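(* Let $\{S_n\}_{n\ge0}$ be the SRRW-RVM with memory sequence $\{\mu_n\}$ (regularly varying of index $\gamma$), recollection probability $p$, and zero mean innovation sequence $\{\xi_n\}_{n\ge1}$ satisfying $\mathbb{E}\xi_1^2=1$. If $p=p_c$ and $\{\mu_n\}$ is such that $\{v_n\}$ is unbounded, then $$\left(\frac{S_{\lfloor nt\rfloor}}{\sigma_n}:t\ge0\right)\to\left(\sqrt t\,(2\gamma+1)Z:t\ge0\right)\quad\text{weakly in }D([0,\infty)),$$ where $Z$ is a standard Gaussian random variable.
   Context: Model (SRRW-RVM). Fix $p\in[0,1]$ (recollection probability) and $\gamma>-1$. Let $\{\mu_n\}_{n\ge1}$ (memory sequence) be a sequence of positive reals, regularly varying of index $\gamma$: $\mu_{\lfloor\lambda n\rfloor}/\mu_n\to\lambda^\gamma$ for every $\lambda>0$. Put $\nu_n=\sum_{k=1}^n\mu_k$. Let $\{\xi_n\}_{n\ge1}$ (innovation sequence) be i.i.d. real random variables with mean $0$; $\{\alpha_n\}_{n\ge2}$ i.i.d. Bernoulli($p$); $\{\beta_n\}_{n\ge2}$ independent with $\mathbb{P}(\beta_n=k)=\mu_k/\nu_{n-1}$ for $1\le k\le n-1$; the three sequences are independent of each other. Set $X_1=\xi_1$ and, for $n\ge1$, $X_{n+1}=\alpha_{n+1}X_{\beta_{n+1}}+(1-\alpha_{n+1})\xi_{n+1}$. The walk is $S_0=0$, $S_n=\sum_{k=1}^nX_k$. Notation. $a_n=\prod_{i=1}^{n-1}\left(1+p\frac{\mu_{i+1}}{\nu_i}\right)^{-1}$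 for $n\ge1$ (so $a_1=1$); $v_n^2=\sum_{k=1}^na_k^2\mu_k^2$ ($v_n\ge0$); $\sigma_n=v_n/(a_n\mu_n)$; $p_c=(\gamma+\frac12)/(\gamma+1)$. $D([0,\infty))$ is the space of r.c.l.l. functions on $[0,\infty)$ with the Skorohod topology. *)

theory Defs
  imports "HOL-Probability.Probability"
begin

section \<open>The space $D([0,\infty))$ with the Skorohod topology\<close>

text \<open>Paths are normalised to be \<open>undefined\<close> off \<open>[0,\<infinity>)\<close> so that equality of paths is equality of
  functions.\<close>

definition skorohod_space :: "(real \<Rightarrow> real) set" where
  "skorohod_space = {x \<in> extensional {0..}.
     (\<forall>t\<ge>0. (x \<longlongrightarrow> x t) (at_right t)) \<and> (\<forall>t>0. \<exists>l. (x \<longlongrightarrow> l) (at_left t))}"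

definition time_changes :: "real \<Rightarrow> (real \<Rightarrow> real) set" where
  "time_changes T = {\<tau>. continuous_on {0..T} \<tau> \<and> strict_mono_on {0..T} \<tau> \<and> \<tau> ` {0..T} = {0..T}}"

text \<open>\<open>min 1 (d\<^sub>T(x, y))\<close>, where \<open>d\<^sub>T\<close> is Skorohod's metric on \<open>D([0,T])\<close>: the infimum of the
  \<open>\<epsilon> > 0\<close> for which some time change \<open>\<tau>\<close> satisfies \<open>sup |\<tau> t - t| \<le> \<epsilon>\<close> and
  \<open>sup |x t - y (\<tau> t)| \<le> \<epsilon>\<close>. Inserting \<open>1\<close> into the set is the truncation at \<open>1\<close>; it also keeps the
  set nonempty.\<close>

definition skorohod_dist_on :: "real \<Rightarrow> (real \<Rightarrow> real) \<Rightarrow> (real \<Rightarrow> real) \<Rightarrow> real" where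
  "skorohod_dist_on T x y = Inf (insert 1 {\<epsilon>. 0 < \<epsilon> \<and>
     (\<exists>\<tau>\<in>time_changes T. \<forall>t\<in>{0..T}. \<bar>\<tau> t - t\<bar> \<le> \<epsilon> \<and> \<bar>x t - y (\<tau> t)\<bar> \<le> \<epsilon>)})"

text \<open>Multiplication by the function that is \<open>1\<close> on \<open>[0,T-1]\<close>, \<open>0\<close> on \<open>[T,\<infinity>)\<close> and linear in
  between. It is needed because plain restriction to \<open>[0,T]\<close> is not continuous at paths that jump at
  \<open>T\<close>.\<close>

definition taper :: "real \<Rightarrow> (real \<Rightarrow> real) \<Rightarrow> real \<Rightarrow> real" where
  "taper T x t = max 0 (min 1 (T - t)) * x t"

text \<open>Billingsley's metric \<open>\<Sum>m\<ge>1. 2\<^sup>-\<^sup>m min 1 (d\<^sub>m(x\<^sup>m, y\<^sup>m))\<close> for the Skorohod topology on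
  \<open>D([0,\<infinity>))\<close>, with \<open>x\<^sup>m\<close> the tapered path (Convergence of Probability Measures, 2nd ed.,
  Section 16).\<close>

definition skorohod_dist :: "(real \<Rightarrow> real) \<Rightarrow> (real \<Rightarrow> real) \<Rightarrow> real" where
  "skorohod_dist x y =
     (\<Sum>m. (1/2) ^ Suc m *
        skorohod_dist_on (real (Suc m)) (taper (real (Suc m)) x) (taper (real (Suc m)) y))"

lemma time_changes_id: "(\<lambda>t. t) \<in> time_changes T"
  by (auto simp: time_changes_def strict_mono_on_def)

lemma time_changesD:
  assumes "\<tau> \<in> time_changes T"
  shows "continuous_on {0..T} \<tau>" "strict_mono_on {0..T} \<tau>" "\<tau> ` {0..T} = {0..T}"
    "t \<in> {0..T} \<Longrightarrow> \<tau> t \<in> {0..T}"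
proof -
  show "continuous_on {0..T} \<tau>" "strict_mono_on {0..T} \<tau>" and im: "\<tau> ` {0..T} = {0..T}"
    using assms unfolding time_changes_def by blast+
  show "\<tau> t \<in> {0..T}" if "t \<in> {0..T}"
    using imageI[OF that, of \<tau>] unfolding im .
qed

lemma time_changes_comp:
  assumes "\<sigma> \<in> time_changes T" "\<tau> \<in> time_changes T"
  shows "(\<lambda>t. \<sigma> (\<tau> t)) \<in> time_changes T"
proof -
  note \<sigma> = time_changesD[OF assms(1)] and \<tau> = time_changesD[OF assms(2)]
  have "continuous_on {0..T} (\<lambda>t. \<sigma> (\<tau> t))"
    by (rule continuous_on_compose2[OF \<sigma>(1) \<tau>(1)]) (simp only: \<tau>(3) order_refl)
  moreover have "strict_mono_on {0..T} (\<lambda>t. \<sigma> (\<tau> t))"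
  proof (rule strict_mono_onI)
    fix r s assume rs: "r \<in> {0..T}" "s \<in> {0..T}" "r < s"
    show "\<sigma> (\<tau> r) < \<sigma> (\<tau> s)"
      by (intro strict_mono_onD[OF \<sigma>(2)] strict_mono_onD[OF \<tau>(2)] \<tau>(4) rs)
  qed
  moreover have "(\<lambda>t. \<sigma> (\<tau> t)) ` {0..T} = {0..T}"
    by (simp only: image_image[of \<sigma> \<tau>, symmetric] \<tau>(3) \<sigma>(3))
  ultimately show ?thesis by (simp add: time_changes_def)
qed

lemma time_changes_inverse:
  assumes "\<tau> \<in> time_changes T"
  obtains \<sigma> where "\<sigma> \<in> time_changes T"
    "\<And>t. t \<in> {0..T} \<Longrightarrow> \<sigma> t \<in> {0..T}" "\<And>t. t \<in> {0..T} \<Longrightarrow> \<tau> (\<sigma> t) = t"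
proof -
  have c: "continuous_on {0..T} \<tau>" and m: "strict_mono_on {0..T} \<tau>"
    and im: "\<tau> ` {0..T} = {0..T}"
    using time_changesD[OF assms] by blast+
  have inj: "inj_on \<tau> {0..T}" using m by (rule strict_mono_on_imp_inj_on)
  define \<sigma> where "\<sigma> = inv_into {0..T} \<tau>"
  have s1: "\<sigma> t \<in> {0..T}" if "t \<in> {0..T}" for t
    unfolding \<sigma>_def using that im by (metis inv_into_into)
  have s2: "\<tau> (\<sigma> t) = t" if "t \<in> {0..T}" for t
    unfolding \<sigma>_def using that im by (metis f_inv_into_f)
  have s3: "\<sigma> (\<tau> t) = t" if "t \<in> {0..T}" for t
    unfolding \<sigma>_def using that inj by (simp add: inv_into_f_f)
  have "continuous_on (\<tau> ` {0..T}) \<sigma>"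
    by (rule continuous_on_inv[OF c]) (use s3 in auto)
  moreover have "strict_mono_on {0..T} \<sigma>"
  proof (rule strict_mono_onI)
    fix r s assume rs: "r \<in> {0..T}" "s \<in> {0..T}" "r < s"
    show "\<sigma> r < \<sigma> s"
    proof (rule ccontr)
      assume "\<not> \<sigma> r < \<sigma> s"
      then have "\<sigma> s \<le> \<sigma> r" by simp
      then have "\<tau> (\<sigma> s) \<le> \<tau> (\<sigma> r)"
        using s1[OF rs(1)] s1[OF rs(2)] m
        by (metis strict_mono_on_leD)
      then show False using s2 rs by auto
    qed
  qed
  moreover have "\<sigma> ` {0..T} = {0..T}"
  proof (intro subset_antisym subsetI)
    show "t \<in> {0..T}" if "t \<in> \<sigma> ` {0..T}" for t
      using that s1 by blast
    show "t \<in> \<sigma> ` {0..T}" if "t \<in> {0..T}" for t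
      using s3[OF that] time_changesD(4)[OF assms that] by (metis image_eqI)
  qed
  ultimately have "\<sigma> \<in> time_changes T" by (simp add: time_changes_def im)
  then show ?thesis using s1 s2 that by blast
qed

lemma skorohod_dist_on_bdd_below:
  "bdd_below (insert 1 {\<epsilon>::real. 0 < \<epsilon> \<and> P \<epsilon>})"
  by (intro bdd_belowI[of _ 0]) auto

lemma skorohod_dist_on_nonneg: "0 \<le> skorohod_dist_on T x y"
  unfolding skorohod_dist_on_def by (rule cInf_greatest) auto

lemma skorohod_dist_on_le_1: "skorohod_dist_on T x y \<le> 1"
  unfolding skorohod_dist_on_def by (rule cInf_lower[OF _ skorohod_dist_on_bdd_below]) simp

lemma skorohod_dist_on_le:
  assumes "0 < \<epsilon>" "\<tau> \<in> time_changes T"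
    "\<And>t. t \<in> {0..T} \<Longrightarrow> \<bar>\<tau> t - t\<bar> \<le> \<epsilon>" "\<And>t. t \<in> {0..T} \<Longrightarrow> \<bar>x t - y (\<tau> t)\<bar> \<le> \<epsilon>"
  shows "skorohod_dist_on T x y \<le> \<epsilon>"
  unfolding skorohod_dist_on_def
proof (rule cInf_lower[OF _ skorohod_dist_on_bdd_below])
  show "\<epsilon> \<in> insert 1 {\<epsilon>. 0 < \<epsilon> \<and>
     (\<exists>\<tau>\<in>time_changes T. \<forall>t\<in>{0..T}. \<bar>\<tau> t - t\<bar> \<le> \<epsilon> \<and> \<bar>x t - y (\<tau> t)\<bar> \<le> \<epsilon>)}"
    by (intro insertI2 CollectI conjI bexI[of _ \<tau>] ballI assms)
qed

lemma skorohod_dist_on_lessD: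
  assumes "skorohod_dist_on T x y < r" "r \<le> 1"
  obtains \<epsilon> \<tau> where "0 < \<epsilon>" "\<epsilon> < r" "\<tau> \<in> time_changes T"
    "\<And>t. t \<in> {0..T} \<Longrightarrow> \<bar>\<tau> t - t\<bar> \<le> \<epsilon>" "\<And>t. t \<in> {0..T} \<Longrightarrow> \<bar>x t - y (\<tau> t)\<bar> \<le> \<epsilon>"
proof -
  obtain \<epsilon> where "\<epsilon> < r" "\<epsilon> = 1 \<or> 0 < \<epsilon> \<and>
     (\<exists>\<tau>\<in>time_changes T. \<forall>t\<in>{0..T}. \<bar>\<tau> t - t\<bar> \<le> \<epsilon> \<and> \<bar>x t - y (\<tau> t)\<bar> \<le> \<epsilon>)"
    using assms(1) unfolding skorohod_dist_on_def
    by (subst (asm) cInf_less_iff[OF _ skorohod_dist_on_bdd_below]) auto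
  with assms(2) that show ?thesis by force
qed

lemma skorohod_dist_on_commute_le: "skorohod_dist_on T y x \<le> skorohod_dist_on T x y"
proof (rule ccontr)
  assume "\<not> ?thesis"
  then have less: "skorohod_dist_on T x y < skorohod_dist_on T y x" by simp
  obtain \<epsilon> \<tau> where e: "0 < \<epsilon>" "\<epsilon> < skorohod_dist_on T y x" "\<tau> \<in> time_changes T"
    "\<And>t. t \<in> {0..T} \<Longrightarrow> \<bar>\<tau> t - t\<bar> \<le> \<epsilon>" "\<And>t. t \<in> {0..T} \<Longrightarrow> \<bar>x t - y (\<tau> t)\<bar> \<le> \<epsilon>"
    using skorohod_dist_on_lessD[OF less skorohod_dist_on_le_1] by metis
  obtain \<sigma> where s: "\<sigma> \<in> time_changes T"
    "\<And>t. t \<in> {0..T} \<Longrightarrow> \<sigma> t \<in> {0..T}" "\<And>t. t \<in> {0..T} \<Longrightarrow> \<tau> (\<sigma> t) = t"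
    using time_changes_inverse[OF e(3)] by metis
  have "skorohod_dist_on T y x \<le> \<epsilon>"
  proof (rule skorohod_dist_on_le[OF e(1) s(1)])
    fix t assume t: "t \<in> {0..T}"
    show "\<bar>\<sigma> t - t\<bar> \<le> \<epsilon>" using e(4)[OF s(2)[OF t]] s(3)[OF t] by (simp add: abs_minus_commute)
    show "\<bar>y t - x (\<sigma> t)\<bar> \<le> \<epsilon>" using e(5)[OF s(2)[OF t]] s(3)[OF t] by (simp add: abs_minus_commute)
  qed
  with e(2) show False by simp
qed

lemma skorohod_dist_on_commute: "skorohod_dist_on T x y = skorohod_dist_on T y x"
  by (intro antisym skorohod_dist_on_commute_le)

lemma skorohod_dist_on_triangle:
  "skorohod_dist_on T x z \<le> skorohod_dist_on T x y + skorohod_dist_on T y z"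
proof (rule field_le_epsilon)
  fix e :: real assume e: "0 < e"
  let ?a = "skorohod_dist_on T x y" and ?b = "skorohod_dist_on T y z"
  show "skorohod_dist_on T x z \<le> ?a + ?b + e"
  proof (cases "?a + e/2 < 1 \<and> ?b + e/2 < 1")
    case True
    obtain \<epsilon> \<tau> where 1: "0 < \<epsilon>" "\<epsilon> < ?a + e/2" "\<tau> \<in> time_changes T"
      "\<And>t. t \<in> {0..T} \<Longrightarrow> \<bar>\<tau> t - t\<bar> \<le> \<epsilon>" "\<And>t. t \<in> {0..T} \<Longrightarrow> \<bar>x t - y (\<tau> t)\<bar> \<le> \<epsilon>"
      using skorohod_dist_on_lessD[of T x y "?a + e/2"] True e by auto
    obtain \<delta> \<sigma> where 2: "0 < \<delta>" "\<delta> < ?b + e/2" "\<sigma> \<in> time_changes T"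
      "\<And>t. t \<in> {0..T} \<Longrightarrow> \<bar>\<sigma> t - t\<bar> \<le> \<delta>" "\<And>t. t \<in> {0..T} \<Longrightarrow> \<bar>y t - z (\<sigma> t)\<bar> \<le> \<delta>"
      using skorohod_dist_on_lessD[of T y z "?b + e/2"] True e by auto
    have "skorohod_dist_on T x z \<le> \<epsilon> + \<delta>"
    proof (rule skorohod_dist_on_le[OF _ time_changes_comp[OF 2(3) 1(3)]])
      fix t assume t: "t \<in> {0..T}"
      then have t': "\<tau> t \<in> {0..T}" by (rule time_changesD(4)[OF 1(3)])
      show "\<bar>\<sigma> (\<tau> t) - t\<bar> \<le> \<epsilon> + \<delta>" using 1(4)[OF t] 2(4)[OF t'] by linarith
      show "\<bar>x t - z (\<sigma> (\<tau> t))\<bar> \<le> \<epsilon> + \<delta>" using 1(5)[OF t] 2(5)[OF t'] by linarith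
    qed (use 1 2 in simp)
    then show ?thesis using 1(2) 2(2) by simp
  next
    case False
    then show ?thesis
      using skorohod_dist_on_le_1[of T x z] skorohod_dist_on_nonneg[of T x y]
        skorohod_dist_on_nonneg[of T y z] e by linarith
  qed
qed

lemma skorohod_dist_on_refl: "skorohod_dist_on T x x = 0"
proof -
  have "skorohod_dist_on T x x \<le> e" if "0 < e" for e
    by (rule skorohod_dist_on_le[OF that time_changes_id]) (use that in simp_all)
  then have "skorohod_dist_on T x x \<le> 0"
    using field_le_epsilon[of "skorohod_dist_on T x x" 0] by simp
  then show ?thesis using skorohod_dist_on_nonneg[of T x x] by simp
qed

lemma skorohod_dist_on_zeroD:
  assumes 0: "skorohod_dist_on T x y = 0" and t: "0 \<le> t" "t < T"
    and x: "(x \<longlongrightarrow> x t) (at_right t)" and y: "(y \<longlongrightarrow> y t) (at_right t)"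
  shows "x t = y t"
proof (rule ccontr)
  assume ne: "x t \<noteq> y t"
  define e where "e = \<bar>x t - y t\<bar> / 4"
  have e: "0 < e" using ne by (simp add: e_def)
  obtain b where b: "b > t" "\<And>s. t < s \<Longrightarrow> s < b \<Longrightarrow> dist (x s) (x t) < e"
    using tendstoD[OF x e] unfolding eventually_at_right_field by auto
  obtain c where c: "c > t" "\<And>s. t < s \<Longrightarrow> s < c \<Longrightarrow> dist (y s) (y t) < e"
    using tendstoD[OF y e] unfolding eventually_at_right_field by auto
  define h where "h = min (min b c) T - t"
  have h: "0 < h" using b c t by (simp add: h_def)
  define r where "r = min 1 (min e (h / 4))"
  have r: "0 < r" "r \<le> 1" "r \<le> e" "r \<le> h/4" using e h by (auto simp: r_def)
  obtain \<epsilon> \<tau> where 1: "0 < \<epsilon>" "\<epsilon> < r"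
      "\<And>t. t \<in> {0..T} \<Longrightarrow> \<bar>\<tau> t - t\<bar> \<le> \<epsilon>" "\<And>t. t \<in> {0..T} \<Longrightarrow> \<bar>x t - y (\<tau> t)\<bar> \<le> \<epsilon>"
  proof -
    have "skorohod_dist_on T x y < r" using 0 r(1) by simp
    then show ?thesis by (rule skorohod_dist_on_lessD[OF _ r(2)]) (rule that)
  qed
  define s where "s = t + h/2"
  have hh: "h \<le> b - t" "h \<le> c - t" "h \<le> T - t" by (auto simp: h_def)
  have s: "s \<in> {0..T}" "t < s" "s < b" using hh h t unfolding s_def by (auto simp: field_simps)
  have s': "t < \<tau> s" "\<tau> s < c"
    using 1(3)[OF s(1)] 1(2) r(4) hh h unfolding s_def by (auto simp: field_simps)
  have "\<bar>x t - y t\<bar> \<le> \<bar>x s - x t\<bar> + \<bar>x s - y (\<tau> s)\<bar> + \<bar>y (\<tau> s) - y t\<bar>" by linarith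
  also have "\<dots> < 3 * e"
    using b(2)[OF s(2,3)] c(2)[OF s'] 1(4)[OF s(1)] 1(2) r(3) by (simp add: dist_real_def)
  finally show False using e by (simp add: e_def)
qed

lemma taper_right_continuous:
  assumes "(x \<longlongrightarrow> x t) (at_right t)"
  shows "(taper T x \<longlongrightarrow> taper T x t) (at_right t)"
  unfolding taper_def by (intro tendsto_intros assms)

lemma skorohod_dist_summable:
  "summable (\<lambda>m. (1/2) ^ Suc m *
     skorohod_dist_on (real (Suc m)) (taper (real (Suc m)) x) (taper (real (Suc m)) y))"
proof (rule summable_comparison_test')
  show "summable (\<lambda>m. (1/2::real) ^ Suc m)" by (subst summable_Suc_iff) (simp add: summable_geometric)
  fix m :: nat
  show "norm ((1/2) ^ Suc m *
     skorohod_dist_on (real (Suc m)) (taper (real (Suc m)) x) (taper (real (Suc m)) y)) \<le> (1/2) ^ Suc m"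
    using skorohod_dist_on_nonneg skorohod_dist_on_le_1
    by (simp add: abs_mult mult_left_le del: power_Suc of_nat_Suc)
qed

lemma Metric_space_skorohod: "Metric_space skorohod_space skorohod_dist"
proof
  fix x y :: "real \<Rightarrow> real"
  show "0 \<le> skorohod_dist x y" unfolding skorohod_dist_def
    by (intro suminf_nonneg skorohod_dist_summable mult_nonneg_nonneg skorohod_dist_on_nonneg) simp
  show "skorohod_dist x y = skorohod_dist y x" unfolding skorohod_dist_def
    by (subst skorohod_dist_on_commute) (rule refl)
next
  fix x y assume xy: "x \<in> skorohod_space" "y \<in> skorohod_space"
  show "skorohod_dist x y = 0 \<longleftrightarrow> x = y"
  proof
    assume "x = y"
    then show "skorohod_dist x y = 0" by (simp add: skorohod_dist_def skorohod_dist_on_refl)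
  next
    assume 0: "skorohod_dist x y = 0"
    have z: "skorohod_dist_on (real (Suc m)) (taper (real (Suc m)) x) (taper (real (Suc m)) y) = 0" for m
    proof -
      have "(1/2) ^ Suc m * skorohod_dist_on (real (Suc m)) (taper (real (Suc m)) x) (taper (real (Suc m)) y) = 0"
        using 0 unfolding skorohod_dist_def
        by (subst (asm) suminf_eq_zero_iff[OF skorohod_dist_summable])
           (auto intro!: mult_nonneg_nonneg skorohod_dist_on_nonneg simp del: power_Suc of_nat_Suc)
      then show ?thesis by simp
    qed
    have "x t = y t" if t: "0 \<le> t" for t
    proof -
      define m where "m = nat \<lceil>t\<rceil>"
      have m: "t \<le> real m" unfolding m_def by linarith
      have "taper (real (Suc m)) x t = taper (real (Suc m)) y t"
        by (rule skorohod_dist_on_zeroD[OF z t])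
           (use xy t m in \<open>auto intro!: taper_right_continuous simp: skorohod_space_def\<close>)
      then show ?thesis using m by (simp add: taper_def)
    qed
    then show "x = y" using xy
      by (intro extensionalityI[of x "{0..}" y]) (auto simp: skorohod_space_def)
  qed
next
  fix x y z :: "real \<Rightarrow> real"
  show "skorohod_dist x z \<le> skorohod_dist x y + skorohod_dist y z"
    unfolding skorohod_dist_def suminf_add[OF skorohod_dist_summable skorohod_dist_summable]
      distrib_left[symmetric]
  proof (rule suminf_le[OF _ skorohod_dist_summable])
    show "summable (\<lambda>m. (1/2) ^ Suc m *
       (skorohod_dist_on (real (Suc m)) (taper (real (Suc m)) x) (taper (real (Suc m)) y) +
        skorohod_dist_on (real (Suc m)) (taper (real (Suc m)) y) (taper (real (Suc m)) z)))"
      unfolding distrib_left by (intro summable_add skorohod_dist_summable)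
  qed (intro mult_left_mono skorohod_dist_on_triangle, simp)
qed

definition skorohod_topology :: "(real \<Rightarrow> real) topology" where
  "skorohod_topology = Metric_space.mtopology skorohod_space skorohod_dist"


section \<open>Weak convergence of random elements of a topological space\<close>

definition borel_sigma :: "'b topology \<Rightarrow> 'b measure" where
  "borel_sigma T = sigma (topspace T) {U. openin T U}"

text \<open>The random elements \<open>Y n\<close> are defined on a common probability space \<open>M\<close>, the limit \<open>Y'\<close> on a
  possibly different one \<open>N\<close>. Measurability is part of the notion: otherwise the integrals below
  could be the default value \<open>0\<close>.\<close>

definition converges_weakly ::
    "'b topology \<Rightarrow> 'a measure \<Rightarrow> (nat \<Rightarrow> 'a \<Rightarrow> 'b) \<Rightarrow> 'c measure \<Rightarrow> ('c \<Rightarrow> 'b) \<Rightarrow> bool" where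
  "converges_weakly T M Y N Y' \<longleftrightarrow>
     (\<forall>n. Y n \<in> measurable M (borel_sigma T)) \<and> Y' \<in> measurable N (borel_sigma T) \<and>
     (\<forall>f. continuous_map T euclideanreal f \<longrightarrow> bounded (f ` topspace T) \<longrightarrow>
        (\<lambda>n. \<integral>\<omega>. f (Y n \<omega>) \<partial>M) \<longlonglongrightarrow> (\<integral>\<omega>. f (Y' \<omega>) \<partial>N))"


section \<open>The step-reinforced random walk with regularly varying memory\<close>

definition regularly_varying_seq :: "real \<Rightarrow> (nat \<Rightarrow> real) \<Rightarrow> bool" where
  "regularly_varying_seq \<gamma> \<mu> \<longleftrightarrow>
     (\<forall>c>0. (\<lambda>n. \<mu> (nat \<lfloor>c * real n\<rfloor>) / \<mu> n) \<longlonglongrightarrow> c powr \<gamma>)"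

definition memory_sum :: "(nat \<Rightarrow> real) \<Rightarrow> nat \<Rightarrow> real" where
  "memory_sum \<mu> n = (\<Sum>k=1..n. \<mu> k)"

text \<open>The family of all the variables driving the walk, with \<open>\<alpha>\<close> and \<open>\<beta>\<close> embedded in the reals since
  \<open>indep_vars\<close> needs a common value type.\<close>

definition driving_family ::
    "(nat \<Rightarrow> 'a \<Rightarrow> real) \<Rightarrow> (nat \<Rightarrow> 'a \<Rightarrow> bool) \<Rightarrow> (nat \<Rightarrow> 'a \<Rightarrow> nat) \<Rightarrow> nat + nat + nat \<Rightarrow> 'a \<Rightarrow> real" where
  "driving_family \<xi> \<alpha> \<beta> i = (case i of
       Inl n \<Rightarrow> \<xi> n
     | Inr (Inl n) \<Rightarrow> (\<lambda>\<omega>. of_bool (\<alpha> n \<omega>))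
     | Inr (Inr n) \<Rightarrow> (\<lambda>\<omega>. real (\<beta> n \<omega>)))"

text \<open>All sequences are indexed by \<open>nat\<close>; \<open>\<mu>\<close>, \<open>\<xi>\<close>, \<open>X\<close> are meaningful from index \<open>1\<close> on, \<open>\<alpha>\<close> and
  \<open>\<beta>\<close> from index \<open>2\<close> on. Mutual independence of the whole driving family expresses that each of the
  three sequences consists of independent variables and that the three sequences are independent of
  each other. The law of \<open>\<beta> n\<close> confines it to \<open>{1..n-1}\<close> only almost surely, hence so is the
  recursion for \<open>X\<close>.\<close>

locale srrw_rvm = prob_space M
  for M :: "'a measure" +
  fixes p \<gamma> :: real and \<mu> :: "nat \<Rightarrow> real"
    and \<xi> :: "nat \<Rightarrow> 'a \<Rightarrow> real" and \<alpha> :: "nat \<Rightarrow> 'a \<Rightarrow> bool" and \<beta> :: "nat \<Rightarrow> 'a \<Rightarrow> nat"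
    and X :: "nat \<Rightarrow> 'a \<Rightarrow> real"
  assumes p_range: "0 \<le> p" "p \<le> 1"
    and \<gamma>_range: "\<gamma> > -1"
    and \<mu>_pos: "\<And>n. n \<ge> 1 \<Longrightarrow> \<mu> n > 0"
    and \<mu>_regularly_varying: "regularly_varying_seq \<gamma> \<mu>"
    and \<xi>_measurable: "\<And>n. n \<ge> 1 \<Longrightarrow> random_variable borel (\<xi> n)"
    and \<xi>_identical: "\<And>n. n \<ge> 1 \<Longrightarrow> distr M borel (\<xi> n) = distr M borel (\<xi> 1)"
    and \<xi>_integrable: "integrable M (\<xi> 1)"
    and \<xi>_mean: "expectation (\<xi> 1) = 0"
    and \<alpha>_measurable: "\<And>n. n \<ge> 2 \<Longrightarrow> random_variable (count_space UNIV) (\<alpha> n)"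
    and \<alpha>_law: "\<And>n. n \<ge> 2 \<Longrightarrow> distr M (count_space UNIV) (\<alpha> n) = measure_pmf (bernoulli_pmf p)"
    and \<beta>_measurable: "\<And>n. n \<ge> 2 \<Longrightarrow> random_variable (count_space UNIV) (\<beta> n)"
    and \<beta>_law: "\<And>n k. n \<ge> 2 \<Longrightarrow> 1 \<le> k \<Longrightarrow> k \<le> n - 1 \<Longrightarrow>
      prob {\<omega> \<in> space M. \<beta> n \<omega> = k} = \<mu> k / memory_sum \<mu> (n - 1)"
    and independent: "indep_vars (\<lambda>_. borel) (driving_family \<xi> \<alpha> \<beta>) ({1..} <+> {2..} <+> {2..})"
    and X_measurable: "\<And>n. n \<ge> 1 \<Longrightarrow> random_variable borel (X n)"
    and X_1: "AE \<omega> in M. X 1 \<omega> = \<xi> 1 \<omega>"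
    and X_Suc: "\<And>n. n \<ge> 1 \<Longrightarrow> AE \<omega> in M. X (n + 1) \<omega> =
      of_bool (\<alpha> (n + 1) \<omega>) * X (\<beta> (n + 1) \<omega>) \<omega> + (1 - of_bool (\<alpha> (n + 1) \<omega>)) * \<xi> (n + 1) \<omega>"

definition walk :: "(nat \<Rightarrow> 'a \<Rightarrow> real) \<Rightarrow> nat \<Rightarrow> 'a \<Rightarrow> real" where
  "walk X n \<omega> = (\<Sum>k=1..n. X k \<omega>)"

definition a_seq :: "real \<Rightarrow> (nat \<Rightarrow> real) \<Rightarrow> nat \<Rightarrow> real" where
  "a_seq p \<mu> n = (\<Prod>i=1..<n. inverse (1 + p * (\<mu> (i + 1) / memory_sum \<mu> i)))"

definition v_seq :: "real \<Rightarrow> (nat \<Rightarrow> real) \<Rightarrow> nat \<Rightarrow> real" where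
  "v_seq p \<mu> n = sqrt (\<Sum>k=1..n. (a_seq p \<mu> k)\<^sup>2 * (\<mu> k)\<^sup>2)"

definition \<sigma>_seq :: "real \<Rightarrow> (nat \<Rightarrow> real) \<Rightarrow> nat \<Rightarrow> real" where
  "\<sigma>_seq p \<mu> n = v_seq p \<mu> n / (a_seq p \<mu> n * \<mu> n)"

definition critical_p :: "real \<Rightarrow> real" where
  "critical_p \<gamma> = (\<gamma> + 1/2) / (\<gamma> + 1)"

end

theory Submission
  imports Defs "HOL-Real_Asymp.Real_Asymp"
begin

text \<open>With \<open>U\<^sub>n = \<Sum>k\<le>n. \<mu>\<^sub>k X\<^sub>k\<close> the process \<open>M\<^sub>n = a\<^sub>n U\<^sub>n\<close> is a martingale with \<open>E M\<^sub>n\<^sup>2 \<le> v\<^sub>n\<^sup>2\<close>, and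
  \<open>S\<^sub>n = N\<^sub>n + p \<Sum>k<n. M\<^sub>k / (a\<^sub>k \<nu>\<^sub>k)\<close> with a martingale \<open>N\<^sub>n\<close> such that \<open>E N\<^sub>n\<^sup>2 \<le> n\<close>. At the critical
  point \<open>v\<^sub>n\<^sup>2\<close> is a slowly varying divergent sum of larger order than \<open>n a\<^sub>n\<^sup>2 \<mu>\<^sub>n\<^sup>2\<close>. Hence \<open>N\<close> is negligible
  on the scale \<open>\<sigma>\<^sub>n\<close> by the maximal inequality, and \<open>M\<^sub>k\<close> may be replaced by \<open>M\<^sub>n\<close> for \<open>k \<le> T n\<close>. As
  \<open>1 / (a\<^sub>k \<nu>\<^sub>k)\<close> is regularly varying of index \<open>-1/2\<close>, Karamata's theorem turns the remaining sum into
  \<open>(2\<gamma> + 1) \<surd>t\<close> times \<open>M\<^sub>n / v\<^sub>n\<close>, uniformly in \<open>t \<le> T\<close>. Finally \<open>M\<^sub>n / v\<^sub>n\<close> is asymptotically normal: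
  every \<open>X\<^sub>n\<close> has the law of \<open>\<xi>\<^sub>1\<close> and the conditional variances converge to \<open>1\<close> in \<open>L\<^sup>1\<close>, so the
  characteristic functions satisfy the Gaussian recursion up to errors with vanishing sum.\<close>


text \<open>The limit is degenerate: a single Gaussian variable carries all its randomness. Since
  \<open>v2\<close>, the square of v_n, varies slowly, the variance that the martingale gains
  between s*n and T*n is negligible against the total. No tightness criterion for paths is needed: a
  one-dimensional limit for \<open>W n\<close> = M_n / v_n, closeness to the path with slope
  \<open>W n\<close> off small events, and compactness of the limit paths with bounded slope
  suffice. Replacing M_k by M_n is not controlled for k of smaller order than n. The indices k <=
  s*n carry a total weight of order \<open>sqrt s\<close>, so the sum is split there. The limiting
  factor is p * 2 * (\<gamma> + 1): 2 is Karamata's 1 / (1 - 1/2), \<gamma> + 1 is the limit of n *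
  \<mu> n / \<nu> n, and criticality turns the product into 2 * \<gamma> + 1. The steps repeat
  earlier values, so the conditional second moment of a step is an affine function of a weighted
  average of past squares and needs its own law of large numbers. Each error in the Gaussian
  recursion is a squared coefficient times a small factor; the squared coefficients have bounded
  sum, so small factors are enough.\<close>

section \<open>Slowly varying sequences\<close>

text \<open>A regularly varying sequence of index \<open>\<gamma>\<close> is \<open>n powr \<gamma>\<close> times a sequence of the following
  kind; all asymptotics below rest on this uniform control over \<open>[n, 2n]\<close>.\<close>

definition slowly_osc :: "(nat \<Rightarrow> real) \<Rightarrow> bool" where
  "slowly_osc L \<longleftrightarrow> (\<forall>n\<ge>1. 0 < L n) \<and>
     (\<forall>e>0. \<exists>N. \<forall>n\<ge>N. \<forall>m. n \<le> m \<longrightarrow> m \<le> 2 * n \<longrightarrow> \<bar>ln (L m) - ln (L n)\<bar> \<le> e)"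

lemma slowly_osc_pos: "slowly_osc L \<Longrightarrow> 1 \<le> n \<Longrightarrow> 0 < L n"
  by (auto simp: slowly_osc_def)

lemma nat_floor_ratio:
  assumes "0 \<le> c"
  shows "(\<lambda>n. real (nat \<lfloor>c * real n\<rfloor>) / real n) \<longlonglongrightarrow> c"
proof (rule tendsto_sandwich[of "\<lambda>n. c - 1 / real n" _ _ "\<lambda>n. c"])
  have e: "eventually (\<lambda>n::nat. n > 0) sequentially" by (rule eventually_gt_at_top)
  have nf: "real (nat \<lfloor>c * real n\<rfloor>) = of_int \<lfloor>c * real n\<rfloor>" for n
    using assms by (simp add: of_nat_nat)
  show "eventually (\<lambda>n. c - 1 / real n \<le> real (nat \<lfloor>c * real n\<rfloor>) / real n) sequentially"
    using e
  proof eventually_elim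
    case (elim n)
    have "c * real n - 1 \<le> real (nat \<lfloor>c * real n\<rfloor>)" unfolding nf by linarith
    then have "(c * real n - 1) / real n \<le> real (nat \<lfloor>c * real n\<rfloor>) / real n"
      by (intro divide_right_mono) auto
    then show ?case using elim by (simp add: diff_divide_distrib)
  qed
  show "eventually (\<lambda>n. real (nat \<lfloor>c * real n\<rfloor>) / real n \<le> c) sequentially"
    using e by eventually_elim (simp add: nf field_simps)
  show "(\<lambda>n. c - 1 / real n) \<longlonglongrightarrow> c" by real_asymp
qed simp

lemma nat_floor_at_top:
  assumes "0 < c"
  shows "filterlim (\<lambda>n. nat \<lfloor>c * real n\<rfloor>) at_top sequentially"
proof -
  have "filterlim (\<lambda>n. c * real n) at_top sequentially" using assms by real_asymp
  then show ?thesis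
    by (rule filterlim_compose[OF filterlim_nat_sequentially filterlim_compose[OF filterlim_floor_sequentially]])
qed

text \<open>Uniform convergence from pointwise convergence: the set \<open>E N\<close> of those \<open>c\<close> in \<open>[1, 4]\<close> for which
  \<open>h \<lfloor>c n\<rfloor>\<close> is close to \<open>h n\<close> for all \<open>n \<ge> N\<close> has almost full Lebesgue measure. So for
  \<open>N \<le> n \<le> m \<le> 2 n\<close> and \<open>r = m / n\<close> there is a \<open>c\<close> with both \<open>c\<close> and \<open>r c\<close> in \<open>E N\<close>; as
  \<open>r c n = c m\<close>, both \<open>h m\<close> and \<open>h n\<close> are close to the same value.\<close>

lemma regularly_varying_imp_slowly_osc:
  assumes rv: "regularly_varying_seq g \<mu>" and pos: "\<And>n. n \<ge> 1 \<Longrightarrow> \<mu> n > 0"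
  shows "slowly_osc (\<lambda>n. \<mu> n / real n powr g)"
proof -
  define h where "h n = ln (\<mu> n) - g * ln (real n)" for n
  have h_eq: "ln (\<mu> n / real n powr g) = h n" if "n \<ge> 1" for n
    using that pos[OF that] by (simp add: h_def ln_div ln_powr)
  have pt: "(\<lambda>n. h (nat \<lfloor>c * real n\<rfloor>) - h n) \<longlonglongrightarrow> 0" if c: "c > 0" for c
  proof -
    have "(\<lambda>n. ln (\<mu> (nat \<lfloor>c * real n\<rfloor>) / \<mu> n) - g * ln (real (nat \<lfloor>c * real n\<rfloor>) / real n))
       \<longlonglongrightarrow> ln (c powr g) - g * ln c"
      using rv c unfolding regularly_varying_seq_def
      by (intro tendsto_intros nat_floor_ratio) auto
    moreover have "ln (c powr g) - g * ln c = 0" using c by (simp add: ln_powr)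
    moreover have "eventually (\<lambda>n. nat \<lfloor>c * real n\<rfloor> \<ge> 1) sequentially"
      using nat_floor_at_top[OF c] by (simp add: filterlim_at_top)
    then have "eventually (\<lambda>n. ln (\<mu> (nat \<lfloor>c * real n\<rfloor>) / \<mu> n) - g * ln (real (nat \<lfloor>c * real n\<rfloor>) / real n)
       = h (nat \<lfloor>c * real n\<rfloor>) - h n) sequentially"
      using eventually_ge_at_top[of 1]
    proof eventually_elim
      case (elim n)
      have "ln (\<mu> (nat \<lfloor>c * real n\<rfloor>) / \<mu> n) = ln (\<mu> (nat \<lfloor>c * real n\<rfloor>)) - ln (\<mu> n)"
        using elim pos[of n] pos[of "nat \<lfloor>c * real n\<rfloor>"] by (intro ln_divide_pos) auto
      moreover have "ln (real (nat \<lfloor>c * real n\<rfloor>) / real n) = ln (real (nat \<lfloor>c * real n\<rfloor>)) - ln (real n)"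
        using elim by (intro ln_divide_pos) linarith+
      ultimately show ?case by (simp add: h_def right_diff_distrib)
    qed
    ultimately show ?thesis by (auto dest: Lim_transform_eventually)
  qed
  have "\<exists>N. \<forall>n\<ge>N. \<forall>m. n \<le> m \<longrightarrow> m \<le> 2 * n \<longrightarrow> \<bar>h m - h n\<bar> \<le> e" if e: "e > 0" for e
  proof -
    define E where "E N = {c\<in>{1..4}. \<forall>n\<ge>N. \<bar>h (nat \<lfloor>c * real n\<rfloor>) - h n\<bar> \<le> e/2}" for N
    have meas: "E N \<in> sets lborel" for N
    proof -
      have [measurable]: "h \<in> borel_measurable (count_space UNIV)" by simp
      have "{c\<in>space lborel. c \<in> {1..4} \<and> (\<forall>n\<in>{N..}. \<bar>h (nat \<lfloor>c * real n\<rfloor>) - h n\<bar> \<le> e/2)} \<in> sets lborel"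
        by measurable
      then show ?thesis by (simp add: E_def conj_commute Ball_def)
    qed
    have mono: "incseq E" by (auto simp: incseq_def E_def)
    have U: "(\<Union>N. E N) = {1..4}"
    proof safe
      fix c :: real assume c: "c \<in> {1..4}"
      then have "c > 0" by simp
      from tendstoD[OF pt[OF this], of "e/2"] e obtain N
        where "\<And>n. n \<ge> N \<Longrightarrow> \<bar>h (nat \<lfloor>c * real n\<rfloor>) - h n\<bar> < e/2"
        by (auto simp: eventually_sequentially dist_real_def)
      with c show "c \<in> (\<Union>N. E N)" by (force simp: E_def)
    qed (auto simp: E_def)
    have "(\<lambda>N. measure lborel (E N)) \<longlonglongrightarrow> measure lborel (\<Union>N. E N)"
      by (rule Lim_measure_incseq) (use meas mono in \<open>auto simp: U\<close>)
    then have "(\<lambda>N. measure lborel (E N)) \<longlonglongrightarrow> 3" by (simp add: U)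
    \<comment> \<open>Measure 5/2 out of 3 leaves a complement \<open>B\<close> of measure below
      1/2. The preimage of \<open>B\<close> under multiplication by \<open>r \<ge> 1\<close> is no
      larger, so the two cannot cover \<open>{1..2}\<close>; for \<open>c\<close> in that interval
      both \<open>c\<close> and \<open>r * c\<close> stay in \<open>{1..4}\<close>.\<close>
    then have "eventually (\<lambda>N. measure lborel (E N) > 5/2) sequentially"
      by (rule order_tendstoD) simp
    then obtain N where N: "measure lborel (E N) > 5/2" by (auto simp: eventually_sequentially)
    define B where "B = {1..4} - E N"
    have B_meas[measurable]: "B \<in> sets lborel" using meas by (auto simp: B_def)
    have "emeasure lborel B \<le> emeasure lborel {1..4::real}" by (intro emeasure_mono) (auto simp: B_def)
    then have B_fin: "emeasure lborel B < \<infinity>" by (simp add: le_less_trans)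
    have mB: "measure lborel B < 1/2"
    proof -
      have "measure lborel B = measure lborel {1..4::real} - measure lborel (E N)"
        unfolding B_def by (intro measure_Diff meas) (auto simp: E_def)
      then show ?thesis using N by simp
    qed
    have "\<bar>h m - h n\<bar> \<le> e" if n: "n \<ge> max N 1" and m: "n \<le> m" "m \<le> 2 * n" for n m
    proof -
      define r where "r = real m / real n"
      have r: "1 \<le> r" "r \<le> 2" using n m by (auto simp: r_def field_simps)
      define C where "C = (\<lambda>x. r * x) -` B"
      have C_meas: "C \<in> sets lborel" unfolding C_def
        using measurable_sets_borel[of "\<lambda>x. r * x" borel B] B_meas by simp
      have eB: "emeasure lborel B = ennreal (measure lborel B)"
        using B_fin by (intro emeasure_eq_ennreal_measure) auto
      have "emeasure lborel C = emeasure (distr lborel borel ((*) r)) B"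
        using B_meas by (simp add: C_def emeasure_distr)
      also have "\<dots> = emeasure (density lborel (\<lambda>_. ennreal (inverse \<bar>r\<bar>))) B"
        using r by (subst lborel_distr_mult) auto
      also have "\<dots> = ennreal (inverse \<bar>r\<bar>) * emeasure lborel B"
        using B_meas by (simp add: emeasure_density_const)
      also have "\<dots> = ennreal (inverse r * measure lborel B)"
        using r by (subst eB, subst ennreal_mult[symmetric]) auto
      finally have eC: "emeasure lborel C = ennreal (inverse r * measure lborel B)" .
      then have C_fin: "emeasure lborel C < \<infinity>" by simp
      have "measure lborel C = inverse r * measure lborel B"
        using r by (simp add: measure_def[of _ C] eC)
      also have "\<dots> \<le> 1 * measure lborel B"
        using r by (intro mult_right_mono) (auto simp: inverse_le_1_iff)
      finally have mC: "measure lborel C \<le> measure lborel B" by simp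
      have "\<exists>c\<in>{1..2}. c \<in> E N \<and> r * c \<in> E N"
      proof (rule ccontr)
        assume no: "\<not> ?thesis"
        have "{1..2} \<subseteq> B \<union> C"
        proof
          fix c :: real assume c: "c \<in> {1..2}"
          have "1 \<le> r * c" "r * c \<le> 4" using mult_mono[of 1 r 1 c] mult_mono[of r 2 c 2] r c by auto
          then show "c \<in> B \<union> C" using no c by (auto simp: B_def C_def)
        qed
        then have "measure lborel {1..2::real} \<le> measure lborel (B \<union> C)"
          using B_meas C_meas B_fin C_fin
          by (intro measure_mono_fmeasurable fmeasurable.Un fmeasurableI) auto
        also have "\<dots> \<le> measure lborel B + measure lborel C"
          using B_meas C_meas by (intro measure_Un_le) auto
        finally show False using mB mC by simp
      qed
      then obtain c where c: "c \<in> {1..2}" "c \<in> E N" "r * c \<in> E N" by blast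
      have "r * c * real n = c * real m" using n by (simp add: r_def)
      moreover have "\<bar>h (nat \<lfloor>r * c * real n\<rfloor>) - h n\<bar> \<le> e/2" using c(3) n unfolding E_def by simp
      ultimately have "\<bar>h (nat \<lfloor>c * real m\<rfloor>) - h n\<bar> \<le> e/2" by (simp only:)
      moreover have "\<bar>h (nat \<lfloor>c * real m\<rfloor>) - h m\<bar> \<le> e/2" using c(2) n m unfolding E_def by auto
      ultimately show ?thesis by linarith
    qed
    then show ?thesis by blast
  qed
  note main = this
  show ?thesis unfolding slowly_osc_def
  proof (intro conjI allI impI)
    fix n :: nat assume "1 \<le> n" then show "0 < \<mu> n / real n powr g" using pos by simp
  next
    fix e :: real assume "e > 0"
    from main[OF this] obtain N where N: "\<forall>n\<ge>N. \<forall>m. n \<le> m \<longrightarrow> m \<le> 2 * n \<longrightarrow> \<bar>h m - h n\<bar> \<le> e" by blast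
    show "\<exists>N. \<forall>n\<ge>N. \<forall>m. n \<le> m \<longrightarrow> m \<le> 2 * n \<longrightarrow>
        \<bar>ln (\<mu> m / real m powr g) - ln (\<mu> n / real n powr g)\<bar> \<le> e"
      using N by (intro exI[of _ "max N 1"]) (auto simp: h_eq)
  qed
qed

section \<open>Potter bounds and Karamata's theorem for sums of index above -1\<close>

lemma slowly_osc_potter:
  assumes L: "slowly_osc L" and e: "e > 0"
  obtains N where "N \<ge> 1" "\<And>n m. N \<le> n \<Longrightarrow> n \<le> m \<Longrightarrow> \<bar>ln (L m) - ln (L n)\<bar> \<le> e * (1 + ln (real m / real n))"
proof -
  \<comment> \<open>Each doubling of \<open>n\<close> costs at most \<open>d\<close> and lowers
    \<open>e * ln (real m / real n)\<close> by exactly \<open>d\<close>. The summand 1 in the bound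
    pays for the last incomplete doubling, since \<open>d \<le> e\<close>.\<close>
  define d where "d = e * ln 2"
  have ln2: "0 < ln (2::real)" "ln (2::real) \<le> 1" using ln_le_minus_one[of 2] by auto
  have d: "d > 0" "d \<le> e" using e ln2 by (auto simp: d_def mult_left_le)
  obtain N where N: "\<forall>n\<ge>N. \<forall>m. n \<le> m \<longrightarrow> m \<le> 2 * n \<longrightarrow> \<bar>ln (L m) - ln (L n)\<bar> \<le> d"
    using L d unfolding slowly_osc_def by blast
  have "\<bar>ln (L m) - ln (L n)\<bar> \<le> e * (1 + ln (real m / real n))" if "max N 1 \<le> n" "n \<le> m" for n m
    using that
  proof (induction "m - n" arbitrary: n rule: less_induct)
    case less
    show ?case
    proof (cases "m \<le> 2 * n")
      case True
      then have "\<bar>ln (L m) - ln (L n)\<bar> \<le> d" using N less.prems by auto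
      moreover have "ln (real m / real n) \<ge> 0" using less.prems by (intro ln_ge_zero) (auto simp: field_simps)
      then have "0 \<le> e * ln (real m / real n)" using e by simp
      ultimately show ?thesis using d by (simp add: distrib_left)
    next
      case False
      have "\<bar>ln (L m) - ln (L (2*n))\<bar> \<le> e * (1 + ln (real m / real (2*n)))"
        using less.prems False by (intro less.hyps) auto
      moreover have "\<bar>ln (L (2*n)) - ln (L n)\<bar> \<le> d" using N less.prems by auto
      moreover have ln_eq: "ln (real m / real (2*n)) = ln (real m / real n) - ln 2"
        using less.prems False by (simp add: ln_div ln_mult)
      have "e * (1 + ln (real m / real (2*n))) = e * (1 + ln (real m / real n)) - d"
        unfolding ln_eq by (simp add: d_def algebra_simps)
      ultimately show ?thesis by linarith
    qed
  qed
  then show ?thesis by (intro that[of "max N 1"]) auto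
qed

text \<open>Toeplitz's lemma: the terms before \<open>N\<close> form a fixed sum, which the
  divergent total weight absorbs, and the later ones average to less than
  \<open>r/2\<close>.\<close>

lemma weighted_average_tendsto_0:
  fixes c x :: "nat \<Rightarrow> real"
  assumes c: "\<And>k. 1 \<le> k \<Longrightarrow> 0 \<le> c k" and C: "filterlim (\<lambda>n. \<Sum>k=1..n. c k) at_top sequentially"
    and x: "x \<longlonglongrightarrow> 0"
  shows "(\<lambda>n. (\<Sum>k=1..n. c k * x k) / (\<Sum>k=1..n. c k)) \<longlonglongrightarrow> 0"
proof (rule LIMSEQ_I)
  fix r :: real assume r: "0 < r"
  let ?C = "\<lambda>n. \<Sum>k=1..n. c k"
  from LIMSEQ_D[OF x, of "r/2"] r obtain N where N: "\<And>k. k \<ge> N \<Longrightarrow> \<bar>x k\<bar> < r/2" by auto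
  define A where "A = (\<Sum>k=1..<N. c k * \<bar>x k\<bar>)"
  have "((\<lambda>n. A / ?C n) \<longlongrightarrow> 0) sequentially"
    by (rule real_tendsto_divide_at_top[OF tendsto_const C])
  then have "eventually (\<lambda>n. A / ?C n < r/2) sequentially" using r by (intro order_tendstoD) auto
  moreover have "eventually (\<lambda>n. ?C n > 0) sequentially" using C by (simp add: filterlim_at_top_dense)
  ultimately have "eventually (\<lambda>n. norm ((\<Sum>k=1..n. c k * x k) / ?C n - 0) < r) sequentially"
    using eventually_ge_at_top[of N]
  proof eventually_elim
    case (elim n)
    have "\<bar>\<Sum>k=1..n. c k * x k\<bar> \<le> (\<Sum>k=1..n. c k * \<bar>x k\<bar>)"
      by (rule order_trans[OF sum_abs]) (auto intro!: sum_mono simp: abs_mult c)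
    also have "\<dots> \<le> (\<Sum>k=1..n. (if k < N then c k * \<bar>x k\<bar> else 0) + c k * (r/2))"
    proof (rule sum_mono)
      fix k assume k: "k \<in> {1..n}"
      show "c k * \<bar>x k\<bar> \<le> (if k < N then c k * \<bar>x k\<bar> else 0) + c k * (r/2)"
      proof (cases "k < N")
        case False
        then have "c k * \<bar>x k\<bar> \<le> c k * (r/2)" using N[of k] c[of k] k by (intro mult_left_mono) auto
        then show ?thesis using False by simp
      qed (use c[of k] k r in auto)
    qed
    also have "\<dots> = (\<Sum>k\<in>{1..n} \<inter> {k. k < N}. c k * \<bar>x k\<bar>) + ?C n * (r/2)"
      by (simp add: sum.distrib sum_distrib_right sum.If_cases)
    also have "{1..n} \<inter> {k. k < N} = {1..<N}" using elim by auto
    finally have "\<bar>\<Sum>k=1..n. c k * x k\<bar> / ?C n \<le> A / ?C n + r/2"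
      using elim by (simp add: A_def field_simps)
    then have "\<bar>\<Sum>k=1..n. c k * x k\<bar> / ?C n < r" using elim(1) by linarith
    then show ?case using elim by simp
  qed
  then show "\<exists>n0. \<forall>n\<ge>n0. norm ((\<Sum>k=1..n. c k * x k) / ?C n - 0) < r"
    by (simp add: eventually_sequentially)
qed

lemma weighted_average_tendsto:
  fixes c x :: "nat \<Rightarrow> real"
  assumes c: "\<And>k. 1 \<le> k \<Longrightarrow> 0 \<le> c k" and C: "filterlim (\<lambda>n. \<Sum>k=1..n. c k) at_top sequentially"
    and x: "x \<longlonglongrightarrow> l"
  shows "(\<lambda>n. (\<Sum>k=1..n. c k * x k) / (\<Sum>k=1..n. c k)) \<longlonglongrightarrow> l"
proof -
  let ?C = "\<lambda>n. \<Sum>k=1..n. c k"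
  have "(\<lambda>n. (\<Sum>k=1..n. c k * (x k - l)) / ?C n + l) \<longlonglongrightarrow> 0 + l"
    using x by (intro tendsto_add weighted_average_tendsto_0[OF c C] tendsto_const) (auto simp: LIM_zero_iff)
  moreover have "eventually (\<lambda>n. ?C n > 0) sequentially" using C by (simp add: filterlim_at_top_dense)
  then have "eventually (\<lambda>n. (\<Sum>k=1..n. c k * (x k - l)) / ?C n + l = (\<Sum>k=1..n. c k * x k) / ?C n) sequentially"
    by eventually_elim
      (simp add: right_diff_distrib sum_subtractf sum_distrib_right[symmetric] diff_divide_distrib)
  ultimately show ?thesis by (auto dest: Lim_transform_eventually)
qed

text \<open>A weighted average in which the weights \<open>c k\<close> are the increments of
  \<open>k powr (s + 1)\<close>: they telescope to the denominator, and
  \<open>real k powr s / c k\<close> has the required limit. This covers negative \<open>s\<close>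
  as well.\<close>

lemma powr_sum_tendsto:
  fixes s :: real
  assumes s: "s > -1"
  shows "(\<lambda>n. (\<Sum>k=1..n. real k powr s) / real n powr (s + 1)) \<longlonglongrightarrow> 1 / (s + 1)"
proof -
  define c where "c k = real k powr (s + 1) - (real k - 1) powr (s + 1)" for k :: nat
  have cpos: "c k > 0" if "1 \<le> k" for k
    using that s by (simp add: c_def powr_less_mono2)
  have C: "(\<Sum>k=1..n. c k) = real n powr (s + 1)" for n
    using s by (induction n) (auto simp: c_def)
  have "filterlim (\<lambda>n. \<Sum>k=1..n. c k) at_top sequentially"
    unfolding C using s by real_asymp
  moreover have "(\<lambda>k. real k powr s / c k) \<longlonglongrightarrow> 1 / (s + 1)"
    unfolding c_def using s by (real_asymp simp: field_simps)
  ultimately have "(\<lambda>n. (\<Sum>k=1..n. c k * (real k powr s / c k)) / (\<Sum>k=1..n. c k)) \<longlonglongrightarrow> 1 / (s + 1)"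
    using cpos by (intro weighted_average_tendsto) (auto intro: less_imp_le)
  moreover have "(\<Sum>k=1..n. c k * (real k powr s / c k)) = (\<Sum>k=1..n. real k powr s)" for n
    using cpos by (intro sum.cong) (auto simp: less_imp_neq[symmetric])
  ultimately show ?thesis by (simp only: C)
qed

text \<open>Potter's bounds with the logarithms removed, arranged to compare the earlier value
  \<open>L n\<close> with the later value \<open>L m\<close>, as terms of a sum are compared with
  its last one.\<close>

lemma slowly_osc_potter_bounds:
  assumes L: "slowly_osc L" and e: "e > 0"
  obtains N where "N \<ge> 1"
    "\<And>n m. N \<le> n \<Longrightarrow> n \<le> m \<Longrightarrow> L n \<le> exp e * (real m / real n) powr e * L m"
    "\<And>n m. N \<le> n \<Longrightarrow> n \<le> m \<Longrightarrow> exp (-e) * (real n / real m) powr e * L m \<le> L n"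
proof -
  obtain N where N: "N \<ge> 1"
    "\<And>n m. N \<le> n \<Longrightarrow> n \<le> m \<Longrightarrow> \<bar>ln (L m) - ln (L n)\<bar> \<le> e * (1 + ln (real m / real n))"
    using slowly_osc_potter[OF L e] by blast
  show ?thesis
  proof (rule that[OF N(1)])
    fix n m assume nm: "N \<le> n" "n \<le> m"
    have pos: "0 < L n" "0 < L m" "0 < real n" "0 < real m"
      using nm N(1) slowly_osc_pos[OF L] by auto
    note b = N(2)[OF nm]
    have "L n = exp (ln (L n))" using pos by simp
    also have "\<dots> \<le> exp (e + e * ln (real m / real n) + ln (L m))" using b by (simp add: algebra_simps)
    also have "\<dots> = exp e * (real m / real n) powr e * L m" using pos by (simp add: exp_add powr_def)
    finally show "L n \<le> exp e * (real m / real n) powr e * L m" .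
    have "ln (real n / real m) = - ln (real m / real n)" using pos by (simp add: ln_div)
    then have "exp (-e) * (real n / real m) powr e * L m = exp (-e + - e * ln (real m / real n) + ln (L m))"
      using pos unfolding exp_add by (simp add: powr_def)
    also have "\<dots> \<le> exp (ln (L n))" using b by (simp add: algebra_simps)
    finally show "exp (-e) * (real n / real m) powr e * L m \<le> L n" using pos by simp
  qed
qed

text \<open>Potter's bound with exponent \<open>s / 2\<close> lets \<open>L\<close> decay no faster
  than that power, so half of the growth survives.\<close>

lemma slowly_osc_powr_at_top:
  assumes L: "slowly_osc L" and s: "s > 0"
  shows "filterlim (\<lambda>n. real n powr s * L n) at_top sequentially"
proof -
  define e where "e = s / 2"
  have e: "e > 0" using s by (simp add: e_def)
  obtain N where N: "N \<ge> 1"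
    "\<And>n m. N \<le> n \<Longrightarrow> n \<le> m \<Longrightarrow> L n \<le> exp e * (real m / real n) powr e * L m"
    using slowly_osc_potter_bounds[OF L e] by metis
  define K where "K = L N * exp (-e) * real N powr e"
  have K: "K > 0" using slowly_osc_pos[OF L N(1)] N(1) by (simp add: K_def)
  have "filterlim (\<lambda>n. K * real n powr e) at_top sequentially" using K e by real_asymp
  moreover have "eventually (\<lambda>n. K * real n powr e \<le> real n powr s * L n) sequentially"
    using eventually_ge_at_top[of N]
  proof eventually_elim
    case (elim n)
    have "L N \<le> exp e * (real n / real N) powr e * L n" by (rule N(2)) (use elim in auto)
    from mult_right_mono[OF this, of "exp (-e) * real N powr e"]
    have "K \<le> exp e * (real n / real N) powr e * L n * (exp (-e) * real N powr e)"
      by (simp add: K_def mult.assoc)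
    also have "\<dots> = real n powr e * L n" using N(1) elim by (simp add: powr_divide exp_minus field_simps)
    finally have "K * real n powr e \<le> real n powr e * L n * real n powr e" by (intro mult_right_mono) auto
    also have "\<dots> = real n powr s * L n" by (simp add: e_def powr_add[symmetric])
    finally show ?case .
  qed
  ultimately show ?thesis by (rule filterlim_at_top_mono)
qed

text \<open>Potter's bounds allow \<open>L k\<close> to be replaced by \<open>L n\<close> at the
  price of a factor \<open>(n / k) powr e\<close> or its inverse, which leaves pure power sums of
  index \<open>s - e\<close> or \<open>s + e\<close>. The finitely many terms before
  \<open>N\<close> vanish against the divergent denominator.\<close>

lemma karamata_sum:
  assumes L: "slowly_osc L" and s: "s > -1"
  shows "(\<lambda>n. (\<Sum>k=1..n. real k powr s * L k) / (real n powr (s + 1) * L n)) \<longlonglongrightarrow> 1 / (s + 1)"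
proof (rule order_tendstoI)
  let ?R = "\<lambda>n. (\<Sum>k=1..n. real k powr s * L k) / (real n powr (s + 1) * L n)"
  have top: "filterlim (\<lambda>n. real n powr (s + 1) * L n) at_top sequentially"
    by (rule slowly_osc_powr_at_top[OF L]) (use s in simp)
  fix u assume u: "1 / (s + 1) < u"
  \<comment> \<open>The constant produced by the upper Potter bound tends to
    \<open>1 / (s + 1)\<close> as \<open>e\<close> tends to 0, so some \<open>e\<close> keeps it
    below \<open>u\<close>; requiring \<open>e < s + 1\<close> keeps the exponent
    \<open>s - e\<close> above -1.\<close>
  have "((\<lambda>e. exp e / (s - e + 1)) \<longlongrightarrow> exp 0 / (s - 0 + 1)) (at_right 0)"
    using s by (intro tendsto_intros) auto
  then have "eventually (\<lambda>e. exp e / (s - e + 1) < u) (at_right 0)"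
    using u by (intro order_tendstoD(2)) auto
  moreover have "eventually (\<lambda>e. e < s + 1) (at_right (0::real))" using s
    by (intro eventually_at_right_less order_tendstoD(2)[OF tendsto_ident_at]) auto
  moreover have "eventually (\<lambda>e. e > (0::real)) (at_right 0)" by (rule eventually_at_right_less)
  ultimately have "eventually (\<lambda>e. exp e / (s - e + 1) < u \<and> e < s + 1 \<and> 0 < e) (at_right 0)"
    by eventually_elim auto
  then obtain e where e: "exp e / (s - e + 1) < u" "e < s + 1" "0 < e"
    using eventually_happens trivial_limit_at_right_real by blast
  obtain N where N: "N \<ge> 1"
    "\<And>n m. N \<le> n \<Longrightarrow> n \<le> m \<Longrightarrow> L n \<le> exp e * (real m / real n) powr e * L m"
    using slowly_osc_potter_bounds[OF L e(3)] by metis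
  define A where "A = (\<Sum>k=1..<N. real k powr s * L k)"
  let ?P = "\<lambda>n. (\<Sum>k=1..n. real k powr (s - e)) / real n powr (s - e + 1)"
  have "(\<lambda>n. A / (real n powr (s + 1) * L n) + exp e * ?P n) \<longlonglongrightarrow> 0 + exp e * (1 / (s - e + 1))"
    using e by (intro tendsto_intros real_tendsto_divide_at_top[OF tendsto_const top] powr_sum_tendsto) auto
  then have "eventually (\<lambda>n. A / (real n powr (s + 1) * L n) + exp e * ?P n < u) sequentially"
    using e(1) by (intro order_tendstoD(2)) auto
  then show "eventually (\<lambda>n. ?R n < u) sequentially"
    using eventually_ge_at_top[of N]
  proof eventually_elim
    case (elim n)
    have n: "n \<ge> 1" "L n > 0" using elim N(1) slowly_osc_pos[OF L, of n] by auto
    have "(\<Sum>k=1..n. real k powr s * L k)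
      \<le> (\<Sum>k=1..n. (if k < N then real k powr s * L k else 0) + exp e * real n powr e * L n * real k powr (s - e))"
    proof (rule sum_mono)
      fix k assume k: "k \<in> {1..n}"
      show "real k powr s * L k \<le> (if k < N then real k powr s * L k else 0) + exp e * real n powr e * L n * real k powr (s - e)"
      proof (cases "k < N")
        case True then show ?thesis using n by simp
      next
        case False
        have "real k powr s * L k \<le> real k powr s * (exp e * (real n / real k) powr e * L n)"
          by (intro mult_left_mono N(2)) (use k False in auto)
        also have "\<dots> = exp e * real n powr e * L n * real k powr (s - e)"
          using k by (simp add: powr_divide powr_diff)
        finally show ?thesis using False by simp
      qed
    qed
    also have "\<dots> = (\<Sum>k\<in>{1..n} \<inter> {k. k < N}. real k powr s * L k)
        + exp e * real n powr e * L n * (\<Sum>k=1..n. real k powr (s - e))"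
      by (simp add: sum.distrib sum_distrib_left sum.If_cases)
    also have "{1..n} \<inter> {k. k < N} = {1..<N}" using elim by auto
    also have "(\<Sum>k\<in>{1..<N}. real k powr s * L k) = A" by (simp add: A_def)
    finally have "?R n \<le> (A + exp e * real n powr e * L n * (\<Sum>k=1..n. real k powr (s - e))) / (real n powr (s + 1) * L n)"
      using n by (intro divide_right_mono) auto
    also have "\<dots> = A / (real n powr (s + 1) * L n) + exp e * ?P n"
      using n by (simp add: add_divide_distrib powr_add powr_diff)
    finally show ?case using elim(1) by simp
  qed
next
  let ?R = "\<lambda>n. (\<Sum>k=1..n. real k powr s * L k) / (real n powr (s + 1) * L n)"
  fix u assume u: "u < 1 / (s + 1)"
  have "((\<lambda>e. exp (-e) / (s + e + 1)) \<longlongrightarrow> exp (-0) / (s + 0 + 1)) (at_right 0)"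
    using s by (intro tendsto_intros) auto
  then have "eventually (\<lambda>e. u < exp (-e) / (s + e + 1)) (at_right 0)"
    using u by (intro order_tendstoD(1)) auto
  moreover have "eventually (\<lambda>e. e > (0::real)) (at_right 0)" by (rule eventually_at_right_less)
  ultimately have "eventually (\<lambda>e. u < exp (-e) / (s + e + 1) \<and> 0 < e) (at_right 0)"
    by eventually_elim auto
  then obtain e where e: "u < exp (-e) / (s + e + 1)" "0 < e"
    using eventually_happens trivial_limit_at_right_real by blast
  obtain N where N: "N \<ge> 1"
    "\<And>n m. N \<le> n \<Longrightarrow> n \<le> m \<Longrightarrow> exp (-e) * (real n / real m) powr e * L m \<le> L n"
    using slowly_osc_potter_bounds[OF L e(2)] by metis
  define A where "A = (\<Sum>k=1..<N. real k powr (s + e))"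
  let ?P = "\<lambda>n. (\<Sum>k=1..n. real k powr (s + e)) / real n powr (s + e + 1)"
  have top: "filterlim (\<lambda>n. real n powr (s + e + 1)) at_top sequentially"
    using s e by real_asymp
  have "(\<lambda>n. exp (-e) * (?P n - A / real n powr (s + e + 1))) \<longlonglongrightarrow> exp (-e) * (1 / (s + e + 1) - 0)"
    using e s by (intro tendsto_intros real_tendsto_divide_at_top[OF tendsto_const top] powr_sum_tendsto) auto
  then have "eventually (\<lambda>n. u < exp (-e) * (?P n - A / real n powr (s + e + 1))) sequentially"
    using e(1) by (intro order_tendstoD(1)) auto
  then show "eventually (\<lambda>n. u < ?R n) sequentially"
    using eventually_ge_at_top[of N]
  proof eventually_elim
    case (elim n)
    have n: "n \<ge> 1" "L n > 0" using elim N(1) slowly_osc_pos[OF L, of n] by auto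
    let ?c = "exp (-e) * real n powr (-e) * L n"
    have "(\<Sum>k=1..n. ?c * real k powr (s + e))
      \<le> (\<Sum>k=1..n. (if k < N then ?c * real k powr (s + e) else 0) + real k powr s * L k)"
    proof (rule sum_mono)
      fix k assume k: "k \<in> {1..n}"
      then have Lk: "L k > 0" using slowly_osc_pos[OF L] by auto
      show "?c * real k powr (s + e) \<le> (if k < N then ?c * real k powr (s + e) else 0) + real k powr s * L k"
      proof (cases "k < N")
        case True then show ?thesis using Lk by simp
      next
        case False
        have "?c * real k powr (s + e) = real k powr s * (exp (-e) * (real k / real n) powr e * L n)"
          using k n by (simp add: powr_divide powr_add powr_minus field_simps)
        also have "\<dots> \<le> real k powr s * L k"
          by (intro mult_left_mono N(2)) (use k False in auto)
        finally show ?thesis using False by simp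
      qed
    qed
    also have "\<dots> = ?c * (\<Sum>k\<in>{1..n} \<inter> {k. k < N}. real k powr (s + e)) + (\<Sum>k=1..n. real k powr s * L k)"
      by (simp add: sum.distrib sum_distrib_left sum.If_cases)
    also have "{1..n} \<inter> {k. k < N} = {1..<N}" using elim by auto
    also have "(\<Sum>k\<in>{1..<N}. real k powr (s + e)) = A" by (simp add: A_def)
    finally have "?c * ((\<Sum>k=1..n. real k powr (s + e)) - A) \<le> (\<Sum>k=1..n. real k powr s * L k)"
      by (simp add: sum_distrib_left right_diff_distrib)
    then have "?c * ((\<Sum>k=1..n. real k powr (s + e)) - A) / (real n powr (s + 1) * L n) \<le> ?R n"
      using n by (intro divide_right_mono) auto
    also have "?c * ((\<Sum>k=1..n. real k powr (s + e)) - A) / (real n powr (s + 1) * L n)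
       = exp (-e) * (?P n - A / real n powr (s + e + 1))"
      using n by (simp add: powr_add powr_minus field_simps)
    finally show ?case using elim(1) by simp
  qed
qed

section \<open>Closure properties of slowly varying sequences and comparison over wide
  windows\<close>

lemma slowly_oscI:
  assumes "\<And>n. n \<ge> 1 \<Longrightarrow> 0 < L n"
    and "\<And>e. e > 0 \<Longrightarrow> eventually (\<lambda>n. \<forall>m. n \<le> m \<longrightarrow> m \<le> 2 * n \<longrightarrow> \<bar>ln (L m) - ln (L n)\<bar> \<le> e) sequentially"
  shows "slowly_osc L"
  using assms unfolding slowly_osc_def eventually_sequentially by blast

lemma slowly_osc_eventually:
  assumes "slowly_osc L" "e > 0"
  shows "eventually (\<lambda>n. \<forall>m. n \<le> m \<longrightarrow> m \<le> 2 * n \<longrightarrow> \<bar>ln (L m) - ln (L n)\<bar> \<le> e) sequentially"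
  using assms unfolding slowly_osc_def eventually_sequentially by blast

lemma slowly_osc_mult:
  assumes L: "slowly_osc L" and K: "slowly_osc K"
  shows "slowly_osc (\<lambda>n. L n * K n)"
proof (rule slowly_oscI)
  fix e :: real assume "e > 0"
  then have "e/2 > 0" by simp
  from slowly_osc_eventually[OF L this] slowly_osc_eventually[OF K this] eventually_ge_at_top[of 1]
  show "eventually (\<lambda>n. \<forall>m. n \<le> m \<longrightarrow> m \<le> 2 * n \<longrightarrow> \<bar>ln (L m * K m) - ln (L n * K n)\<bar> \<le> e) sequentially"
  proof eventually_elim
    case (elim n)
    show ?case
    proof (intro allI impI)
      fix m assume m: "n \<le> m" "m \<le> 2 * n"
      have "0 < L n" "0 < K n" "0 < L m" "0 < K m"
        using m elim slowly_osc_pos[OF L] slowly_osc_pos[OF K] by auto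
      then have "ln (L m * K m) = ln (L m) + ln (K m)" "ln (L n * K n) = ln (L n) + ln (K n)"
        by (simp_all add: ln_mult_pos)
      moreover have "\<bar>ln (L m) - ln (L n)\<bar> \<le> e/2" "\<bar>ln (K m) - ln (K n)\<bar> \<le> e/2"
        using elim m by auto
      ultimately show "\<bar>ln (L m * K m) - ln (L n * K n)\<bar> \<le> e" by linarith
    qed
  qed
qed (use slowly_osc_pos[OF L] slowly_osc_pos[OF K] in simp)

lemma slowly_osc_inverse:
  assumes L: "slowly_osc L"
  shows "slowly_osc (\<lambda>n. inverse (L n))"
proof (rule slowly_oscI)
  fix e :: real assume "e > 0"
  from slowly_osc_eventually[OF L this]
  show "eventually (\<lambda>n. \<forall>m. n \<le> m \<longrightarrow> m \<le> 2 * n \<longrightarrow> \<bar>ln (inverse (L m)) - ln (inverse (L n))\<bar> \<le> e) sequentially"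
    by eventually_elim (simp add: ln_inverse abs_minus_commute)
qed (use slowly_osc_pos[OF L] in simp)

lemma slowly_osc_convergent:
  assumes pos: "\<And>n. n \<ge> 1 \<Longrightarrow> 0 < L n" and lim: "L \<longlonglongrightarrow> c" and c: "c > 0"
  shows "slowly_osc L"
proof (rule slowly_oscI)
  fix e :: real assume e: "e > 0"
  have "(\<lambda>n. ln (L n)) \<longlonglongrightarrow> ln c" using lim c by (intro tendsto_intros) auto
  from tendstoD[OF this, of "e/2"] e obtain N where N: "\<And>n. n \<ge> N \<Longrightarrow> \<bar>ln (L n) - ln c\<bar> < e/2"
    by (auto simp: eventually_sequentially dist_real_def)
  have "\<bar>ln (L m) - ln (L n)\<bar> \<le> e" if "N \<le> n" "n \<le> m" for n m
    using N[of n] N[of m] that by linarith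
  then show "eventually (\<lambda>n. \<forall>m. n \<le> m \<longrightarrow> m \<le> 2 * n \<longrightarrow> \<bar>ln (L m) - ln (L n)\<bar> \<le> e) sequentially"
    unfolding eventually_sequentially by blast
qed (rule pos)

lemma slowly_osc_cong:
  assumes L: "slowly_osc L" and eq: "\<And>n. n \<ge> 1 \<Longrightarrow> L n = K n"
  shows "slowly_osc K"
proof (rule slowly_oscI)
  fix e :: real assume "e > 0"
  from slowly_osc_eventually[OF L this] eventually_ge_at_top[of 1]
  show "eventually (\<lambda>n. \<forall>m. n \<le> m \<longrightarrow> m \<le> 2 * n \<longrightarrow> \<bar>ln (K m) - ln (K n)\<bar> \<le> e) sequentially"
    by eventually_elim (simp add: eq[symmetric])
qed (use slowly_osc_pos[OF L] eq in metis)

text \<open>Potter's bound grows only logarithmically, so shrinking the tolerance by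
  \<open>1 + \<bar>ln K\<bar>\<close> passes from factor 2 to any fixed factor \<open>K\<close>, in
  both directions.\<close>

lemma slowly_osc_wide:
  assumes L: "slowly_osc L" and e: "e > 0" and K: "K > 0"
  obtains N where "N \<ge> 1"
    "\<And>n m. N \<le> n \<Longrightarrow> N \<le> m \<Longrightarrow> real m \<le> K * real n \<Longrightarrow> real n \<le> K * real m \<Longrightarrow> \<bar>ln (L m) - ln (L n)\<bar> \<le> e"
proof -
  define d where "d = e / (1 + \<bar>ln K\<bar>)"
  have d: "d > 0" using e by (simp add: d_def)
  obtain N where N: "N \<ge> 1"
    "\<And>n m. N \<le> n \<Longrightarrow> n \<le> m \<Longrightarrow> \<bar>ln (L m) - ln (L n)\<bar> \<le> d * (1 + ln (real m / real n))"
    using slowly_osc_potter[OF L d] by blast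
  have *: "\<bar>ln (L m) - ln (L n)\<bar> \<le> e" if "N \<le> n" "n \<le> m" "real m \<le> K * real n" for n m
  proof -
    have "ln (real m / real n) \<le> ln K" using that N(1) K by (subst ln_le_cancel_iff) (auto simp: field_simps)
    then have "d * (1 + ln (real m / real n)) \<le> d * (1 + \<bar>ln K\<bar>)" using d by (intro mult_left_mono) auto
    also have "\<dots> = e" by (simp add: d_def)
    finally show ?thesis using N(2)[OF that(1,2)] by simp
  qed
  show ?thesis
  proof (rule that[OF N(1)])
    fix n m assume "N \<le> n" "N \<le> m" "real m \<le> K * real n" "real n \<le> K * real m"
    then show "\<bar>ln (L m) - ln (L n)\<bar> \<le> e"
      using *[of n m] *[of m n] by (cases "n \<le> m") (auto simp: abs_minus_commute)
  qed
qed

lemma slowly_osc_ratio: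
  assumes L: "slowly_osc L" and r: "(\<lambda>n. real (r n) / real n) \<longlonglongrightarrow> c" and c: "c > 0"
  shows "(\<lambda>n. L (r n) / L n) \<longlonglongrightarrow> 1"
proof -
  \<comment> \<open>Twice the limiting ratio and twice its inverse: eventually \<open>r n\<close>
    and \<open>n\<close> lie within a factor \<open>K\<close> of each other, whichever is
    larger.\<close>
  define K where "K = max (2 * c) (2 / c)"
  have K: "K > 0" "2 * c \<le> K" "2 / c \<le> K" using c by (auto simp: K_def)
  have r_large: "filterlim r at_top sequentially"
  proof -
    have "filterlim (\<lambda>n. real (r n) / real n * real n) at_top sequentially"
      by (rule filterlim_tendsto_pos_mult_at_top[OF r c filterlim_real_sequentially])
    moreover have "eventually (\<lambda>n. real (r n) / real n * real n = real (r n)) sequentially"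
      using eventually_ge_at_top[of 1] by eventually_elim simp
    ultimately have "filterlim (\<lambda>n. real (r n)) at_top sequentially"
      by (subst (asm) filterlim_cong[OF refl refl])
    then show ?thesis by (simp add: filterlim_sequentially_iff_filterlim_real)
  qed
  have lo: "eventually (\<lambda>n. c / 2 < real (r n) / real n) sequentially"
    and hi: "eventually (\<lambda>n. real (r n) / real n < 2 * c) sequentially"
    by (rule order_tendstoD[OF r], use c in simp)+
  have "(\<lambda>n. ln (L (r n)) - ln (L n)) \<longlonglongrightarrow> 0"
  proof (rule tendstoI)
    fix e :: real assume e: "e > 0"
    then have "e/2 > 0" by simp
    from slowly_osc_wide[OF L this K(1)] obtain N where N: "N \<ge> 1"
      "\<And>n m. N \<le> n \<Longrightarrow> N \<le> m \<Longrightarrow> real m \<le> K * real n \<Longrightarrow> real n \<le> K * real m \<Longrightarrow> \<bar>ln (L m) - ln (L n)\<bar> \<le> e/2"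
      by metis
    have "eventually (\<lambda>n. r n \<ge> N) sequentially" using r_large by (simp add: filterlim_at_top)
    then show "eventually (\<lambda>n. dist (ln (L (r n)) - ln (L n)) 0 < e) sequentially"
      using lo hi eventually_ge_at_top[of N]
    proof eventually_elim
      case (elim n)
      have n: "real n > 0" using elim N(1) by auto
      have "real (r n) \<le> 2 * c * real n" using elim n by (simp add: field_simps)
      also have "\<dots> \<le> K * real n" using K n by (intro mult_right_mono) auto
      finally have 1: "real (r n) \<le> K * real n" .
      have "real n \<le> 2 / c * real (r n)" using elim n c by (simp add: field_simps)
      also have "\<dots> \<le> K * real (r n)" using K by (intro mult_right_mono) auto
      finally have "\<bar>ln (L (r n)) - ln (L n)\<bar> \<le> e/2" using N(2)[of n "r n"] elim 1 by auto
      then show ?case using e by (simp add: dist_real_def)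
    qed
  qed
  then have "(\<lambda>n. exp (ln (L (r n)) - ln (L n))) \<longlonglongrightarrow> exp 0" by (intro tendsto_intros)
  moreover have "eventually (\<lambda>n. r n \<ge> 1) sequentially" using r_large by (simp add: filterlim_at_top)
  then have "eventually (\<lambda>n. exp (ln (L (r n)) - ln (L n)) = L (r n) / L n) sequentially"
    using eventually_ge_at_top[of 1]
    by eventually_elim (simp add: exp_diff slowly_osc_pos[OF L])
  ultimately show ?thesis by (auto dest: Lim_transform_eventually)
qed

text \<open>The boundary case \<open>s = -1\<close> of Karamata's theorem.\<close>

lemma slowly_osc_harmonic_dominates:
  assumes L: "slowly_osc L"
  shows "(\<lambda>n. L n / (\<Sum>k=1..n. L k / real k)) \<longlonglongrightarrow> 0"
proof (rule order_tendstoI)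
  let ?G = "\<lambda>n. \<Sum>k=1..n. L k / real k"
  have G: "?G n > 0" if "n \<ge> 1" for n
    using that slowly_osc_pos[OF L] by (intro sum_pos) auto
  { fix u :: real assume "u < 0"
    show "eventually (\<lambda>n. u < L n / ?G n) sequentially"
      using eventually_ge_at_top[of 1]
    proof eventually_elim
      case (elim n)
      have "0 < L n / ?G n" using G[OF elim] slowly_osc_pos[OF L elim] by simp
      with \<open>u < 0\<close> show ?case by linarith
    qed }
  fix u :: real assume u: "0 < u"
  \<comment> \<open>6 = 2 * 3: the power sum of index \<open>e - 1\<close> exceeds
    \<open>1 / (2 * e)\<close>, half of its limit, and \<open>exp (-e) > 1 / 3\<close> because
    \<open>e \<le> 1\<close>. Together the harmonic sum exceeds
    \<open>L n / (6 * e)\<close>.\<close>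
  define e where "e = min 1 (u / 6)"
  have e: "0 < e" "e \<le> 1" "6 * e \<le> u" using u by (auto simp: e_def)
  obtain N where N: "N \<ge> 1"
    "\<And>n m. N \<le> n \<Longrightarrow> n \<le> m \<Longrightarrow> exp (-e) * (real n / real m) powr e * L m \<le> L n"
    using slowly_osc_potter_bounds[OF L e(1)] by metis
  define A where "A = (\<Sum>k=1..<N. real k powr (e - 1))"
  let ?P = "\<lambda>n. (\<Sum>k=1..n. real k powr (e - 1)) / real n powr (e - 1 + 1)"
  have top: "filterlim (\<lambda>n. real n powr (e - 1 + 1)) at_top sequentially"
    using e by real_asymp
  have "(\<lambda>n. ?P n - A / real n powr (e - 1 + 1)) \<longlonglongrightarrow> 1 / (e - 1 + 1) - 0"
    using e by (intro tendsto_intros real_tendsto_divide_at_top[OF tendsto_const top] powr_sum_tendsto) auto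
  then have "eventually (\<lambda>n. 1 / (2 * e) < ?P n - A / real n powr (e - 1 + 1)) sequentially"
    using e(1) by (intro order_tendstoD(1)) (auto simp: field_simps)
  then show "eventually (\<lambda>n. L n / ?G n < u) sequentially"
    using eventually_ge_at_top[of N]
  proof eventually_elim
    case (elim n)
    have n: "n \<ge> 1" "L n > 0" using elim N(1) slowly_osc_pos[OF L, of n] by auto
    let ?c = "exp (-e) * real n powr (-e) * L n"
    have "(\<Sum>k=1..n. ?c * real k powr (e - 1))
      \<le> (\<Sum>k=1..n. (if k < N then ?c * real k powr (e - 1) else 0) + L k / real k)"
    proof (rule sum_mono)
      fix k assume k: "k \<in> {1..n}"
      then have Lk: "L k > 0" using slowly_osc_pos[OF L] by auto
      show "?c * real k powr (e - 1) \<le> (if k < N then ?c * real k powr (e - 1) else 0) + L k / real k"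
      proof (cases "k < N")
        case True then show ?thesis using Lk by simp
      next
        case False
        have "?c * real k powr (e - 1) = (exp (-e) * (real k / real n) powr e * L n) / real k"
          using k n by (simp add: powr_divide powr_diff powr_minus field_simps)
        also have "\<dots> \<le> L k / real k"
          by (intro divide_right_mono N(2)) (use k False in auto)
        finally show ?thesis using False by simp
      qed
    qed
    also have "\<dots> = ?c * (\<Sum>k\<in>{1..n} \<inter> {k. k < N}. real k powr (e - 1)) + ?G n"
      by (simp add: sum.distrib sum_distrib_left sum.If_cases)
    also have "{1..n} \<inter> {k. k < N} = {1..<N}" using elim by auto
    also have "(\<Sum>k\<in>{1..<N}. real k powr (e - 1)) = A" by (simp add: A_def)
    finally have "?c * ((\<Sum>k=1..n. real k powr (e - 1)) - A) \<le> ?G n"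
      by (simp add: sum_distrib_left right_diff_distrib)
    also have "?c * ((\<Sum>k=1..n. real k powr (e - 1)) - A) = exp (-e) * L n * (?P n - A / real n powr (e - 1 + 1))"
      using n by (simp add: powr_minus field_simps)
    finally have *: "exp (-e) * L n * (?P n - A / real n powr (e - 1 + 1)) \<le> ?G n" .
    have "exp (-e) * L n * (1 / (2 * e)) < exp (-e) * L n * (?P n - A / real n powr (e - 1 + 1))"
      using elim(1) n by (intro mult_strict_left_mono) auto
    then have **: "exp (-e) * L n * (1 / (2 * e)) < ?G n" using * by linarith
    have "exp e \<le> exp 1" using e by simp
    also have "\<dots> < 3" using e_less_272 by linarith
    finally have "1 / 3 < exp (-e)" by (simp add: exp_minus field_simps)
    then have "1 / 3 * L n * (1 / (2 * e)) < exp (-e) * L n * (1 / (2 * e))"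
      using n e by (intro mult_strict_right_mono) auto
    then have "L n < 6 * e * ?G n" using ** e by (simp add: field_simps)
    also have "\<dots> \<le> u * ?G n" using e G[OF n(1)] by (intro mult_right_mono) auto
    finally show ?case using G[OF n(1)] by (simp add: field_simps)
  qed
qed

text \<open>The crude comparison of \<open>1 / k\<close> with \<open>k powr (-1/2)\<close> is
  enough: Karamata's theorem bounds the larger sum by a multiple of
  \<open>sqrt n * L n\<close>.\<close>

lemma slowly_osc_harmonic_upper:
  assumes L: "slowly_osc L"
  shows "(\<lambda>n. (\<Sum>k=1..n. L k / real k) / (real n * L n)) \<longlonglongrightarrow> 0"
proof (rule tendsto_sandwich[of "\<lambda>n. 0" _ _ "\<lambda>n. (\<Sum>k=1..n. real k powr (-1/2) * L k) / (real n powr (-1/2+1) * L n) * real n powr (-1/2)"])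
  have "(\<lambda>n. real n powr (-1/2)) \<longlonglongrightarrow> 0" by real_asymp
  from tendsto_mult[OF karamata_sum[OF L, of "-1/2"] this]
  show "(\<lambda>n. (\<Sum>k=1..n. real k powr (-1/2) * L k) / (real n powr (-1/2+1) * L n) * real n powr (-1/2)) \<longlonglongrightarrow> 0"
    by simp
  show "eventually (\<lambda>n. 0 \<le> (\<Sum>k=1..n. L k / real k) / (real n * L n)) sequentially"
    using eventually_ge_at_top[of 1]
  proof eventually_elim
    case (elim n)
    have "0 \<le> L k" if "1 \<le> k" for k using slowly_osc_pos[OF L that] by simp
    then show ?case using elim by (intro divide_nonneg_nonneg sum_nonneg mult_nonneg_nonneg) auto
  qed
  show "eventually (\<lambda>n. (\<Sum>k=1..n. L k / real k) / (real n * L n)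
      \<le> (\<Sum>k=1..n. real k powr (-1/2) * L k) / (real n powr (-1/2+1) * L n) * real n powr (-1/2)) sequentially"
    using eventually_ge_at_top[of 1]
  proof eventually_elim
    case (elim n)
    have Ln: "L n > 0" using slowly_osc_pos[OF L elim] .
    have "(\<Sum>k=1..n. L k / real k) \<le> (\<Sum>k=1..n. real k powr (-1/2) * L k)"
    proof (rule sum_mono)
      fix k assume k: "k \<in> {1..n}"
      have "real k powr (-1) \<le> real k powr (-1/2)" using k by (intro powr_mono) auto
      from mult_right_mono[OF this, of "L k"]
      show "L k / real k \<le> real k powr (-1/2) * L k"
        using k slowly_osc_pos[OF L, of k] by (simp add: powr_minus field_simps)
    qed
    then have "(\<Sum>k=1..n. L k / real k) / (real n * L n) \<le> (\<Sum>k=1..n. real k powr (-1/2) * L k) / (real n * L n)"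
      using Ln by (intro divide_right_mono) auto
    also have "\<dots> = (\<Sum>k=1..n. real k powr (-1/2) * L k) / (real n powr (-1/2+1) * L n) * real n powr (-1/2)"
    proof -
      have eq: "real n * L n = real n powr (-1/2+1) * L n * real n powr (1/2)"
        using elim by (simp add: powr_add[symmetric] mult.commute[of _ "L n"] mult.assoc)
      show ?thesis unfolding eq
        by (simp only: powr_minus divide_inverse inverse_mult_distrib mult.assoc minus_mult_left[symmetric] mult_1_left)
    qed
    finally show ?case .
  qed
qed simp

text \<open>Between comparable indices the harmonic sum changes only by a multiple of
  \<open>L n\<close>, which is of smaller order than the sum itself. Applied to \<open>v2\<close>,
  this is why the martingale hardly moves after time s*n.\<close>

lemma slowly_osc_harmonic_increment:
  assumes L: "slowly_osc L" and K: "K \<ge> 1"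
  obtains C N where "C \<ge> 0" "N \<ge> 1"
    "\<And>n m. N \<le> n \<Longrightarrow> real m \<le> K * real n \<Longrightarrow> real n \<le> K * real m \<Longrightarrow>
      \<bar>(\<Sum>k=1..m. L k / real k) - (\<Sum>k=1..n. L k / real k)\<bar> \<le> C * L n"
proof -
  let ?G = "\<lambda>n. \<Sum>k=1..n. L k / real k"
  obtain N where N: "N \<ge> 1"
    "\<And>n m. N \<le> n \<Longrightarrow> N \<le> m \<Longrightarrow> real m \<le> K * real n \<Longrightarrow> real n \<le> K * real m \<Longrightarrow> \<bar>ln (L m) - ln (L n)\<bar> \<le> 1"
    using slowly_osc_wide[OF L zero_less_one, of K] K by (metis less_le_trans zero_less_one)
  \<comment> \<open>Every \<open>k\<close> with \<open>K * k \<ge> n \<ge> N'\<close> is then at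
    least \<open>N\<close>, so the comparison of \<open>L k\<close> with \<open>L n\<close> applies
    to all summands.\<close>
  define N' where "N' = nat \<lceil>K * real N\<rceil> + 1"
  have N': "K * real N \<le> real N'" unfolding N'_def by linarith
  have NN': "N \<le> N'"
  proof -
    have "1 * real N \<le> K * real N" using K by (intro mult_right_mono) auto
    then show ?thesis using N' by linarith
  qed
  \<comment> \<open>One \<open>K\<close> bounds the number of summands by \<open>K * n\<close>, the
    other compares \<open>1 / k\<close> with \<open>1 / n\<close>, and \<open>exp 1\<close> compares
    \<open>L k\<close> with \<open>L n\<close>.\<close>
  define C where "C = K * (K * exp 1)"
  show ?thesis
  proof (rule that[of C N'])
    show "C \<ge> 0" using K by (simp add: C_def)
    show "N' \<ge> 1" by (simp add: N'_def)
    fix n m assume nm: "N' \<le> n" "real m \<le> K * real n" "real n \<le> K * real m"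
    have n1: "n \<ge> 1" "real n > 0" using nm N(1) NN' by auto
    have Ln: "L n > 0" using slowly_osc_pos[OF L n1(1)] .
    have tb: "L k / real k \<le> K * exp 1 * L n / real n" if k: "k \<in> {Suc (min m n)..max m n}" for k
    proof -
      have k': "real n \<le> K * real k" "real k \<le> K * real n"
      proof -
        have 1: "real n \<le> K * real n" using K n1 mult_right_mono[of 1 K "real n"] by simp
        show "real k \<le> K * real n" using k 1 nm by auto
        have "real n \<le> K * real (min m n)" using 1 nm by (auto simp: min_def)
        also have "\<dots> \<le> K * real k" using k K by (intro mult_left_mono) auto
        finally show "real n \<le> K * real k" .
      qed
      have "K * real N \<le> K * real k" using k'(1) N' nm(1) by linarith
      then have kN: "N \<le> k" using K by simp
      then have "L k > 0" "real k > 0" using N(1) slowly_osc_pos[OF L, of k] by auto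
      have "\<bar>ln (L k) - ln (L n)\<bar> \<le> 1" using N(2)[of n k] kN k' nm(1) NN' by auto
      then have "exp (ln (L k)) \<le> exp (1 + ln (L n))" by simp
      then have "L k \<le> exp 1 * L n" using \<open>L k > 0\<close> Ln by (simp add: exp_add)
      then have "L k / real k \<le> exp 1 * L n / real k" using \<open>real k > 0\<close> by (intro divide_right_mono) auto
      also have "\<dots> \<le> K * exp 1 * L n / real n"
        using mult_right_mono[OF k'(1), of "exp 1 * L n"] \<open>real k > 0\<close> n1 Ln by (simp add: field_simps)
      finally show ?thesis .
    qed
    have diff: "\<bar>?G m - ?G n\<bar> = \<bar>\<Sum>k=Suc (min m n)..max m n. L k / real k\<bar>"
    proof -
      have split: "?G b - ?G a = (\<Sum>k=Suc a..b. L k / real k)" if "a \<le> b" for a b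
        using sum.ub_add_nat[of 1 a "\<lambda>k. L k / real k" "b - a"] that by simp
      show ?thesis using split[of n m] split[of m n] by (cases "n \<le> m") (auto simp: min_def max_def abs_minus_commute)
    qed
    also have "\<dots> = (\<Sum>k=Suc (min m n)..max m n. L k / real k)"
    proof (intro abs_of_nonneg sum_nonneg)
      fix k assume "k \<in> {Suc (min m n)..max m n}"
      then have "k \<ge> 1" by auto
      then show "0 \<le> L k / real k" using slowly_osc_pos[OF L, of k] by simp
    qed
    also have "\<dots> \<le> of_nat (card {Suc (min m n)..max m n}) * (K * exp 1 * L n / real n)"
      by (intro sum_bounded_above tb)
    also have "\<dots> \<le> (K * real n) * (K * exp 1 * L n / real n)"
    proof (intro mult_right_mono)
      have 1: "real n \<le> K * real n" using K n1 mult_right_mono[of 1 K "real n"] by simp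
      show "real (card {Suc (min m n)..max m n}) \<le> K * real n" using 1 nm by auto
    qed (use K Ln n1 in auto)
    also have "\<dots> = C * L n" using n1 by (simp add: C_def)
    finally show "\<bar>?G m - ?G n\<bar> \<le> C * L n" .
  qed
qed

text \<open>From \<open>n\<close> to \<open>2 * n\<close> there are at most \<open>n\<close>
  logarithmic increments, each eventually at most \<open>e / n\<close>. The criterion suits
  sequences given by a product formula.\<close>

lemma slowly_osc_of_increments:
  assumes pos: "\<And>n. n \<ge> 1 \<Longrightarrow> 0 < L n"
    and inc: "(\<lambda>n. real n * (ln (L (Suc n)) - ln (L n))) \<longlonglongrightarrow> 0"
  shows "slowly_osc L"
proof (rule slowly_oscI)
  fix e :: real assume e: "e > 0"
  from tendstoD[OF inc this] obtain N where N: "\<And>n. n \<ge> N \<Longrightarrow> \<bar>real n * (ln (L (Suc n)) - ln (L n))\<bar> < e"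
    by (auto simp: eventually_sequentially dist_real_def)
  have "\<bar>ln (L m) - ln (L n)\<bar> \<le> e" if n: "max N 1 \<le> n" "n \<le> m" "m \<le> 2 * n" for n m
  proof -
    have *: "\<bar>ln (L m) - ln (L n)\<bar> \<le> (real m - real n) * (e / real n)" using n(2)
    proof (induction m rule: dec_induct)
      case (step m)
      have "\<bar>ln (L (Suc m)) - ln (L m)\<bar> \<le> e / real m"
      proof -
        have "real m * \<bar>ln (L (Suc m)) - ln (L m)\<bar> < e" using N[of m] step n(1) by (simp add: abs_mult)
        then show ?thesis using step n(1) by (simp add: pos_le_divide_eq mult.commute)
      qed
      also have "\<dots> \<le> e / real n" using step n(1) e by (intro divide_left_mono) auto
      moreover have "(real (Suc m) - real n) * (e / real n) = (real m - real n) * (e / real n) + e / real n"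
        by (simp add: left_diff_distrib distrib_right add_divide_distrib diff_divide_distrib)
      ultimately show ?case using step.IH by linarith
    qed simp
    also have "\<dots> \<le> real n * (e / real n)" using n e by (intro mult_right_mono) auto
    finally show ?thesis using n by simp
  qed
  then show "eventually (\<lambda>n. \<forall>m. n \<le> m \<longrightarrow> m \<le> 2 * n \<longrightarrow> \<bar>ln (L m) - ln (L n)\<bar> \<le> e) sequentially"
    unfolding eventually_sequentially by blast
qed (rule pos)

text \<open>Polya's argument: on a grid finer than the modulus of continuity of \<open>G\<close> the
  convergence is simultaneous, and monotonicity of \<open>F n\<close> encloses each value between
  those at neighbouring grid points. The \<open>F n\<close> may jump, as partial sums up to a floor
  do.\<close>

lemma monotone_convergence_uniform:
  fixes F :: "nat \<Rightarrow> real \<Rightarrow> real" and G :: "real \<Rightarrow> real"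
  assumes mono: "\<And>n. mono_on {0..T} (F n)" and lim: "\<And>t. 0 \<le> t \<Longrightarrow> t \<le> T \<Longrightarrow> (\<lambda>n. F n t) \<longlonglongrightarrow> G t"
    and cont: "continuous_on {0..T} G" and T: "T > 0" and e: "e > 0"
  shows "eventually (\<lambda>n. \<forall>t\<in>{0..T}. \<bar>F n t - G t\<bar> \<le> e) sequentially"
proof -
  have "uniformly_continuous_on {0..T} G" using cont by (rule compact_uniformly_continuous) simp
  then obtain d where d: "d > 0" "\<And>s t. s \<in> {0..T} \<Longrightarrow> t \<in> {0..T} \<Longrightarrow> dist t s < d \<Longrightarrow> dist (G t) (G s) < e/2"
    using e unfolding uniformly_continuous_on_def by (metis half_gt_zero)
  obtain J :: nat where J: "T / d < real J" using reals_Archimedean2 by blast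
  have J0: "J > 0" using J T d(1) by (metis divide_pos_pos gr0I less_asym of_nat_0)
  define h where "h = T / real J"
  have h: "0 < h" "h < d" "h * real J = T" using J J0 T d(1) by (auto simp: h_def field_simps)
  have "eventually (\<lambda>n. \<forall>j\<in>{..J}. \<bar>F n (h * real j) - G (h * real j)\<bar> < e/2) sequentially"
  proof (rule eventually_ball_finite)
    show "\<forall>j\<in>{..J}. eventually (\<lambda>n. \<bar>F n (h * real j) - G (h * real j)\<bar> < e/2) sequentially"
    proof
      fix j assume "j \<in> {..J}"
      then have "h * real j \<le> h * real J" using h by (intro mult_left_mono) auto
      then have "(\<lambda>n. F n (h * real j)) \<longlonglongrightarrow> G (h * real j)" using h by (intro lim) auto
      from tendstoD[OF this, of "e/2"] e
      show "eventually (\<lambda>n. \<bar>F n (h * real j) - G (h * real j)\<bar> < e/2) sequentially"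
        by (simp add: dist_real_def)
    qed
  qed simp
  then show ?thesis
  proof eventually_elim
    case (elim n)
    show ?case
    proof
      fix t assume t: "t \<in> {0..T}"
      define j where "j = nat \<lfloor>t / h\<rfloor>"
      have j: "real j \<le> t / h" "t / h < real j + 1"
      proof -
        have "0 \<le> t / h" using t h by simp
        then have "real j = of_int \<lfloor>t / h\<rfloor>" by (simp add: j_def)
        then show "real j \<le> t / h" "t / h < real j + 1" by linarith+
      qed
      have j1: "h * real j \<le> t" "t < h * real j + h" using j h by (auto simp: field_simps)
      have jJ: "j \<le> J" using j1 t h(3) h(1)
        by (metis atLeastAtMost_iff mult_le_cancel_left_pos of_nat_le_iff order_trans)
      have lo: "h * real j \<in> {0..T}" using j1 t h by auto
      have Glo: "\<bar>G t - G (h * real j)\<bar> < e/2"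
        using d(2)[OF lo t] j1 h by (simp add: dist_real_def)
      have "F n (h * real j) \<le> F n t" using mono_onD[OF mono lo t j1(1)] .
      moreover have "\<bar>F n (h * real j) - G (h * real j)\<bar> < e/2" using elim jJ by auto
      ultimately have A: "G t - F n t \<le> e" using Glo by linarith
      have "F n t - G t \<le> e"
      \<comment> \<open>Beyond \<open>J\<close> there is no grid point; in that case
        \<open>t\<close> itself is the last one.\<close>
      proof (cases "j = J")
        case True
        then have "t = h * real j" using t j1 h(3) by auto
        then have "\<bar>F n t - G t\<bar> < e/2" using elim jJ by auto
        then show ?thesis using e by linarith
      next
        case False
        then have j2: "Suc j \<le> J" using jJ by simp
        then have "h * real (Suc j) \<le> h * real J" using h by (intro mult_left_mono) auto
        then have hi: "h * real (Suc j) \<in> {0..T}" using h by auto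
        have tj: "t \<le> h * real (Suc j)" using j1 by (simp add: algebra_simps)
        have "\<bar>G (h * real (Suc j)) - G t\<bar> < e/2"
          using d(2)[OF t hi] j1 h tj by (simp add: dist_real_def algebra_simps)
        moreover have "F n t \<le> F n (h * real (Suc j))" using mono_onD[OF mono t hi tj] .
        moreover have "\<bar>F n (h * real (Suc j)) - G (h * real (Suc j))\<bar> < e/2" using elim j2 by blast
        ultimately show ?thesis by linarith
      qed
      with A show "\<bar>F n t - G t\<bar> \<le> e" by linarith
    qed
  qed
qed


section \<open>The normalising sequences at criticality\<close>

text \<open>The deterministic part of the hypotheses. \<open>p_critical\<close> is the equation
  \<open>p = critical_p \<gamma>\<close> multiplied by the positive number
  \<open>\<gamma> + 1\<close>.\<close>

locale critical_memory =
  fixes p \<gamma> :: real and \<mu> :: "nat \<Rightarrow> real"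
  assumes p_nonneg: "0 \<le> p" and \<gamma>_gt: "\<gamma> > -1"
    and \<mu>_gt_0: "\<And>n. n \<ge> 1 \<Longrightarrow> \<mu> n > 0"
    and \<mu>_rv: "regularly_varying_seq \<gamma> \<mu>"
    and p_critical: "p * (\<gamma> + 1) = \<gamma> + 1/2"
    and v_unbounded: "\<not> bounded (v_seq p \<mu> ` {1..})"
begin

text \<open>\<open>v2 n\<close> is the square of the paper's \<open>v\<^sub>n\<close>, and \<open>\<sigma>\<^sub>n = v\<^sub>n / b n\<close>. The sequences \<open>b\<close> and \<open>c\<close> are both
  regularly varying of index \<open>-1/2\<close>, by criticality.\<close>

definition "\<nu> n = memory_sum \<mu> n"
definition "a n = a_seq p \<mu> n"
definition "b n = a n * \<mu> n"
definition "v2 n = (\<Sum>k=1..n. (b k)\<^sup>2)"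
definition "c k = 1 / (a k * \<nu> k)"

lemma \<nu>_Suc: "\<nu> (Suc n) = \<nu> n + \<mu> (Suc n)"
  by (simp add: \<nu>_def memory_sum_def)

lemma \<nu>_0: "\<nu> 0 = 0"
  by (simp add: \<nu>_def memory_sum_def)

lemma \<nu>_pos: "n \<ge> 1 \<Longrightarrow> \<nu> n > 0"
  unfolding \<nu>_def memory_sum_def by (intro sum_pos) (auto intro: \<mu>_gt_0)

lemma a_1: "a 1 = 1" by (simp add: a_def a_seq_def)

lemma a_Suc: "n \<ge> 1 \<Longrightarrow> a (Suc n) = a n / (1 + p * (\<mu> (Suc n) / \<nu> n))"
  by (simp add: a_def a_seq_def \<nu>_def divide_inverse)

lemma growth_pos: "1 + p * (\<mu> (Suc n) / \<nu> n) > 0"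
proof (cases "n \<ge> 1")
  case True
  then have "0 \<le> p * (\<mu> (Suc n) / \<nu> n)" using p_nonneg \<nu>_pos[OF True] \<mu>_gt_0[of "Suc n"] by simp
  then show ?thesis by simp
next
  case False
  then have "n = 0" by simp
  then show ?thesis by (simp add: \<nu>_0)
qed

lemma a_pos: "n \<ge> 1 \<Longrightarrow> a n > 0"
proof (induction n rule: dec_induct)
  case (step n) then show ?case using growth_pos[of n] by (simp add: a_Suc)
qed (use a_1 in simp)

lemma b_pos: "n \<ge> 1 \<Longrightarrow> b n > 0"
  using a_pos \<mu>_gt_0 by (simp add: b_def)

lemma c_pos: "n \<ge> 1 \<Longrightarrow> c n > 0"
  using a_pos \<nu>_pos by (simp add: c_def)

lemma c_nonneg: "0 \<le> c n"
  using c_pos[of n] by (cases "n \<ge> 1") (auto simp: c_def \<nu>_0 not_le)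

lemma v_seq_eq: "v_seq p \<mu> n = sqrt (v2 n)"
  by (simp add: v_seq_def v2_def b_def a_def power_mult_distrib)

lemma v2_nonneg: "v2 n \<ge> 0"
  by (simp add: v2_def sum_nonneg)

lemma v2_Suc: "v2 (Suc n) = v2 n + (b (Suc n))\<^sup>2"
  by (simp add: v2_def)

lemma v2_mono: "m \<le> n \<Longrightarrow> v2 m \<le> v2 n"
  unfolding v2_def by (intro sum_mono2) auto

lemma v2_pos: "n \<ge> 1 \<Longrightarrow> v2 n > 0"
  unfolding v2_def using b_pos by (intro sum_pos) (auto simp: less_imp_neq[symmetric])

lemma v2_at_top: "filterlim v2 at_top sequentially"
  unfolding filterlim_at_top eventually_sequentially
proof
  fix Z
  have "\<exists>n\<ge>1. v2 n > Z"
  proof (rule ccontr)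
    assume "\<not> ?thesis"
    then have "\<And>n. n \<ge> 1 \<Longrightarrow> v2 n \<le> Z" by (auto simp: not_less)
    then have "bounded (v_seq p \<mu> ` {1..})"
      by (intro boundedI[of _ "sqrt Z"]) (auto simp: v_seq_eq v2_nonneg)
    then show False using v_unbounded by simp
  qed
  then obtain n where "v2 n > Z" by blast
  then show "\<exists>N. \<forall>n\<ge>N. Z \<le> v2 n" using v2_mono by (intro exI[of _ n]) (meson less_imp_le order_trans)
qed

section \<open>Asymptotics of the memory sums and of \<open>a\<close>, \<open>b\<close>,
  \<open>c\<close> and \<open>v2\<close>\<close>

lemma \<mu>_slowly_osc: "slowly_osc (\<lambda>n. \<mu> n / real n powr \<gamma>)"
  by (rule regularly_varying_imp_slowly_osc[OF \<mu>_rv \<mu>_gt_0])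

text \<open>Karamata's theorem for the partial sums of a sequence of index
  \<open>\<gamma> > -1\<close>, inverted.\<close>

lemma \<mu>_\<nu>_ratio: "(\<lambda>n. real n * \<mu> n / \<nu> n) \<longlonglongrightarrow> \<gamma> + 1"
proof -
  have "(\<lambda>n. inverse ((\<Sum>k=1..n. real k powr \<gamma> * (\<mu> k / real k powr \<gamma>)) / (real n powr (\<gamma> + 1) * (\<mu> n / real n powr \<gamma>))))
      \<longlonglongrightarrow> inverse (1 / (\<gamma> + 1))"
    using \<gamma>_gt by (intro tendsto_inverse karamata_sum \<mu>_slowly_osc) auto
  moreover have "(\<Sum>k=1..n. real k powr \<gamma> * (\<mu> k / real k powr \<gamma>)) = \<nu> n" for n
    unfolding \<nu>_def memory_sum_def by (intro sum.cong) auto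
  moreover have "eventually (\<lambda>n. real n powr (\<gamma> + 1) * (\<mu> n / real n powr \<gamma>) = real n * \<mu> n) sequentially"
    using eventually_ge_at_top[of 1] by eventually_elim (simp add: powr_add)
  then have "eventually (\<lambda>n. inverse (\<nu> n / (real n powr (\<gamma> + 1) * (\<mu> n / real n powr \<gamma>))) = real n * \<mu> n / \<nu> n) sequentially"
    by eventually_elim simp
  ultimately show ?thesis by (auto dest: Lim_transform_eventually)
qed

text \<open>Since \<open>\<nu> n = \<nu> (Suc n) - \<mu> (Suc n)\<close>, the quotient is a function
  of the ratio already known at \<open>Suc n\<close>.\<close>

lemma \<mu>_Suc_\<nu>_ratio: "(\<lambda>n. real n * (\<mu> (Suc n) / \<nu> n)) \<longlonglongrightarrow> \<gamma> + 1"
proof -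
  define r where "r n = real n * \<mu> n / \<nu> n" for n
  have r: "(\<lambda>n. r (Suc n)) \<longlonglongrightarrow> \<gamma> + 1" unfolding r_def using \<mu>_\<nu>_ratio by (rule LIMSEQ_Suc)
  have 1: "(\<lambda>n. inverse (real (Suc n))) \<longlonglongrightarrow> 0" by (rule LIMSEQ_inverse_real_of_nat)
  have 2: "(\<lambda>n. real n / real (Suc n)) \<longlonglongrightarrow> 1" by real_asymp
  have "(\<lambda>n. (real n / real (Suc n)) * r (Suc n) / (1 - r (Suc n) * inverse (real (Suc n)))) \<longlonglongrightarrow> 1 * (\<gamma> + 1) / (1 - (\<gamma> + 1) * 0)"
    by (intro tendsto_intros r 1 2) simp
  moreover have "eventually (\<lambda>n. (real n / real (Suc n)) * r (Suc n) / (1 - r (Suc n) * inverse (real (Suc n)))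
      = real n * (\<mu> (Suc n) / \<nu> n)) sequentially"
    using eventually_ge_at_top[of 1]
  proof eventually_elim
    case (elim n)
    have n: "\<nu> n > 0" "\<nu> (Suc n) > 0" using elim by (auto intro: \<nu>_pos)
    have "1 - r (Suc n) * inverse (real (Suc n)) = \<nu> n / \<nu> (Suc n)"
      using n by (simp add: r_def field_simps \<nu>_Suc del: of_nat_Suc)
    then show ?case using n by (simp add: r_def del: of_nat_Suc)
  qed
  ultimately show ?thesis by (auto dest: Lim_transform_eventually)
qed

text \<open>The logarithmic increment of \<open>a\<close> is
  \<open>- ln (1 + p * (\<mu> (Suc n) / \<nu> n))\<close>, asymptotically
  \<open>- p * (\<gamma> + 1) / n\<close>. Criticality makes the coefficient
  \<open>\<gamma> + 1/2\<close>, which the power cancels to first order.\<close>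

lemma a_slowly_osc: "slowly_osc (\<lambda>n. a n * real n powr (\<gamma> + 1/2))"
proof (rule slowly_osc_of_increments)
  define x where "x n = p * (\<mu> (Suc n) / \<nu> n)" for n
  have x0: "x n \<ge> 0" if "n \<ge> 1" for n
    using p_nonneg \<nu>_pos[OF that] \<mu>_gt_0[of "Suc n"] by (simp add: x_def)
  have nx: "(\<lambda>n. real n * x n) \<longlonglongrightarrow> \<gamma> + 1/2"
  proof -
    have "(\<lambda>n. p * (real n * (\<mu> (Suc n) / \<nu> n))) \<longlonglongrightarrow> p * (\<gamma> + 1)"
      by (intro tendsto_intros \<mu>_Suc_\<nu>_ratio)
    then show ?thesis by (simp add: x_def p_critical mult_ac)
  qed
  have xlim: "x \<longlonglongrightarrow> 0"
  proof -
    have "(\<lambda>n. inverse (real n) * (real n * x n)) \<longlonglongrightarrow> 0 * (\<gamma> + 1/2)"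
      by (intro tendsto_intros nx lim_inverse_n)
    moreover have "eventually (\<lambda>n. inverse (real n) * (real n * x n) = x n) sequentially"
      using eventually_ge_at_top[of 1] by eventually_elim simp
    ultimately show ?thesis using Lim_transform_eventually by force
  qed
  have lnx: "(\<lambda>n. real n * ln (1 + x n)) \<longlonglongrightarrow> \<gamma> + 1/2"
  proof (rule tendsto_sandwich[OF _ _ _ nx])
    show "(\<lambda>n. (real n * x n) / (1 + x n)) \<longlonglongrightarrow> \<gamma> + 1/2"
      using tendsto_divide[OF nx tendsto_add[OF tendsto_const xlim, of 1]] by simp
    show "eventually (\<lambda>n. real n * x n / (1 + x n) \<le> real n * ln (1 + x n)) sequentially"
      using eventually_ge_at_top[of 1]
    proof eventually_elim
      case (elim n)
      have "1 + x n > 0" using x0[OF elim] by simp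
      then have "- ln (1 + x n) \<le> inverse (1 + x n) - 1"
        using ln_le_minus_one[of "inverse (1 + x n)"] by (simp add: ln_inverse)
      then have "x n / (1 + x n) \<le> ln (1 + x n)" using \<open>1 + x n > 0\<close> by (simp add: field_simps)
      then show ?case using mult_left_mono[of _ _ "real n"] by fastforce
    qed
    show "eventually (\<lambda>n. real n * ln (1 + x n) \<le> real n * x n) sequentially"
      using eventually_ge_at_top[of 1]
      by eventually_elim (intro mult_left_mono ln_add_one_self_le_self x0, auto)
  qed
  have "(\<lambda>n. (\<gamma> + 1/2) * (real n * (ln (real (Suc n)) - ln (real n))) - real n * ln (1 + x n)) \<longlonglongrightarrow> (\<gamma> + 1/2) * 1 - (\<gamma> + 1/2)"
    by (intro tendsto_intros lnx) real_asymp
  moreover have "eventually (\<lambda>n. (\<gamma> + 1/2) * (real n * (ln (real (Suc n)) - ln (real n))) - real n * ln (1 + x n)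
     = real n * (ln (a (Suc n) * real (Suc n) powr (\<gamma> + 1/2)) - ln (a n * real n powr (\<gamma> + 1/2)))) sequentially"
    using eventually_ge_at_top[of 1]
  proof eventually_elim
    case (elim n)
    have *: "ln (a k * real k powr (\<gamma> + 1/2)) = ln (a k) + (\<gamma> + 1/2) * ln (real k)" if "k \<ge> 1" for k
      using a_pos[OF that] that by (simp add: ln_mult_pos ln_powr)
    have la: "ln (a (Suc n)) = ln (a n) - ln (1 + x n)"
      using a_pos[OF elim] growth_pos[of n] elim by (simp add: a_Suc x_def ln_divide_pos)
    show ?case unfolding *[OF elim] *[OF le_SucI[OF elim]] la by (simp add: algebra_simps)
  qed
  ultimately show "(\<lambda>n. real n * (ln (a (Suc n) * real (Suc n) powr (\<gamma> + 1/2)) - ln (a n * real n powr (\<gamma> + 1/2)))) \<longlonglongrightarrow> 0"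
    by (auto dest: Lim_transform_eventually)
qed (simp add: a_pos)

text \<open>The slowly varying numerator that exhibits \<open>v2\<close> as a harmonic sum, the
  boundary case of Karamata's theorem.\<close>

definition "lb n = real n * (b n)\<^sup>2"

text \<open>The index \<open>- (\<gamma> + 1/2)\<close> of \<open>a\<close> and the index
  \<open>\<gamma>\<close> of \<open>\<mu>\<close> add up to -1/2 for every
  \<open>\<gamma>\<close>.\<close>

lemma b_slowly_osc: "slowly_osc (\<lambda>n. b n * real n powr (1/2))"
proof (rule slowly_osc_cong[OF slowly_osc_mult[OF a_slowly_osc \<mu>_slowly_osc]])
  fix n :: nat assume "n \<ge> 1"
  then show "a n * real n powr (\<gamma> + 1/2) * (\<mu> n / real n powr \<gamma>) = b n * real n powr (1/2)"
    by (simp add: b_def powr_add)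
qed

lemma lb_slowly_osc: "slowly_osc lb"
proof (rule slowly_osc_cong[OF slowly_osc_mult[OF b_slowly_osc b_slowly_osc]])
  fix n :: nat assume "n \<ge> 1"
  then have "real n powr (1/2) * real n powr (1/2) = real n" by (simp add: powr_add[symmetric])
  then show "b n * real n powr (1/2) * (b n * real n powr (1/2)) = lb n"
    by (simp add: lb_def power2_eq_square mult.commute mult.left_commute)
qed

lemma v2_eq: "v2 n = (\<Sum>k=1..n. lb k / real k)"
  unfolding v2_def by (intro sum.cong) (auto simp: lb_def)

text \<open>The quantity is n divided by the square of \<sigma>_n. Its vanishing makes the
  martingale with second moment at most n negligible on the scale \<sigma>_n.\<close>

lemma lb_v2: "(\<lambda>n. real n * (b n)\<^sup>2 / v2 n) \<longlonglongrightarrow> 0"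
  using slowly_osc_harmonic_dominates[OF lb_slowly_osc] unfolding v2_eq[symmetric] unfolding lb_def .

lemma b_v2: "(\<lambda>n. (b n)\<^sup>2 / v2 n) \<longlonglongrightarrow> 0"
proof (rule tendsto_sandwich[OF _ _ tendsto_const lb_v2])
  show "eventually (\<lambda>n. (b n)\<^sup>2 / v2 n \<le> real n * (b n)\<^sup>2 / v2 n) sequentially"
    using eventually_ge_at_top[of 1]
  proof eventually_elim
    case (elim n)
    have "1 * (b n)\<^sup>2 \<le> real n * (b n)\<^sup>2" using elim by (intro mult_right_mono) auto
    then show ?case using v2_nonneg[of n] by (intro divide_right_mono) auto
  qed
qed (simp add: v2_nonneg)

text \<open>Up to the variance of the test function this bounds the mean square of the weighted
  average \<open>U h n / \<nu> n\<close>, so it is the source of all laws of large numbers below. It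
  holds because \<open>v2 n\<close> is of smaller order than \<open>n * lb n\<close>, which is the
  square of \<open>n * b n\<close>.\<close>

lemma v2_a\<nu>: "(\<lambda>n. v2 n / (a n * \<nu> n)\<^sup>2) \<longlonglongrightarrow> 0"
proof -
  have "(\<lambda>n. v2 n / (real n * lb n) * (real n * \<mu> n / \<nu> n)\<^sup>2) \<longlonglongrightarrow> 0 * (\<gamma> + 1)\<^sup>2"
    unfolding v2_eq by (intro tendsto_intros slowly_osc_harmonic_upper[OF lb_slowly_osc] \<mu>_\<nu>_ratio)
  moreover have "eventually (\<lambda>n. v2 n / (real n * lb n) * (real n * \<mu> n / \<nu> n)\<^sup>2 = v2 n / (a n * \<nu> n)\<^sup>2) sequentially"
    using eventually_ge_at_top[of 1]
  proof eventually_elim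
    case (elim n)
    then show ?case using a_pos[OF elim] \<nu>_pos[OF elim] \<mu>_gt_0[OF elim]
      by (simp add: lb_def b_def field_simps power2_eq_square)
  qed
  ultimately show ?thesis by (auto dest: Lim_transform_eventually)
qed

text \<open>\<open>c n\<close> is \<open>n * \<mu> n / \<nu> n\<close>, which converges to a
  positive limit, divided by \<open>n * b n\<close>; the index -1/2 is thus inherited from
  \<open>b\<close>.\<close>

lemma c_slowly_osc: "slowly_osc (\<lambda>n. c n * real n powr (1/2))"
proof -
  have "slowly_osc (\<lambda>n. real n * \<mu> n / \<nu> n)" if "\<gamma> + 1 > 0"
  proof (rule slowly_osc_convergent[OF _ \<mu>_\<nu>_ratio that])
    fix n :: nat assume "n \<ge> 1"
    then show "0 < real n * \<mu> n / \<nu> n" using \<mu>_gt_0[of n] \<nu>_pos[of n] by simp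
  qed
  then have "slowly_osc (\<lambda>n. (real n * \<mu> n / \<nu> n) * inverse (b n * real n powr (1/2)))"
    using \<gamma>_gt by (intro slowly_osc_mult slowly_osc_inverse b_slowly_osc) auto
  then show ?thesis
  proof (rule slowly_osc_cong)
    fix n :: nat assume n: "n \<ge> 1"
    have "real n powr (1/2) * real n powr (1/2) = real n" using n by (simp add: powr_add[symmetric])
    then have *: "real n * inverse (real n powr (1/2)) = real n powr (1/2)" using n
      by (metis mult.assoc nonzero_divide_eq_eq divide_inverse of_nat_0_eq_iff not_one_le_zero powr_eq_0_iff mult.commute)
    have "(real n * \<mu> n / \<nu> n) * inverse (b n * real n powr (1/2)) = (real n * inverse (real n powr (1/2))) * (\<mu> n / (\<nu> n * b n))"
      by (simp add: field_simps)
    also have "\<dots> = c n * real n powr (1/2)"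
      unfolding * using a_pos[OF n] \<mu>_gt_0[OF n] by (simp add: c_def b_def)
    finally show "(real n * \<mu> n / \<nu> n) * inverse (b n * real n powr (1/2)) = c n * real n powr (1/2)" .
  qed
qed

text \<open>Karamata's theorem at index -1/2 gives the factor 2, slow variation moves the
  normalisation from \<open>r n\<close> to \<open>n\<close> at the cost of \<open>sqrt t\<close>,
  and the remaining factor is \<open>n * \<mu> n / \<nu> n\<close> with limit
  \<open>\<gamma> + 1\<close>.\<close>

lemma b_c_sum:
  assumes r: "(\<lambda>n. real (r n) / real n) \<longlonglongrightarrow> t" and t: "t \<ge> 0" and r_top: "t > 0 \<Longrightarrow> filterlim r at_top sequentially"
    and r0: "t = 0 \<Longrightarrow> r = (\<lambda>_. 0)"
  shows "(\<lambda>n. b n * (\<Sum>k=1..r n. c k)) \<longlonglongrightarrow> 2 * (\<gamma> + 1) * sqrt t"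
proof (cases "t = 0")
  case True
  then show ?thesis by (simp add: r0)
next
  case False
  with t have t: "t > 0" by simp
  define L where "L n = c n * real n powr (1/2)" for n
  have L: "slowly_osc L" unfolding L_def by (rule c_slowly_osc)
  have sum_eq: "(\<Sum>k=1..n. real k powr (-1/2) * L k) = (\<Sum>k=1..n. c k)" for n
    by (intro sum.cong) (auto simp: L_def powr_minus)
  have "(\<lambda>n. (\<Sum>k=1..n. real k powr (-1/2) * L k) / (real n powr (-1/2 + 1) * L n)) \<longlonglongrightarrow> 1 / (-1/2 + 1)"
    by (rule karamata_sum[OF L]) simp
  then have K: "(\<lambda>n. (\<Sum>k=1..n. c k) / (real n powr (1/2) * L n)) \<longlonglongrightarrow> 2"
    unfolding sum_eq by simp
  have Kr: "(\<lambda>n. (\<Sum>k=1..r n. c k) / (real (r n) powr (1/2) * L (r n))) \<longlonglongrightarrow> 2"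
    by (rule filterlim_compose[OF K r_top[OF t]])
  have "(\<lambda>n. (\<Sum>k=1..r n. c k) / (real (r n) powr (1/2) * L (r n)) * (L (r n) / L n) * ((real (r n) / real n) powr (1/2)) * (real n * \<mu> n / \<nu> n))
     \<longlonglongrightarrow> 2 * 1 * (t powr (1/2)) * (\<gamma> + 1)"
    using t by (intro tendsto_intros Kr slowly_osc_ratio[OF L r t] r \<mu>_\<nu>_ratio) auto
  moreover have "eventually (\<lambda>n. r n \<ge> 1) sequentially" using r_top[OF t] by (simp add: filterlim_at_top)
  then have "eventually (\<lambda>n. (\<Sum>k=1..r n. c k) / (real (r n) powr (1/2) * L (r n)) * (L (r n) / L n) * ((real (r n) / real n) powr (1/2)) * (real n * \<mu> n / \<nu> n)
      = b n * (\<Sum>k=1..r n. c k)) sequentially"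
    using eventually_ge_at_top[of 1]
  proof eventually_elim
    case (elim n)
    have Lr: "L (r n) > 0" "L n > 0" using slowly_osc_pos[OF L] elim by auto
    have pos: "real (r n) powr (1/2) > 0" "real n powr (1/2) > 0" using elim by auto
    have "real n powr (1/2) * real n powr (1/2) = real n" using elim by (simp add: powr_add[symmetric])
    then have *: "real n * \<mu> n / \<nu> n = b n * (L n * real n powr (1/2))"
      using a_pos[of n] elim by (simp add: b_def L_def c_def mult_ac)
    show ?case unfolding * using Lr pos by (simp add: powr_divide field_simps)
  qed
  ultimately show ?thesis using t by (auto dest: Lim_transform_eventually simp: powr_half_sqrt mult_ac)
qed

lemma b_c_sum_floor:
  assumes t: "t \<ge> 0"
  shows "(\<lambda>n. b n * (\<Sum>k=1..<nat \<lfloor>real n * t\<rfloor>. c k)) \<longlonglongrightarrow> 2 * (\<gamma> + 1) * sqrt t"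
proof -
  \<comment> \<open>The walk at index j involves \<open>c k\<close> only for \<open>k < j\<close>.
    Truncated subtraction gives \<open>r = 0\<close> at \<open>t = 0\<close>, as required
    there.\<close>
  define r where "r n = nat \<lfloor>t * real n\<rfloor> - 1" for n
  have "(\<lambda>n. b n * (\<Sum>k=1..r n. c k)) \<longlonglongrightarrow> 2 * (\<gamma> + 1) * sqrt t"
  proof (rule b_c_sum[OF _ t])
    show "r = (\<lambda>_. 0)" if "t = 0" using that by (simp add: r_def fun_eq_iff)
    show top: "filterlim r at_top sequentially" if "t > 0"
      unfolding r_def by (rule filterlim_compose[OF filterlim_minus_const_nat_at_top nat_floor_at_top[OF that]])
    show "(\<lambda>n. real (r n) / real n) \<longlonglongrightarrow> t"
    proof (cases "t = 0")
      case False
      with t have tp: "t > 0" by simp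
      have "(\<lambda>n. real (nat \<lfloor>t * real n\<rfloor>) / real n - 1 / real n) \<longlonglongrightarrow> t - 0"
        by (intro tendsto_intros nat_floor_ratio t lim_1_over_n)
      moreover have "eventually (\<lambda>n. r n \<ge> 1) sequentially" using top[OF tp] by (simp add: filterlim_at_top)
      then have "eventually (\<lambda>n. real (nat \<lfloor>t * real n\<rfloor>) / real n - 1 / real n = real (r n) / real n) sequentially"
        by eventually_elim (simp add: r_def diff_divide_distrib)
      ultimately show ?thesis by (auto dest: Lim_transform_eventually)
    qed (simp add: r_def)
  qed
  moreover have "{1..r n} = {1..<nat \<lfloor>real n * t\<rfloor>}" for n by (auto simp: r_def mult.commute)
  ultimately show ?thesis by simp
qed

lemma b_c_sum_floor_uniform:
  assumes T: "T > 0" and e: "e > 0"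
  shows "eventually (\<lambda>n. \<forall>t\<in>{0..T}. \<bar>b n * (\<Sum>k=1..<nat \<lfloor>real n * t\<rfloor>. c k) - 2 * (\<gamma> + 1) * sqrt t\<bar> \<le> e) sequentially"
proof -
  \<comment> \<open>No sign is available for \<open>b 0\<close>. Fixing the value at
    \<open>n = 0\<close> gives monotonicity in \<open>t\<close> for every \<open>n\<close> without
    affecting the limit.\<close>
  have "eventually (\<lambda>n. \<forall>t\<in>{0..T}. \<bar>(if n = 0 then 0 else b n * (\<Sum>k=1..<nat \<lfloor>real n * t\<rfloor>. c k)) - 2 * (\<gamma> + 1) * sqrt t\<bar> \<le> e) sequentially"
  proof (rule monotone_convergence_uniform[OF _ _ _ T e])
    show "mono_on {0..T} (\<lambda>t. if n = 0 then 0 else b n * (\<Sum>k=1..<nat \<lfloor>real n * t\<rfloor>. c k))" for n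
    proof (rule mono_onI)
      fix s t assume st: "s \<in> {0..T}" "t \<in> {0..T}" "s \<le> t"
      have "nat \<lfloor>real n * s\<rfloor> \<le> nat \<lfloor>real n * t\<rfloor>"
        using st by (intro nat_mono floor_mono mult_left_mono) auto
      then have "(\<Sum>k=1..<nat \<lfloor>real n * s\<rfloor>. c k) \<le> (\<Sum>k=1..<nat \<lfloor>real n * t\<rfloor>. c k)"
        by (intro sum_mono2) (auto intro: c_nonneg)
      then show "(if n = 0 then 0 else b n * (\<Sum>k=1..<nat \<lfloor>real n * s\<rfloor>. c k)) \<le> (if n = 0 then 0 else b n * (\<Sum>k=1..<nat \<lfloor>real n * t\<rfloor>. c k))"
        using b_pos[of n] by (auto intro!: mult_left_mono)
    qed
    fix t :: real assume "0 \<le> t" "t \<le> T"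
    have "eventually (\<lambda>n. b n * (\<Sum>k=1..<nat \<lfloor>real n * t\<rfloor>. c k) = (if n = 0 then 0 else b n * (\<Sum>k=1..<nat \<lfloor>real n * t\<rfloor>. c k))) sequentially"
      using eventually_ge_at_top[of 1] by eventually_elim simp
    then show "(\<lambda>n. if n = 0 then 0 else b n * (\<Sum>k=1..<nat \<lfloor>real n * t\<rfloor>. c k)) \<longlonglongrightarrow> 2 * (\<gamma> + 1) * sqrt t"
      using b_c_sum_floor[OF \<open>0 \<le> t\<close>] by (rule Lim_transform_eventually[rotated])
  qed (intro continuous_intros)
  then show ?thesis using eventually_ge_at_top[of 1] by eventually_elim simp
qed

text \<open>\<open>sqrt \<bar>v2 n - v2 k\<bar>\<close> bounds the mean distance between the
  martingale at \<open>k\<close> and at \<open>n\<close>, so this sum bounds the total cost of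
  freezing it at time \<open>n\<close>. Below \<open>s * n\<close> the crude bound
  \<open>sqrt (v2 n)\<close> suffices because the weights are small; above, the change of
  \<open>v2\<close> is at most a multiple of \<open>lb n\<close>.\<close>

lemma v2_c_sum:
  assumes T: "T > 0"
  shows "(\<lambda>n. b n / sqrt (v2 n) * (\<Sum>k=1..<nat \<lfloor>real n * T\<rfloor>. sqrt \<bar>v2 n - v2 k\<bar> * c k)) \<longlonglongrightarrow> 0"
proof (rule tendstoI)
  fix e :: real assume e: "e > 0"
  define K where "K = 2 * (\<gamma> + 1)"
  have K: "K > 0" using \<gamma>_gt by (simp add: K_def)
  obtain s where s: "s > 0" "s \<le> T" "s \<le> 1" "2 * K * sqrt s * 2 < e / 2"
  proof -
    \<comment> \<open>\<open>b n\<close> times the weights below \<open>s * n\<close> tends to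
      \<open>K * sqrt s\<close>, hence is eventually below \<open>2 * K * sqrt s\<close>, here at
      most \<open>e / 8\<close>. The cap 1 ensures \<open>v2 k \<le> v2 n\<close> on this
      range.\<close>
    define s where "s = min (min T 1) ((e / (16 * K))\<^sup>2)"
    have "sqrt s \<le> e / (16 * K)" unfolding s_def using e K by (intro real_le_lsqrt) auto
    then have "2 * K * sqrt s * 2 \<le> e / 4" using K by (simp add: field_simps)
    then show ?thesis using that[of s] e K T by (auto simp: s_def)
  qed
  \<comment> \<open>Indices from \<open>s * n\<close> to \<open>T * n\<close> lie within a factor
    \<open>Q\<close> of \<open>n\<close>. Using \<open>s / 2\<close> in place of \<open>s\<close>
    absorbs the rounding in \<open>n * s < k + 1\<close>, since \<open>n * s > 2\<close>
    eventually.\<close>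
  define Q where "Q = max (max T 1) (1 / (s / 2))"
  have Q: "Q \<ge> 1" "T \<le> Q" "2 / s \<le> Q" by (auto simp: Q_def)
  obtain C N where CN: "C \<ge> 0" "N \<ge> 1"
    "\<And>n m. N \<le> n \<Longrightarrow> real m \<le> Q * real n \<Longrightarrow> real n \<le> Q * real m \<Longrightarrow> \<bar>v2 m - v2 n\<bar> \<le> C * lb n"
    using slowly_osc_harmonic_increment[OF lb_slowly_osc Q(1)] unfolding v2_eq by blast
  define KT where "KT = K * sqrt T + 1"
  have KT: "KT > 0" using K T unfolding KT_def by (intro add_nonneg_pos mult_nonneg_nonneg) auto
  have "(\<lambda>n. sqrt (C * (real n * (b n)\<^sup>2 / v2 n))) \<longlonglongrightarrow> sqrt (C * 0)" by (intro tendsto_intros lb_v2)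
  then have ev1: "eventually (\<lambda>n. sqrt (C * (real n * (b n)\<^sup>2 / v2 n)) < e / (2 * KT)) sequentially"
    using e KT by (intro order_tendstoD(2)) auto
  have ev2: "eventually (\<lambda>n. b n * (\<Sum>k=1..<nat \<lfloor>real n * s\<rfloor>. c k) < 2 * K * sqrt s) sequentially"
    using K s b_c_sum_floor[of s] by (intro order_tendstoD(2)[of _ "K * sqrt s"]) (auto simp: K_def)
  have ev3: "eventually (\<lambda>n. b n * (\<Sum>k=1..<nat \<lfloor>real n * T\<rfloor>. c k) < KT) sequentially"
    using T b_c_sum_floor[of T] by (intro order_tendstoD(2)[of _ "K * sqrt T"]) (auto simp: K_def KT_def)
  have ev4: "eventually (\<lambda>n. 2 / s < real n) sequentially"
    using filterlim_real_sequentially by (simp add: filterlim_at_top_dense)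
  show "eventually (\<lambda>n. dist (b n / sqrt (v2 n) * (\<Sum>k=1..<nat \<lfloor>real n * T\<rfloor>. sqrt \<bar>v2 n - v2 k\<bar> * c k)) 0 < e) sequentially"
    using ev1 ev2 ev3 ev4 eventually_ge_at_top[of N]
  proof eventually_elim
    case (elim n)
    have n: "n \<ge> 1" using elim CN(2) by auto
    have vn: "v2 n > 0" by (rule v2_pos[OF n])
    define D where "D = sqrt (C * lb n)"
    have lbn: "lb n > 0" using slowly_osc_pos[OF lb_slowly_osc n] .
    have D: "D \<ge> 0" using CN(1) lbn by (simp add: D_def)
    let ?m = "nat \<lfloor>real n * T\<rfloor>" and ?j = "nat \<lfloor>real n * s\<rfloor>"
    have jm: "?j \<le> ?m" using s by (intro nat_mono floor_mono mult_left_mono) auto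
    have tb: "sqrt \<bar>v2 n - v2 k\<bar> * c k \<le> (if k < ?j then sqrt (v2 n) * c k else 0) + D * c k" if k: "k \<in> {1..<?m}" for k
    proof (cases "k < ?j")
      case True
      have "real k \<le> real n * s" using True by linarith
      also have "\<dots> \<le> real n * 1" using s by (intro mult_left_mono) auto
      finally have "v2 k \<le> v2 n" by (intro v2_mono) simp
      then have "\<bar>v2 n - v2 k\<bar> \<le> v2 n" using v2_nonneg[of k] by simp
      then have "sqrt \<bar>v2 n - v2 k\<bar> * c k \<le> sqrt (v2 n) * c k" using c_pos[of k] k by (intro mult_right_mono) auto
      moreover have "0 \<le> D * c k" using D c_pos[of k] k by simp
      ultimately show ?thesis using True by simp
    next
      case False
      have "real k \<le> real n * T" using k by (simp, linarith)
      also have "\<dots> \<le> Q * real n" using Q mult_right_mono[OF Q(2), of "real n"] by (simp add: mult.commute)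
      finally have 1: "real k \<le> Q * real n" .
      have "real n * s < real k + 1" using False k by (simp, linarith)
      moreover have "real n * s > 2" using elim(4) s by (simp add: field_simps)
      ultimately have "real n * s \<le> 2 * real k" by linarith
      then have "real n \<le> 2 / s * real k" using s by (simp add: field_simps)
      also have "\<dots> \<le> Q * real k" using Q by (intro mult_right_mono) auto
      finally have "\<bar>v2 k - v2 n\<bar> \<le> C * lb n" using CN(3)[OF elim(5) 1] by simp
      then have "sqrt \<bar>v2 n - v2 k\<bar> \<le> D" unfolding D_def by (subst abs_minus_commute) simp
      then have "sqrt \<bar>v2 n - v2 k\<bar> * c k \<le> D * c k" using c_pos[of k] k by (intro mult_right_mono) auto
      then show ?thesis using False by simp
    qed
    have "(\<Sum>k=1..<?m. sqrt \<bar>v2 n - v2 k\<bar> * c k) \<le> (\<Sum>k=1..<?m. (if k < ?j then sqrt (v2 n) * c k else 0) + D * c k)"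
      by (intro sum_mono tb)
    also have "\<dots> = (\<Sum>k\<in>{1..<?m} \<inter> {k. k < ?j}. sqrt (v2 n) * c k) + D * (\<Sum>k=1..<?m. c k)"
      by (simp add: sum.distrib sum_distrib_left sum.If_cases)
    also have "{1..<?m} \<inter> {k. k < ?j} = {1..<?j}" using jm by auto
    finally have S: "(\<Sum>k=1..<?m. sqrt \<bar>v2 n - v2 k\<bar> * c k) \<le> sqrt (v2 n) * (\<Sum>k=1..<?j. c k) + D * (\<Sum>k=1..<?m. c k)"
      by (simp add: sum_distrib_left)
    have bv: "b n / sqrt (v2 n) > 0" using b_pos[OF n] vn by simp
    have "b n / sqrt (v2 n) * (\<Sum>k=1..<?m. sqrt \<bar>v2 n - v2 k\<bar> * c k)
        \<le> b n / sqrt (v2 n) * (sqrt (v2 n) * (\<Sum>k=1..<?j. c k) + D * (\<Sum>k=1..<?m. c k))"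
      using S bv by (intro mult_left_mono) auto
    also have "\<dots> = b n * (\<Sum>k=1..<?j. c k) + D / sqrt (v2 n) * (b n * (\<Sum>k=1..<?m. c k))"
      using vn by (simp add: field_simps)
    also have "D / sqrt (v2 n) = sqrt (C * (real n * (b n)\<^sup>2 / v2 n))"
      by (simp add: D_def real_sqrt_divide[symmetric] lb_def)
    also have "b n * (\<Sum>k=1..<?j. c k) + sqrt (C * (real n * (b n)\<^sup>2 / v2 n)) * (b n * (\<Sum>k=1..<?m. c k))
       < e / 2 + e / (2 * KT) * KT"
    proof (intro add_less_le_mono mult_mono)
      have "0 \<le> 2 * K * sqrt s" using K s by simp
      then show "b n * (\<Sum>k=1..<?j. c k) < e / 2" using elim(2) s(4) by linarith
      show "0 \<le> b n * (\<Sum>k=1..<?m. c k)" using b_pos[OF n]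
        by (intro mult_nonneg_nonneg sum_nonneg) (auto intro: c_nonneg)
    qed (use elim(1,3) e KT in auto)
    also have "\<dots> = e" using KT by simp
    finally have lt: "b n / sqrt (v2 n) * (\<Sum>k=1..<?m. sqrt \<bar>v2 n - v2 k\<bar> * c k) < e" .
    have "0 \<le> b n / sqrt (v2 n) * (\<Sum>k=1..<?m. sqrt \<bar>v2 n - v2 k\<bar> * c k)"
      using bv by (intro mult_nonneg_nonneg sum_nonneg) (auto intro: c_nonneg)
    with lt show ?case by (simp add: dist_real_def)
  qed
qed

lemma weighted_b_average_tendsto_0:
  assumes "x \<longlonglongrightarrow> 0"
  shows "(\<lambda>n. (\<Sum>k=1..n. (b k)\<^sup>2 * x k) / v2 n) \<longlonglongrightarrow> 0"
  using weighted_average_tendsto_0[of "\<lambda>k. (b k)\<^sup>2" x] v2_at_top assms by (simp add: v2_def[abs_def])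

end


section \<open>Convergence to random multiples of a fixed path\<close>

interpretation skorohod: Metric_space skorohod_space skorohod_dist
  by (rule Metric_space_skorohod)

lemma topspace_skorohod: "topspace skorohod_topology = skorohod_space"
  by (simp add: skorohod_topology_def)

section \<open>Skorohod distance under uniform closeness, and continuity of path-valued maps\<close>

lemma skorohod_dist_on_taper_le:
  assumes e: "0 < e" and le: "\<And>t. 0 \<le> t \<Longrightarrow> t \<le> T \<Longrightarrow> \<bar>x t - y t\<bar> \<le> e"
  shows "skorohod_dist_on T (taper T x) (taper T y) \<le> e"
proof (rule skorohod_dist_on_le[OF e time_changes_id])
  fix t assume t: "t \<in> {0..T}"
  have "\<bar>taper T x t - taper T y t\<bar> = max 0 (min 1 (T - t)) * \<bar>x t - y t\<bar>"
    by (simp add: taper_def right_diff_distrib[symmetric] abs_mult)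
  also have "\<dots> \<le> 1 * e" using t le by (intro mult_mono) auto
  finally show "\<bar>taper T x t - taper T y t\<bar> \<le> e" by simp
qed (use e in simp)

text \<open>The first \<open>m\<close> terms of the series have horizons at most \<open>m\<close>
  and are handled by the identity time change; the tail has total weight \<open>(1/2) ^ m\<close>
  because every truncated distance is at most 1.\<close>

lemma skorohod_dist_le_uniform:
  assumes e: "0 < e" and le: "\<And>t. 0 \<le> t \<Longrightarrow> t \<le> real m \<Longrightarrow> \<bar>x t - y t\<bar> \<le> e"
  shows "skorohod_dist x y \<le> e + (1/2) ^ m"
proof -
  let ?f = "\<lambda>m. (1/2) ^ Suc m * skorohod_dist_on (real (Suc m)) (taper (real (Suc m)) x) (taper (real (Suc m)) y)"
  have half: "(\<lambda>i. (1/2) ^ m * (1/2) ^ Suc i) sums ((1/2) ^ m * (1::real))"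
    by (intro sums_mult power_half_series)
  have "skorohod_dist x y = (\<Sum>i. ?f (i + m)) + (\<Sum>i<m. ?f i)"
    unfolding skorohod_dist_def by (rule suminf_split_initial_segment[OF skorohod_dist_summable])
  also have "(\<Sum>i. ?f (i + m)) \<le> (\<Sum>i. (1/2) ^ m * (1/2) ^ Suc i)"
  proof (rule suminf_le)
    show "?f (i + m) \<le> (1/2) ^ m * (1/2) ^ Suc i" for i
      using mult_left_mono[OF skorohod_dist_on_le_1, of "(1/2) ^ Suc (i + m)"]
      by (simp add: power_add mult_ac)
    show "summable (\<lambda>i. ?f (i + m))" by (rule summable_ignore_initial_segment[OF skorohod_dist_summable])
    show "summable (\<lambda>i. (1/2) ^ m * (1/2::real) ^ Suc i)" using half by (rule sums_summable)
  qed
  also have "(\<Sum>i. (1/2) ^ m * (1/2) ^ Suc i) = (1/2::real) ^ m"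
    using sums_unique[OF half] by simp
  also have "(\<Sum>i<m. ?f i) \<le> (\<Sum>i<m. (1/2) ^ Suc i * e)"
  proof (intro sum_mono mult_left_mono skorohod_dist_on_taper_le[OF e])
    fix i t assume "i \<in> {..<m}" "0 \<le> t" "t \<le> real (Suc i)"
    then show "\<bar>x t - y t\<bar> \<le> e" by (intro le) auto
  qed simp
  also have "\<dots> = (1 - (1/2) ^ m) * e"
    unfolding sum_distrib_right[symmetric] by (induction m) (auto simp: algebra_simps)
  also have "\<dots> \<le> e" using e by (simp add: algebra_simps)
  finally show ?thesis by simp
qed

text \<open>Continuity for locally uniform convergence of the values. The domain is an arbitrary
  topological space so that both the sequences of walk positions, with the product topology, and the
  real slopes qualify as parameters.\<close>

definition locally_uniformly_continuous :: "('x::topological_space \<Rightarrow> real \<Rightarrow> real) \<Rightarrow> bool" where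
  "locally_uniformly_continuous F \<longleftrightarrow> (\<forall>x0. \<forall>m::nat. \<forall>e>0.
     eventually (\<lambda>x. \<forall>t. 0 \<le> t \<longrightarrow> t \<le> real m \<longrightarrow> \<bar>F x0 t - F x t\<bar> \<le> e) (nhds x0))"

lemma locally_uniformly_continuous_dist:
  assumes F: "locally_uniformly_continuous F" and r: "r > 0"
  shows "eventually (\<lambda>x. skorohod_dist (F x0) (F x) < r) (nhds x0)"
proof -
  obtain m where m: "(1/2) ^ m < r / 2" using real_arch_pow_inv[of "r/2" "1/2"] r by auto
  have "eventually (\<lambda>x. \<forall>t. 0 \<le> t \<longrightarrow> t \<le> real m \<longrightarrow> \<bar>F x0 t - F x t\<bar> \<le> r/2) (nhds x0)"
    by (rule F[unfolded locally_uniformly_continuous_def, rule_format]) (use r in simp)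
  then show ?thesis
  proof eventually_elim
    case (elim x)
    then have "skorohod_dist (F x0) (F x) \<le> r/2 + (1/2) ^ m"
      using r by (intro skorohod_dist_le_uniform) auto
    then show ?case using m by simp
  qed
qed

lemma locally_uniformly_continuous_map:
  assumes F: "locally_uniformly_continuous F" and D: "\<And>x. F x \<in> skorohod_space"
  shows "continuous_map euclidean skorohod_topology F"
  unfolding continuous_map_def
proof (intro conjI allI impI)
  fix U assume U: "openin skorohod_topology U"
  have "open {x. F x \<in> U}" unfolding open_subopen[of "{x. F x \<in> U}"]
  proof safe
    fix x0 assume "F x0 \<in> U"
    then obtain r where r: "r > 0" "skorohod.mball (F x0) r \<subseteq> U"
      using U unfolding skorohod_topology_def skorohod.openin_mtopology by blast
    obtain V where V: "open V" "x0 \<in> V" "\<And>x. x \<in> V \<Longrightarrow> skorohod_dist (F x0) (F x) < r"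
      using locally_uniformly_continuous_dist[OF F r(1), of x0] by (auto simp: eventually_nhds)
    then show "\<exists>T. open T \<and> x0 \<in> T \<and> T \<subseteq> {x. F x \<in> U}"
      using r(2) D by (intro exI[of _ V]) (auto simp: skorohod.in_mball)
  qed
  then show "openin euclidean {x \<in> topspace euclidean. F x \<in> U}" by simp
qed (auto simp: topspace_skorohod D)

text \<open>Path-valued random elements are obtained as continuous images of Borel random
  parameters, which avoids describing the Borel sets of the path space.\<close>

lemma measurable_borel_sigmaI:
  assumes "continuous_map euclidean T F" "g \<in> borel_measurable M"
  shows "(\<lambda>\<omega>. F (g \<omega>)) \<in> measurable M (borel_sigma T)"
  unfolding borel_sigma_def
proof (rule measurable_measure_of)
  show "{U. openin T U} \<subseteq> Pow (topspace T)" by (auto dest: openin_subset)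
  show "(\<lambda>\<omega>. F (g \<omega>)) \<in> space M \<rightarrow> topspace T"
    using assms(1) by (auto simp: continuous_map_def)
  fix U assume "U \<in> {U. openin T U}"
  then have "open {x. F x \<in> U}" using assms(1) by (auto simp: continuous_map_def)
  from measurable_sets[OF assms(2) borel_open[OF this]]
  show "(\<lambda>\<omega>. F (g \<omega>)) -` U \<inter> space M \<in> sets M" by (simp add: vimage_def)
qed

lemma continuous_map_borel_sigma:
  fixes f :: "'a \<Rightarrow> 'b::topological_space"
  assumes f: "continuous_map T euclidean f"
  shows "f \<in> borel_measurable (borel_sigma T)"
proof (rule borel_measurableI)
  fix U :: "'b set" assume "open U"
  then have "openin T {x \<in> topspace T. f x \<in> U}"
    by (intro openin_continuous_map_preimage[OF f]) simp
  moreover have "f -` U \<inter> space (borel_sigma T) = {x \<in> topspace T. f x \<in> U}"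
    by (auto simp: borel_sigma_def space_measure_of_conv)
  moreover have "{U. openin T U} \<subseteq> Pow (topspace T)" by (auto dest: openin_subset)
  ultimately show "f -` U \<inter> space (borel_sigma T) \<in> sets (borel_sigma T)"
    by (simp add: borel_sigma_def sigma_sets.Basic)
qed

text \<open>Curried so that for fixed \<open>n\<close> and \<open>s\<close> it is a map of the whole
  sequence of positions, to which continuity can be applied.\<close>

definition step_path :: "nat \<Rightarrow> real \<Rightarrow> (nat \<Rightarrow> real) \<Rightarrow> real \<Rightarrow> real" where
  "step_path n s S = (\<lambda>t\<in>{0..}. S (nat \<lfloor>real n * t\<rfloor>) / s)"

definition root_path :: "real \<Rightarrow> real \<Rightarrow> real \<Rightarrow> real" where
  "root_path K z = (\<lambda>t\<in>{0..}. sqrt t * K * z)"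

lemma eventually_floor_right:
  "eventually (\<lambda>u. \<lfloor>real n * u\<rfloor> = \<lfloor>real n * t\<rfloor>) (at_right t)"
proof (cases "n = 0")
  case False
  define z where "z = (of_int \<lfloor>real n * t\<rfloor> + 1) / real n"
  have "real n * t < of_int \<lfloor>real n * t\<rfloor> + 1" by linarith
  then have "t < z" using False by (simp add: z_def field_simps)
  then show ?thesis unfolding eventually_at_right_field
  proof (intro exI[of _ z] conjI allI impI)
    fix u assume u: "t < u" "u < z"
    have "real n * u < of_int \<lfloor>real n * t\<rfloor> + 1" using u(2) False by (simp add: z_def field_simps)
    moreover have "real n * t \<le> real n * u" using u by (intro mult_left_mono) auto
    ultimately show "\<lfloor>real n * u\<rfloor> = \<lfloor>real n * t\<rfloor>" by linarith
  qed simp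
qed simp

text \<open>At a jump time the left limit uses the index before the jump, hence the ceiling minus
  one; for \<open>n = 0\<close> the index is constantly 0.\<close>

lemma eventually_floor_left:
  "eventually (\<lambda>u. \<lfloor>real n * u\<rfloor> = (if n = 0 then 0 else \<lceil>real n * t\<rceil> - 1)) (at_left t)"
proof (cases "n = 0")
  case False
  define z where "z = (of_int \<lceil>real n * t\<rceil> - 1) / real n"
  have "of_int \<lceil>real n * t\<rceil> - 1 < real n * t" by linarith
  then have "z < t" using False by (simp add: z_def field_simps)
  then show ?thesis unfolding eventually_at_left_field
  proof (intro exI[of _ z] conjI allI impI)
    fix u assume u: "z < u" "u < t"
    have "of_int \<lceil>real n * t\<rceil> - 1 < real n * u" using u(1) False by (simp add: z_def field_simps)
    moreover have "real n * u < real n * t" using u False by (intro mult_strict_left_mono) auto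
    ultimately have "\<lfloor>real n * u\<rfloor> = \<lceil>real n * t\<rceil> - 1" by linarith
    then show "\<lfloor>real n * u\<rfloor> = (if n = 0 then 0 else \<lceil>real n * t\<rceil> - 1)" using False by simp
  qed simp
qed simp

lemma step_path_skorohod: "step_path n s S \<in> skorohod_space"
  unfolding skorohod_space_def
proof (intro CollectI conjI allI impI)
  show "step_path n s S \<in> extensional {0..}" by (simp add: step_path_def)
  fix t :: real
  { assume t: "t \<ge> 0"
    have "eventually (\<lambda>u. step_path n s S u = step_path n s S t) (at_right t)"
      using eventually_floor_right[of n t] eventually_at_right_less[of t]
      by eventually_elim (use t in \<open>simp add: step_path_def\<close>)
    then show "(step_path n s S \<longlongrightarrow> step_path n s S t) (at_right t)" by (rule tendsto_eventually) }
  assume t: "t > 0"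
  have "eventually (\<lambda>u. 0 < u) (at_left t)"
    unfolding eventually_at_left_field using t by (intro exI[of _ 0]) auto
  then have "eventually (\<lambda>u. step_path n s S u = S (nat (if n = 0 then 0 else \<lceil>real n * t\<rceil> - 1)) / s) (at_left t)"
    using eventually_floor_left[of n t] by eventually_elim (simp add: step_path_def)
  then show "\<exists>l. (step_path n s S \<longlongrightarrow> l) (at_left t)" by (intro exI) (rule tendsto_eventually)
qed

lemma root_path_skorohod: "root_path K z \<in> skorohod_space"
  unfolding skorohod_space_def
proof (intro CollectI conjI allI impI)
  show "root_path K z \<in> extensional {0..}" by (simp add: root_path_def)
  fix t :: real
  { assume t: "t \<ge> 0"
    have "((\<lambda>t. sqrt t * K * z) \<longlongrightarrow> sqrt t * K * z) (at_right t)" by (intro tendsto_intros)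
    moreover have "eventually (\<lambda>u. sqrt u * K * z = root_path K z u) (at_right t)"
      using eventually_at_right_less[of t] by eventually_elim (use t in \<open>simp add: root_path_def\<close>)
    moreover have "root_path K z t = sqrt t * K * z" using t by (simp add: root_path_def)
    ultimately show "(root_path K z \<longlongrightarrow> root_path K z t) (at_right t)"
      by (simp only:) (rule Lim_transform_eventually) }
  assume t: "t > 0"
  have "eventually (\<lambda>u. 0 < u) (at_left t)"
    unfolding eventually_at_left_field using t by (intro exI[of _ 0]) auto
  then have "eventually (\<lambda>u. sqrt u * K * z = root_path K z u) (at_left t)"
    by eventually_elim (simp add: root_path_def)
  moreover have "((\<lambda>t. sqrt t * K * z) \<longlongrightarrow> sqrt t * K * z) (at_left t)" by (intro tendsto_intros)
  ultimately show "\<exists>l. (root_path K z \<longlongrightarrow> l) (at_left t)"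
    by (intro exI[of _ "sqrt t * K * z"]) (rule Lim_transform_eventually)
qed

text \<open>Up to time \<open>m\<close> the path depends on the coordinates
  \<open>k \<le> n * m\<close> only, so convergence in finitely many coordinates suffices.\<close>

lemma step_path_continuous: "locally_uniformly_continuous (step_path n s)"
  unfolding locally_uniformly_continuous_def
proof (intro allI impI)
  fix S0 :: "nat \<Rightarrow> real" and m :: nat and e :: real assume e: "e > 0"
  \<comment> \<open>For \<open>s = 0\<close> division yields 0, so both paths vanish and any
    tolerance works.\<close>
  define d where "d = (if s = 0 then 1 else e * \<bar>s\<bar>)"
  have d: "d > 0" using e by (simp add: d_def)
  have "eventually (\<lambda>S. \<forall>k\<in>{..n * m}. \<bar>S0 k - S k\<bar> < d) (nhds S0)"
  proof (rule eventually_ball_finite)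
    show "\<forall>k\<in>{..n * m}. eventually (\<lambda>S. \<bar>S0 k - S k\<bar> < d) (nhds S0)"
    proof
      fix k
      have "continuous_on UNIV (\<lambda>S::nat \<Rightarrow> real. S k)" by (rule continuous_on_product_coordinates)
      then have "isCont (\<lambda>S::nat \<Rightarrow> real. S k) S0" using continuous_on_eq_continuous_at[OF open_UNIV] by blast
      then have "((\<lambda>S::nat \<Rightarrow> real. S k) \<longlongrightarrow> S0 k) (nhds S0)"
        by (simp add: isCont_def tendsto_nhds_iff)
      from tendstoD[OF this d] show "eventually (\<lambda>S. \<bar>S0 k - S k\<bar> < d) (nhds S0)"
        by (simp add: dist_real_def abs_minus_commute)
    qed
  qed simp
  then show "eventually (\<lambda>S. \<forall>t. 0 \<le> t \<longrightarrow> t \<le> real m \<longrightarrow> \<bar>step_path n s S0 t - step_path n s S t\<bar> \<le> e) (nhds S0)"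
  proof eventually_elim
    case (elim S)
    show ?case
    proof (intro allI impI)
      fix t :: real assume t: "0 \<le> t" "t \<le> real m"
      have "real n * t \<le> real n * real m" using t by (intro mult_left_mono) auto
      then have "nat \<lfloor>real n * t\<rfloor> \<le> n * m" by (simp add: nat_le_iff floor_le_iff)
      then have *: "\<bar>S0 (nat \<lfloor>real n * t\<rfloor>) - S (nat \<lfloor>real n * t\<rfloor>)\<bar> < d" using elim by auto
      show "\<bar>step_path n s S0 t - step_path n s S t\<bar> \<le> e"
      proof (cases "s = 0")
        case False
        have "\<bar>step_path n s S0 t - step_path n s S t\<bar> = \<bar>S0 (nat \<lfloor>real n * t\<rfloor>) - S (nat \<lfloor>real n * t\<rfloor>)\<bar> / \<bar>s\<bar>"
          using t by (simp add: step_path_def diff_divide_distrib[symmetric])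
        also have "\<dots> \<le> d / \<bar>s\<bar>" using * by (intro divide_right_mono) auto
        also have "\<dots> = e" using False by (simp add: d_def)
        finally show ?thesis .
      qed (use t e in \<open>simp add: step_path_def\<close>)
    qed
  qed
qed

lemma root_path_continuous: "locally_uniformly_continuous (root_path K)"
  unfolding locally_uniformly_continuous_def
proof (intro allI impI)
  fix z0 :: real and m :: nat and e :: real assume e: "e > 0"
  define d where "d = e / (sqrt (real m) * \<bar>K\<bar> + 1)"
  have q: "sqrt (real m) * \<bar>K\<bar> + 1 > 0" by (intro add_nonneg_pos mult_nonneg_nonneg) auto
  have d: "d > 0" using e q by (simp add: d_def)
  have "eventually (\<lambda>z. dist z z0 < d) (nhds z0)" using d by (auto simp: eventually_nhds_metric)
  then show "eventually (\<lambda>z. \<forall>t. 0 \<le> t \<longrightarrow> t \<le> real m \<longrightarrow> \<bar>root_path K z0 t - root_path K z t\<bar> \<le> e) (nhds z0)"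
  proof eventually_elim
    case (elim z)
    show ?case
    proof (intro allI impI)
      fix t :: real assume t: "0 \<le> t" "t \<le> real m"
      have "\<bar>root_path K z0 t - root_path K z t\<bar> = sqrt t * \<bar>K\<bar> * \<bar>z0 - z\<bar>"
        using t by (simp add: root_path_def right_diff_distrib[symmetric] abs_mult)
      also have "\<dots> \<le> (sqrt (real m) * \<bar>K\<bar> + 1) * d"
      proof (intro mult_mono)
        show "sqrt t * \<bar>K\<bar> \<le> sqrt (real m) * \<bar>K\<bar> + 1"
          using mult_right_mono[of "sqrt t" "sqrt (real m)" "\<bar>K\<bar>"] t by simp
      qed (use elim q in \<open>auto simp: dist_real_def\<close>)
      also have "\<dots> = e" using q by (simp add: d_def)
      finally show "\<bar>root_path K z0 t - root_path K z t\<bar> \<le> e" .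
    qed
  qed
qed

lemma step_path_measurable:
  assumes "\<And>k. S k \<in> borel_measurable M"
  shows "(\<lambda>\<omega>. step_path n s (\<lambda>k. S k \<omega>)) \<in> measurable M (borel_sigma skorohod_topology)"
proof -
  have "(\<lambda>\<omega> k. S k \<omega>) \<in> borel_measurable M" by (rule measurable_coordinatewise_then_product) (rule assms)
  with locally_uniformly_continuous_map[OF step_path_continuous step_path_skorohod]
  show ?thesis by (rule measurable_borel_sigmaI)
qed

lemma root_path_measurable:
  assumes "Z \<in> borel_measurable M"
  shows "(\<lambda>\<omega>. root_path K (Z \<omega>)) \<in> measurable M (borel_sigma skorohod_topology)"
  by (rule measurable_borel_sigmaI[OF locally_uniformly_continuous_map[OF root_path_continuous root_path_skorohod] assms])

text \<open>The paths with slope in a compact interval form a compact subset of \<open>D([0,\<infinity>))\<close>, and a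
  continuous function is uniformly continuous near a compact set.\<close>

lemma uniform_continuity_near_root_paths:
  assumes f: "continuous_map skorohod_topology euclideanreal f" and e: "e > 0"
  obtains r where "r > 0"
    "\<And>w y. \<bar>w\<bar> \<le> k \<Longrightarrow> y \<in> skorohod_space \<Longrightarrow> skorohod_dist (root_path K w) y < r \<Longrightarrow> \<bar>f (root_path K w) - f y\<bar> < e"
proof -
  have "\<exists>r>0. \<forall>w y. \<bar>w\<bar> \<le> k \<longrightarrow> y \<in> skorohod_space \<longrightarrow> skorohod_dist (root_path K w) y < r \<longrightarrow> \<bar>f (root_path K w) - f y\<bar> < e"
  proof (rule ccontr)
    assume no: "\<not> ?thesis"
    \<comment> \<open>Counterexamples at distance below \<open>1 / (j + 1)\<close> have slopes with
      a convergent subsequence. Along it both paths approach the root path of the limiting slope,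
      and continuity of \<open>f\<close> at that one path contradicts the gap
      \<open>e\<close>.\<close>
    have "\<exists>w y. \<bar>w\<bar> \<le> k \<and> y \<in> skorohod_space \<and> skorohod_dist (root_path K w) y < inverse (real (Suc j)) \<and> \<not> \<bar>f (root_path K w) - f y\<bar> < e" for j
      using no by (metis inverse_positive_iff_positive of_nat_0_less_iff zero_less_Suc)
    then obtain w y where wy: "\<And>j. \<bar>w j\<bar> \<le> k" "\<And>j. y j \<in> skorohod_space"
      "\<And>j. skorohod_dist (root_path K (w j)) (y j) < inverse (real (Suc j))"
      "\<And>j. \<not> \<bar>f (root_path K (w j)) - f (y j)\<bar> < e"
      by metis
    have "\<And>j. w j \<in> {-k..k}" using wy(1) by (auto simp: abs_le_iff intro: minus_le_iff[THEN iffD1])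
    then obtain l q where lq: "strict_mono (q :: nat \<Rightarrow> nat)" "(w \<circ> q) \<longlonglongrightarrow> l"
      using compact_Icc[of "-k" k] unfolding compact_def by metis
    have "openin skorohod_topology {x \<in> topspace skorohod_topology. f x \<in> ball (f (root_path K l)) (e/2)}"
      by (rule openin_continuous_map_preimage[OF f]) simp
    then have "openin skorohod_topology {x \<in> skorohod_space. f x \<in> ball (f (root_path K l)) (e/2)}"
      by (simp only: topspace_skorohod)
    moreover have "root_path K l \<in> {x \<in> skorohod_space. f x \<in> ball (f (root_path K l)) (e/2)}"
      using e by (simp add: root_path_skorohod)
    ultimately obtain r where r: "r > 0" "skorohod.mball (root_path K l) r \<subseteq> {x \<in> skorohod_space. f x \<in> ball (f (root_path K l)) (e/2)}"
      unfolding skorohod_topology_def skorohod.openin_mtopology by blast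
    have near: "\<bar>f (root_path K l) - f x\<bar> < e/2" if "x \<in> skorohod_space" "skorohod_dist (root_path K l) x < r" for x
      using r(2) that root_path_skorohod[of K l] by (auto simp: skorohod.in_mball dist_real_def)
    have "eventually (\<lambda>x. skorohod_dist (root_path K l) (root_path K x) < r/2) (nhds l)"
      using r(1) by (intro locally_uniformly_continuous_dist[OF root_path_continuous]) simp
    from eventually_compose_filterlim[OF this lq(2)]
    have ev: "eventually (\<lambda>j. skorohod_dist (root_path K l) (root_path K (w (q j))) < r/2) sequentially"
      unfolding o_def .
    have "eventually (\<lambda>j. inverse (real (Suc j)) < r/2) sequentially"
      using LIMSEQ_inverse_real_of_nat r(1) by (intro order_tendstoD(2)) auto
    with ev have "eventually (\<lambda>j. False) sequentially"
    proof eventually_elim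
      case (elim j)
      have "inverse (real (Suc (q j))) \<le> inverse (real (Suc j))"
        using seq_suble[OF lq(1), of j] by (intro le_imp_inverse_le) auto
      then have "skorohod_dist (root_path K (w (q j))) (y (q j)) < r/2"
        using wy(3)[of "q j"] elim by linarith
      then have "skorohod_dist (root_path K l) (y (q j)) < r"
        using skorohod.triangle[of "root_path K l" "root_path K (w (q j))" "y (q j)"] wy(2) root_path_skorohod elim(1)
        by fastforce
      then have "\<bar>f (root_path K l) - f (y (q j))\<bar> < e/2" by (rule near[OF wy(2)])
      moreover have "\<bar>f (root_path K l) - f (root_path K (w (q j)))\<bar> < e/2"
        using elim(1) r(1) by (intro near root_path_skorohod) auto
      ultimately show False using wy(4)[of "q j"] by linarith
    qed
    then show False by simp
  qed
  then show ?thesis using that by blast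
qed

section \<open>Weak convergence of step paths from closeness to random root paths\<close>

lemma (in prob_space) abs_expectation_diff_le:
  fixes f g :: "'a \<Rightarrow> real"
  assumes [measurable]: "f \<in> borel_measurable M" "g \<in> borel_measurable M" "A \<in> sets M"
    and B: "\<And>\<omega>. \<omega> \<in> space M \<Longrightarrow> \<bar>f \<omega>\<bar> \<le> B" "\<And>\<omega>. \<omega> \<in> space M \<Longrightarrow> \<bar>g \<omega>\<bar> \<le> B"
    and near: "\<And>\<omega>. \<omega> \<in> space M - A \<Longrightarrow> \<bar>f \<omega> - g \<omega>\<bar> \<le> e" and e: "e \<ge> 0"
  shows "\<bar>expectation f - expectation g\<bar> \<le> e + 2 * B * prob A"
proof -
  have int: "integrable M f" "integrable M g"
    by (rule integrable_const_bound[of _ B]; use B in auto)+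
  have "\<bar>expectation f - expectation g\<bar> = \<bar>expectation (\<lambda>\<omega>. f \<omega> - g \<omega>)\<bar>"
    using int by simp
  also have "\<dots> \<le> expectation (\<lambda>\<omega>. \<bar>f \<omega> - g \<omega>\<bar>)" by (rule integral_abs_bound)
  also have "\<dots> \<le> expectation (\<lambda>\<omega>. e + 2 * B * indicator A \<omega>)"
  proof (rule integral_mono)
    fix \<omega> assume w: "\<omega> \<in> space M"
    show "\<bar>f \<omega> - g \<omega>\<bar> \<le> e + 2 * B * indicator A \<omega>"
    proof (cases "\<omega> \<in> A")
      case True
      then have "indicat_real A \<omega> = 1" by simp
      then show ?thesis using B[OF w] e by simp
    qed (use near w in auto)
  qed (use int in \<open>auto intro!: Bochner_Integration.integrable_add integrable_mult_right integrable_real_indicator simp: emeasure_eq_measure\<close>)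
  also have "\<dots> = e + 2 * B * prob A"
    by (subst Bochner_Integration.integral_add) (auto simp: prob_space emeasure_eq_measure intro!: integrable_mult_right integrable_real_indicator)
  finally show ?thesis .
qed

text \<open>Weak convergence of the scalar \<open>W n\<close> passes through the continuous map from
  slopes to root paths. The step paths are close to these off the events \<open>A n\<close>, and
  tightness of \<open>W n\<close> confines the slopes to a compact interval, near which a test
  function is uniformly continuous.\<close>

lemma (in prob_space) converges_weakly_root_path:
  fixes S :: "nat \<Rightarrow> 'a \<Rightarrow> real" and W :: "nat \<Rightarrow> 'a \<Rightarrow> real" and Z :: "'b \<Rightarrow> real"
  assumes S: "\<And>k. S k \<in> borel_measurable M" and W[measurable]: "\<And>n. W n \<in> borel_measurable M"
    and Z: "Z \<in> borel_measurable N"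
    and W_lim: "\<And>g :: real \<Rightarrow> real. continuous_on UNIV g \<Longrightarrow> bounded (range g) \<Longrightarrow>
        (\<lambda>n. expectation (\<lambda>\<omega>. g (W n \<omega>))) \<longlonglongrightarrow> (\<integral>\<omega>. g (Z \<omega>) \<partial>N)"
    and tight: "\<And>e. e > 0 \<Longrightarrow> \<exists>k. eventually (\<lambda>n. prob {\<omega> \<in> space M. \<bar>W n \<omega>\<bar> > k} \<le> e) sequentially"
    and near: "\<And>(m::nat) d e. d > 0 \<Longrightarrow> e > 0 \<Longrightarrow> \<exists>A. (\<forall>n. A n \<in> sets M) \<and>
       eventually (\<lambda>n. prob (A n) \<le> e) sequentially \<and> eventually (\<lambda>n. \<forall>\<omega>\<in>space M - A n. \<forall>t. 0 \<le> t \<longrightarrow> t \<le> real m \<longrightarrow>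
          \<bar>S (nat \<lfloor>real n * t\<rfloor>) \<omega> / s n - sqrt t * K * W n \<omega>\<bar> \<le> d) sequentially"
  shows "converges_weakly skorohod_topology M (\<lambda>n \<omega>. step_path n (s n) (\<lambda>k. S k \<omega>)) N (\<lambda>\<omega>. root_path K (Z \<omega>))"
  unfolding converges_weakly_def
proof (intro conjI allI impI step_path_measurable root_path_measurable S Z)
  fix f :: "(real \<Rightarrow> real) \<Rightarrow> real"
  assume f: "continuous_map skorohod_topology euclideanreal f" and bdd: "bounded (f ` topspace skorohod_topology)"
  obtain B0 where B0: "\<And>x. x \<in> skorohod_space \<Longrightarrow> \<bar>f x\<bar> \<le> B0"
    using bdd unfolding bounded_iff topspace_skorohod by auto
  define B where "B = max B0 0"
  have B: "\<And>x. x \<in> skorohod_space \<Longrightarrow> \<bar>f x\<bar> \<le> B" "B \<ge> 0" using B0 by (force simp: B_def)+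
  have "continuous_map euclidean euclideanreal (f \<circ> root_path K)"
    by (rule continuous_map_compose[OF locally_uniformly_continuous_map[OF root_path_continuous root_path_skorohod] f])
  then have cont: "continuous_on UNIV (\<lambda>w. f (root_path K w))" by (simp add: o_def)
  have main: "(\<lambda>n. expectation (\<lambda>\<omega>. f (root_path K (W n \<omega>)))) \<longlonglongrightarrow> (\<integral>\<omega>. f (root_path K (Z \<omega>)) \<partial>N)"
    using B root_path_skorohod by (intro W_lim[OF cont] boundedI[of _ B]) auto
  note fmeas = continuous_map_borel_sigma[OF f]
  have [measurable]: "(\<lambda>\<omega>. f (step_path n (s n) (\<lambda>k. S k \<omega>))) \<in> borel_measurable M" for n
    by (rule measurable_compose[OF step_path_measurable[OF S] fmeas])
  have [measurable]: "(\<lambda>\<omega>. f (root_path K (W n \<omega>))) \<in> borel_measurable M" for n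
    by (rule measurable_compose[OF root_path_measurable[OF W] fmeas])
  have "(\<lambda>n. expectation (\<lambda>\<omega>. f (step_path n (s n) (\<lambda>k. S k \<omega>))) - expectation (\<lambda>\<omega>. f (root_path K (W n \<omega>)))) \<longlonglongrightarrow> 0"
  proof (rule tendstoI)
    fix e0 :: real assume e0: "e0 > 0"
    \<comment> \<open>The total error is \<open>e\<close> off the exceptional events plus
      \<open>2 * B\<close> times their probability, at most \<open>2 * e\<close>; this adds up to
      \<open>(1 + 4 * B) * e = e0 / 2\<close>.\<close>
    define e where "e = (e0 / 2) / (1 + 4 * B)"
    have e: "e > 0" using e0 B(2) by (simp add: e_def)
    obtain k where k: "eventually (\<lambda>n. prob {\<omega> \<in> space M. \<bar>W n \<omega>\<bar> > k} \<le> e) sequentially"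
      using tight[OF e] by blast
    obtain r where r: "r > 0"
      "\<And>w y. \<bar>w\<bar> \<le> k \<Longrightarrow> y \<in> skorohod_space \<Longrightarrow> skorohod_dist (root_path K w) y < r \<Longrightarrow> \<bar>f (root_path K w) - f y\<bar> < e"
      using uniform_continuity_near_root_paths[OF f e] by blast
    obtain m where m: "(1/2) ^ m < r / 2" using real_arch_pow_inv[of "r/2" "1/2"] r by auto
    obtain A where A: "\<And>n. A n \<in> sets M" "eventually (\<lambda>n. prob (A n) \<le> e) sequentially"
      "eventually (\<lambda>n. \<forall>\<omega>\<in>space M - A n. \<forall>t. 0 \<le> t \<longrightarrow> t \<le> real m \<longrightarrow>
          \<bar>S (nat \<lfloor>real n * t\<rfloor>) \<omega> / s n - sqrt t * K * W n \<omega>\<bar> \<le> r/2) sequentially"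
      using near[of "r/2" e m] r(1) e by auto
    from A(2) show "eventually (\<lambda>n. dist (expectation (\<lambda>\<omega>. f (step_path n (s n) (\<lambda>k. S k \<omega>))) - expectation (\<lambda>\<omega>. f (root_path K (W n \<omega>)))) 0 < e0) sequentially"
      using k A(3)
    proof eventually_elim
      case (elim n)
      let ?A = "A n \<union> {\<omega> \<in> space M. \<bar>W n \<omega>\<bar> > k}"
      have [measurable]: "A n \<in> sets M" by (rule A)
      have "\<bar>expectation (\<lambda>\<omega>. f (step_path n (s n) (\<lambda>k. S k \<omega>))) - expectation (\<lambda>\<omega>. f (root_path K (W n \<omega>)))\<bar> \<le> e + 2 * B * prob ?A"
      proof (rule abs_expectation_diff_le)
        fix \<omega> assume w: "\<omega> \<in> space M - ?A"
        have "skorohod_dist (root_path K (W n \<omega>)) (step_path n (s n) (\<lambda>k. S k \<omega>)) \<le> r/2 + (1/2) ^ m"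
        proof (rule skorohod_dist_le_uniform)
          fix t :: real assume t: "0 \<le> t" "t \<le> real m"
          then have "\<bar>S (nat \<lfloor>real n * t\<rfloor>) \<omega> / s n - sqrt t * K * W n \<omega>\<bar> \<le> r/2" using elim(3) w by auto
          then show "\<bar>root_path K (W n \<omega>) t - step_path n (s n) (\<lambda>k. S k \<omega>) t\<bar> \<le> r/2"
            using t by (simp add: root_path_def step_path_def abs_minus_commute)
        qed (use r in simp)
        then have "\<bar>f (root_path K (W n \<omega>)) - f (step_path n (s n) (\<lambda>k. S k \<omega>))\<bar> < e"
          using m w by (intro r(2) step_path_skorohod) auto
        then show "\<bar>f (step_path n (s n) (\<lambda>k. S k \<omega>)) - f (root_path K (W n \<omega>))\<bar> \<le> e" by linarith
      qed (use B step_path_skorohod root_path_skorohod e in auto)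
      also have "e + 2 * B * prob ?A \<le> e + 2 * B * (e + e)"
      proof -
        have "prob ?A \<le> prob (A n) + prob {\<omega> \<in> space M. \<bar>W n \<omega>\<bar> > k}"
          by (rule measure_Un_le) measurable
        then show ?thesis using elim B(2) by (intro add_left_mono mult_left_mono) auto
      qed
      also have "\<dots> = (1 + 4 * B) * e" by (simp add: algebra_simps)
      also have "\<dots> = e0 / 2"
      proof -
        have "1 + 4 * B \<noteq> 0" using B(2) by linarith
        then have "e * (1 + 4 * B) = e0 / 2" by (rule iffD1[OF nonzero_eq_divide_eq e_def])
        then show ?thesis by (subst mult.commute)
      qed
      finally show ?case using e0 by (simp add: dist_real_def)
    qed
  qed
  from tendsto_add[OF this main]
  show "(\<lambda>n. expectation (\<lambda>\<omega>. f (step_path n (s n) (\<lambda>k. S k \<omega>)))) \<longlonglongrightarrow> (\<integral>\<omega>. f (root_path K (Z \<omega>)) \<partial>N)"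
    by simp
qed


section \<open>The one-step conditional law\<close>

text \<open>Independence of variables is independence of the sigma-algebras they generate, so it
  passes to everything measurable with respect to these. In this form no explicit factorisation of
  \<open>G\<close> through \<open>A\<close> has to be given, which suits recursively built
  variables.\<close>

lemma (in prob_space) indep_var_of_vimage_algebra:
  assumes ind: "indep_var S A T B"
    and G: "G \<in> measurable (vimage_algebra (space M) A S) N"
    and H: "H \<in> measurable (vimage_algebra (space M) B T) N'"
  shows "indep_var N G N' H"
proof -
  have rv: "random_variable S A" "random_variable T B"
    and ind': "indep_set (sigma_sets (space M) {A -` C \<inter> space M | C. C \<in> sets S})
      (sigma_sets (space M) {B -` C \<inter> space M | C. C \<in> sets T})"
    using ind unfolding indep_var_eq by auto
  have sub: "sets (vimage_algebra (space M) f R) \<subseteq> sets M" if "random_variable R f" for f and R :: "'z measure"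
    unfolding sets_vimage_algebra using measurable_sets[OF that] by (intro sets.sigma_sets_subset) auto
  have gen: "sigma_sets (space M) {g -` C \<inter> space M | C. C \<in> sets N0} \<subseteq> sigma_sets (space M) {f -` C \<inter> space M | C. C \<in> sets R}"
    if "g \<in> measurable (vimage_algebra (space M) f R) N0" for f g and R :: "'z measure" and N0 :: "'y measure"
  proof (rule sigma_sets_mono, safe)
    fix C assume "C \<in> sets N0"
    from measurable_sets[OF that this] show "g -` C \<inter> space M \<in> sigma_sets (space M) {f -` C \<inter> space M | C. C \<in> sets R}"
      by (simp add: sets_vimage_algebra)
  qed
  have "G \<in> measurable M N" using G sub[OF rv(1)] by (auto simp: measurable_def)
  moreover have "H \<in> measurable M N'" using H sub[OF rv(2)] by (auto simp: measurable_def)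
  moreover have "indep_set (sigma_sets (space M) {G -` C \<inter> space M | C. C \<in> sets N})
      (sigma_sets (space M) {H -` C \<inter> space M | C. C \<in> sets N'})"
    unfolding indep_set_def
    by (rule indep_sets_mono_sets[OF ind'[unfolded indep_set_def]])
       (use gen[OF G] gen[OF H] in \<open>auto split: bool.split\<close>)
  ultimately show ?thesis unfolding indep_var_eq by simp
qed

locale critical_srrw = srrw_rvm M p \<gamma> \<mu> \<xi> \<alpha> \<beta> X + critical_memory p \<gamma> \<mu>
  for M :: "'a measure" and p \<gamma> \<mu> \<xi> \<alpha> \<beta> X +
  assumes \<xi>_sq_integrable: "integrable M (\<lambda>\<omega>. (\<xi> 1 \<omega>)\<^sup>2)"
    and \<xi>_sq: "expectation (\<lambda>\<omega>. (\<xi> 1 \<omega>)\<^sup>2) = 1"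
begin

section \<open>Sigma-algebras of the driving variables and an adapted version of the steps\<close>

abbreviation "drv \<equiv> driving_family \<xi> \<alpha> \<beta>"

definition alg :: "(nat + nat + nat) set \<Rightarrow> 'a measure" where
  "alg A = vimage_algebra (space M) (\<lambda>\<omega>. \<lambda>i\<in>A. drv i \<omega>) (PiM A (\<lambda>_. borel))"

lemma space_alg: "space (alg A) = space M"
  by (simp add: alg_def)

lemma drv_alg: "i \<in> A \<Longrightarrow> drv i \<in> borel_measurable (alg A)"
proof -
  assume i: "i \<in> A"
  have "(\<lambda>\<omega>. \<lambda>i\<in>A. drv i \<omega>) \<in> measurable (alg A) (PiM A (\<lambda>_. borel))"
    unfolding alg_def by (rule measurable_vimage_algebra1) (auto simp: space_PiM)
  from measurable_compose[OF this measurable_component_singleton[OF i]] i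
  show ?thesis by simp
qed

lemma alg_indep:
  assumes "A \<inter> B = {}" "A \<subseteq> {1..} <+> {2..} <+> {2..}" "B \<subseteq> {1..} <+> {2..} <+> {2..}"
    and "G \<in> measurable (alg A) N" "H \<in> measurable (alg B) N'"
  shows "indep_var N G N' H"
  using indep_var_of_vimage_algebra[OF indep_var_restrict[OF independent assms(1-3)]] assms(4,5)
  unfolding alg_def by blast

definition past :: "nat \<Rightarrow> 'a measure" where
  "past n = alg ({1..n} <+> {2..n} <+> {2..n})"

lemma past_measurable:
  "1 \<le> k \<Longrightarrow> k \<le> n \<Longrightarrow> \<xi> k \<in> borel_measurable (past n)"
  "2 \<le> k \<Longrightarrow> k \<le> n \<Longrightarrow> (\<lambda>\<omega>. of_bool (\<alpha> k \<omega>) :: real) \<in> borel_measurable (past n)"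
  "2 \<le> k \<Longrightarrow> k \<le> n \<Longrightarrow> (\<lambda>\<omega>. real (\<beta> k \<omega>)) \<in> borel_measurable (past n)"
proof -
  let ?I = "{1..n} <+> {2..n} <+> {2..n}"
  { assume "1 \<le> k" "k \<le> n"
    then have "Inl k \<in> ?I" by auto
    from drv_alg[OF this] show "\<xi> k \<in> borel_measurable (past n)" by (simp add: past_def driving_family_def) }
  assume "2 \<le> k" "k \<le> n"
  then have "Inr (Inl k) \<in> ?I" "Inr (Inr k) \<in> ?I" by auto
  from this[THEN drv_alg] show "(\<lambda>\<omega>. of_bool (\<alpha> k \<omega>) :: real) \<in> borel_measurable (past n)"
    "(\<lambda>\<omega>. real (\<beta> k \<omega>)) \<in> borel_measurable (past n)"
    by (simp_all add: past_def driving_family_def)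
qed

lemma past_events: "sets (past n) \<subseteq> events"
proof -
  have "(\<lambda>\<omega>. \<lambda>i\<in>{1..n} <+> {2..n} <+> {2..n}. drv i \<omega>) \<in> measurable M (PiM ({1..n} <+> {2..n} <+> {2..n}) (\<lambda>_. borel))"
  proof (rule measurable_restrict)
    fix i assume "i \<in> {1..n} <+> {2..n} <+> {2..n}"
    then show "drv i \<in> borel_measurable M"
      using independent unfolding indep_vars_def by auto
  qed
  from measurable_sets[OF this] show ?thesis
    unfolding past_def alg_def sets_vimage_algebra by (intro sets.sigma_sets_subset) auto
qed

lemma past_imp_measurable: "G \<in> measurable (past n) N \<Longrightarrow> G \<in> measurable M N"
  using past_events[of n] by (auto simp: measurable_def past_def space_alg)

text \<open>A version of \<open>X\<close> that satisfies the recursion everywhere and is therefore measurable with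
  respect to the driving variables up to the current time.\<close>

fun Y :: "nat \<Rightarrow> 'a \<Rightarrow> real" where
  "Y n \<omega> = (if n \<ge> 2 \<and> \<alpha> n \<omega> then \<Sum>k=1..<n. of_bool (\<beta> n \<omega> = k) * Y k \<omega> else \<xi> n \<omega>)"

declare Y.simps[simp del]

text \<open>The recalled value is a finite sum of earlier values times indicators of the recalled
  index, so measurability goes through by strong induction although the index is random.\<close>

lemma Y_past: "1 \<le> k \<Longrightarrow> k \<le> n \<Longrightarrow> Y k \<in> borel_measurable (past n)"
proof (induction k rule: less_induct)
  case (less k)
  note [measurable] = past_measurable(1)[OF less.prems]
  have Y_eq: "Y k = (\<lambda>\<omega>. if k \<ge> 2 then of_bool (\<alpha> k \<omega>) * (\<Sum>j=1..<k. (if real (\<beta> k \<omega>) = real j then 1 else 0) * Y j \<omega>)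
       + (1 - of_bool (\<alpha> k \<omega>)) * \<xi> k \<omega> else \<xi> k \<omega>)"
    by (rule ext, subst Y.simps) (auto simp: of_bool_def)
  show ?case
  proof (cases "k \<ge> 2")
    case True
    note [measurable] = past_measurable(2,3)[OF True less.prems(2)]
    have Yj: "Y j \<in> borel_measurable (past n)" if "j \<in> {1..<k}" for j
      using that less.prems by (intro less.IH) auto
    have \<beta>j: "(\<lambda>\<omega>. if real (\<beta> k \<omega>) = real j then 1 else 0 :: real) \<in> borel_measurable (past n)" for j
      by measurable
    have "(\<lambda>\<omega>. \<Sum>j=1..<k. (if real (\<beta> k \<omega>) = real j then 1 else 0) * Y j \<omega>) \<in> borel_measurable (past n)"
      by (intro borel_measurable_sum borel_measurable_times \<beta>j Yj)
    note [measurable] = this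
    show ?thesis unfolding Y_eq if_P[OF True] by measurable
  qed (simp add: Y_eq)
qed

lemma Y_measurable[measurable]: "1 \<le> k \<Longrightarrow> Y k \<in> borel_measurable M"
  using past_imp_measurable[OF Y_past[of k k]] by simp

text \<open>The prescribed probabilities \<open>\<mu> k / \<nu> n\<close> already sum to 1.\<close>

lemma \<beta>_range: assumes n: "n \<ge> 1" shows "AE \<omega> in M. \<beta> (Suc n) \<omega> \<in> {1..n}"
proof -
  have n2: "Suc n \<ge> 2" using n by simp
  have ev: "{\<omega> \<in> space M. \<beta> (Suc n) \<omega> \<in> K} \<in> events" for K
    using measurable_sets[OF \<beta>_measurable[OF n2], of K] by (simp add: vimage_def Int_def conj_commute)
  have "prob {\<omega> \<in> space M. \<beta> (Suc n) \<omega> \<in> {1..n}} = prob (\<Union>k\<in>{1..n}. {\<omega> \<in> space M. \<beta> (Suc n) \<omega> = k})"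
    by (rule arg_cong[where f=prob]) auto
  also have "\<dots> = (\<Sum>k=1..n. prob {\<omega> \<in> space M. \<beta> (Suc n) \<omega> = k})"
    using ev[of "{_}"] by (intro finite_measure_finite_Union) (auto simp: disjoint_family_on_def)
  also have "\<dots> = (\<Sum>k=1..n. \<mu> k / \<nu> n)"
    using \<beta>_law[OF n2] by (intro sum.cong) (auto simp: \<nu>_def)
  also have "\<dots> = 1"
    using \<nu>_pos[OF n] unfolding sum_divide_distrib[symmetric] by (simp add: \<nu>_def memory_sum_def)
  finally have "prob {\<omega> \<in> space M. \<beta> (Suc n) \<omega> \<in> {1..n}} = 1" .
  from AE_prob_1[OF this] show ?thesis by (auto elim: eventually_mono)
qed

text \<open>The countably many exceptional null sets are merged first; on the common complement the
  two recursions agree by induction on the index, path by path.\<close>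

lemma X_eq_Y: "AE \<omega> in M. \<forall>n\<ge>1. X n \<omega> = Y n \<omega>"
proof -
  have "AE \<omega> in M. \<forall>n. n \<ge> 1 \<longrightarrow> \<beta> (Suc n) \<omega> \<in> {1..n} \<and> X (n + 1) \<omega> =
      of_bool (\<alpha> (n + 1) \<omega>) * X (\<beta> (n + 1) \<omega>) \<omega> + (1 - of_bool (\<alpha> (n + 1) \<omega>)) * \<xi> (n + 1) \<omega>"
    unfolding AE_all_countable
  proof
    fix n
    show "AE \<omega> in M. n \<ge> 1 \<longrightarrow> \<beta> (Suc n) \<omega> \<in> {1..n} \<and> X (n + 1) \<omega> =
      of_bool (\<alpha> (n + 1) \<omega>) * X (\<beta> (n + 1) \<omega>) \<omega> + (1 - of_bool (\<alpha> (n + 1) \<omega>)) * \<xi> (n + 1) \<omega>"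
    proof (cases "n \<ge> 1")
      case True
      from \<beta>_range[OF True] X_Suc[OF True] show ?thesis by eventually_elim simp
    qed simp
  qed
  with X_1 show ?thesis
  proof eventually_elim
    case (elim \<omega>)
    show ?case
    proof (intro allI impI)
      fix n :: nat assume "n \<ge> 1"
      then show "X n \<omega> = Y n \<omega>"
      proof (induction n rule: less_induct)
        case (less n)
        show ?case
        proof (cases "n = 1")
          case True
          then show ?thesis using elim(1) by (simp add: Y.simps)
        next
          case False
          define m where "m = n - 1"
          have m: "n = Suc m" "m \<ge> 1" using False less.prems by (auto simp: m_def)
          have \<beta>: "\<beta> n \<omega> \<in> {1..m}" using elim(2) m by auto
          have X: "X n \<omega> = of_bool (\<alpha> n \<omega>) * X (\<beta> n \<omega>) \<omega> + (1 - of_bool (\<alpha> n \<omega>)) * \<xi> n \<omega>"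
            using elim(2) m by auto
          have "(\<Sum>k=1..<n. of_bool (\<beta> n \<omega> = k) * Y k \<omega>) = (\<Sum>k=1..<n. if k = \<beta> n \<omega> then Y k \<omega> else 0)"
            by (intro sum.cong) auto
          also have "\<dots> = Y (\<beta> n \<omega>) \<omega>" using \<beta> m by (subst sum.delta) auto
          also have "\<dots> = X (\<beta> n \<omega>) \<omega>" using \<beta> m by (intro less.IH[symmetric]) auto
          finally show ?thesis unfolding X by (subst Y.simps) (use m in auto)
        qed
      qed
    qed
  qed
qed

section \<open>Expectations of one step against the past\<close>

definition fut :: "nat \<Rightarrow> 'a measure" where
  "fut n = alg {Inl (Suc n), Inr (Inl (Suc n)), Inr (Inr (Suc n))}"

lemma past_fut_indep:
  assumes "n \<ge> 1" "G \<in> measurable (past n) N" "H \<in> measurable (fut n) N'"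
  shows "indep_var N G N' H"
  using assms unfolding past_def fut_def by (intro alg_indep) auto

lemma \<xi>_integral:
  assumes [measurable]: "h \<in> borel_measurable borel" and n: "n \<ge> 1"
  shows "integrable M (\<lambda>\<omega>. h (\<xi> n \<omega>)) \<longleftrightarrow> integrable M (\<lambda>\<omega>. h (\<xi> 1 \<omega>) :: real)"
    "expectation (\<lambda>\<omega>. h (\<xi> n \<omega>)) = expectation (\<lambda>\<omega>. h (\<xi> 1 \<omega>))"
proof -
  note m = \<xi>_measurable[OF n] \<xi>_measurable[OF order_refl]
  show "integrable M (\<lambda>\<omega>. h (\<xi> n \<omega>)) \<longleftrightarrow> integrable M (\<lambda>\<omega>. h (\<xi> 1 \<omega>))"
    unfolding integrable_distr_eq[OF m(1) assms(1), symmetric] integrable_distr_eq[OF m(2) assms(1), symmetric]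
      \<xi>_identical[OF n] ..
  show "expectation (\<lambda>\<omega>. h (\<xi> n \<omega>)) = expectation (\<lambda>\<omega>. h (\<xi> 1 \<omega>))"
    unfolding integral_distr[OF m(1) assms(1), symmetric] integral_distr[OF m(2) assms(1), symmetric]
      \<xi>_identical[OF n] ..
qed

lemma \<alpha>_expectation:
  assumes n: "n \<ge> 2"
  shows "expectation (\<lambda>\<omega>. of_bool (\<alpha> n \<omega>)) = p" "integrable M (\<lambda>\<omega>. of_bool (\<alpha> n \<omega>) :: real)"
proof -
  note [measurable] = \<alpha>_measurable[OF n]
  have "expectation (\<lambda>\<omega>. of_bool (\<alpha> n \<omega>) :: real) = integral\<^sup>L (distr M (count_space UNIV) (\<alpha> n)) of_bool"
    by (rule integral_distr[symmetric]) auto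
  also have "\<dots> = p" unfolding \<alpha>_law[OF n] using p_range by simp
  finally show "expectation (\<lambda>\<omega>. of_bool (\<alpha> n \<omega>)) = p" .
  have "(of_bool :: bool \<Rightarrow> real) \<in> measurable (count_space UNIV) borel" by simp
  then have "(\<lambda>\<omega>. of_bool (\<alpha> n \<omega>) :: real) \<in> borel_measurable M" by measurable
  then show "integrable M (\<lambda>\<omega>. of_bool (\<alpha> n \<omega>) :: real)"
    by (intro integrable_const_bound[of _ 1]) auto
qed

definition pick :: "nat \<Rightarrow> nat \<Rightarrow> 'a \<Rightarrow> real" where
  "pick n k \<omega> = of_bool (\<alpha> (Suc n) \<omega>) * of_bool (\<beta> (Suc n) \<omega> = k)"

lemma \<alpha>_alg: "Inr (Inl n) \<in> A \<Longrightarrow> (\<lambda>\<omega>. of_bool (\<alpha> n \<omega>) :: real) \<in> borel_measurable (alg A)"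
  using drv_alg[of "Inr (Inl n)" A] by (simp add: driving_family_def)

lemma \<beta>_alg: "Inr (Inr n) \<in> A \<Longrightarrow> (\<lambda>\<omega>. of_bool (\<beta> n \<omega> = k) :: real) \<in> borel_measurable (alg A)"
proof -
  assume "Inr (Inr n) \<in> A"
  then have [measurable]: "(\<lambda>\<omega>. real (\<beta> n \<omega>)) \<in> borel_measurable (alg A)"
    using drv_alg[of "Inr (Inr n)" A] by (simp add: driving_family_def)
  have "(\<lambda>\<omega>. if real (\<beta> n \<omega>) = real k then 1 else 0 :: real) \<in> borel_measurable (alg A)" by measurable
  then show ?thesis by (simp add: of_bool_def)
qed

lemma \<xi>_alg: "Inl n \<in> A \<Longrightarrow> \<xi> n \<in> borel_measurable (alg A)"
  using drv_alg[of "Inl n" A] by (simp add: driving_family_def)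

lemma pick_fut: "pick n k \<in> borel_measurable (fut n)"
proof -
  have [measurable]: "(\<lambda>\<omega>. of_bool (\<alpha> (Suc n) \<omega>) :: real) \<in> borel_measurable (fut n)"
    "(\<lambda>\<omega>. of_bool (\<beta> (Suc n) \<omega> = k) :: real) \<in> borel_measurable (fut n)"
    unfolding fut_def by (auto intro!: \<alpha>_alg \<beta>_alg)
  show ?thesis unfolding pick_def[abs_def] by measurable
qed

lemma pick_expectation:
  assumes n: "n \<ge> 1" and k: "k \<in> {1..n}"
  shows "expectation (pick n k) = p * \<mu> k / \<nu> n" "integrable M (pick n k)"
proof -
  have n2: "Suc n \<ge> 2" using n by simp
  have \<beta>m: "(\<lambda>\<omega>. of_bool (\<beta> (Suc n) \<omega> = k) :: real) \<in> borel_measurable M"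
    using \<beta>_measurable[OF n2] by (rule measurable_compose) simp
  have \<beta>i: "integrable M (\<lambda>\<omega>. of_bool (\<beta> (Suc n) \<omega> = k) :: real)"
    using \<beta>m by (intro integrable_const_bound[of _ 1]) auto
  have ev: "{\<omega> \<in> space M. \<beta> (Suc n) \<omega> = k} \<in> events"
    using measurable_sets[OF \<beta>_measurable[OF n2], of "{k}"] by (simp add: vimage_def Int_def conj_commute)
  have "expectation (\<lambda>\<omega>. of_bool (\<beta> (Suc n) \<omega> = k)) = expectation (indicator {\<omega> \<in> space M. \<beta> (Suc n) \<omega> = k})"
    by (intro Bochner_Integration.integral_cong) (auto simp: indicator_def)
  also have "\<dots> = prob {\<omega> \<in> space M. \<beta> (Suc n) \<omega> = k}" using ev by simp
  also have "\<dots> = \<mu> k / \<nu> n" using \<beta>_law[OF n2] k by (simp add: \<nu>_def)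
  finally have \<beta>e: "expectation (\<lambda>\<omega>. of_bool (\<beta> (Suc n) \<omega> = k)) = \<mu> k / \<nu> n" .
  have ind: "indep_var borel (\<lambda>\<omega>. of_bool (\<alpha> (Suc n) \<omega>) :: real) borel (\<lambda>\<omega>. of_bool (\<beta> (Suc n) \<omega> = k) :: real)"
    by (rule alg_indep[of "{Inr (Inl (Suc n))}" "{Inr (Inr (Suc n))}"]) (use n2 in \<open>auto intro: \<alpha>_alg \<beta>_alg\<close>)
  show "expectation (pick n k) = p * \<mu> k / \<nu> n"
    unfolding pick_def[abs_def] using indep_var_lebesgue_integral[OF ind \<alpha>_expectation(2)[OF n2] \<beta>i]
    by (simp add: \<alpha>_expectation(1)[OF n2] \<beta>e)
  show "integrable M (pick n k)"
    unfolding pick_def[abs_def] by (rule indep_var_integrable[OF ind \<alpha>_expectation(2)[OF n2] \<beta>i])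
qed

lemma innovate_expectation:
  assumes n: "n \<ge> 1" and h[measurable]: "h \<in> borel_measurable borel"
    and int: "integrable M (\<lambda>\<omega>. h (\<xi> 1 \<omega>) :: real)"
  shows "expectation (\<lambda>\<omega>. (1 - of_bool (\<alpha> (Suc n) \<omega>)) * h (\<xi> (Suc n) \<omega>)) = (1 - p) * expectation (\<lambda>\<omega>. h (\<xi> 1 \<omega>))"
    "integrable M (\<lambda>\<omega>. (1 - of_bool (\<alpha> (Suc n) \<omega>)) * h (\<xi> (Suc n) \<omega>))"
    "(\<lambda>\<omega>. (1 - of_bool (\<alpha> (Suc n) \<omega>)) * h (\<xi> (Suc n) \<omega>)) \<in> borel_measurable (fut n)"
proof -
  have n2: "Suc n \<ge> 2" using n by simp
  have ai: "integrable M (\<lambda>\<omega>. 1 - of_bool (\<alpha> (Suc n) \<omega>) :: real)" using \<alpha>_expectation(2)[OF n2] by simp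
  have ae: "expectation (\<lambda>\<omega>. 1 - of_bool (\<alpha> (Suc n) \<omega>)) = 1 - p"
    using \<alpha>_expectation[OF n2] by (simp add: prob_space)
  have hi: "integrable M (\<lambda>\<omega>. h (\<xi> (Suc n) \<omega>))" "expectation (\<lambda>\<omega>. h (\<xi> (Suc n) \<omega>)) = expectation (\<lambda>\<omega>. h (\<xi> 1 \<omega>))"
    using \<xi>_integral[OF h, of "Suc n"] int by auto
  have 1: "(\<lambda>\<omega>. 1 - of_bool (\<alpha> (Suc n) \<omega>) :: real) \<in> borel_measurable (alg A)" if "Inr (Inl (Suc n)) \<in> A" for A
    using \<alpha>_alg[OF that] by measurable
  have 2: "(\<lambda>\<omega>. h (\<xi> (Suc n) \<omega>)) \<in> borel_measurable (alg A)" if "Inl (Suc n) \<in> A" for A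
    using \<xi>_alg[OF that] by measurable
  have ind: "indep_var borel (\<lambda>\<omega>. 1 - of_bool (\<alpha> (Suc n) \<omega>) :: real) borel (\<lambda>\<omega>. h (\<xi> (Suc n) \<omega>))"
    by (rule alg_indep[of "{Inr (Inl (Suc n))}" "{Inl (Suc n)}"]) (use n2 in \<open>auto intro: 1 2\<close>)
  show "expectation (\<lambda>\<omega>. (1 - of_bool (\<alpha> (Suc n) \<omega>)) * h (\<xi> (Suc n) \<omega>)) = (1 - p) * expectation (\<lambda>\<omega>. h (\<xi> 1 \<omega>))"
    using indep_var_lebesgue_integral[OF ind ai hi(1)] by (simp only: ae hi(2))
  show "integrable M (\<lambda>\<omega>. (1 - of_bool (\<alpha> (Suc n) \<omega>)) * h (\<xi> (Suc n) \<omega>))"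
    by (rule indep_var_integrable[OF ind ai hi(1)])
  show "(\<lambda>\<omega>. (1 - of_bool (\<alpha> (Suc n) \<omega>)) * h (\<xi> (Suc n) \<omega>)) \<in> borel_measurable (fut n)"
    unfolding fut_def by (intro borel_measurable_times 1 2) auto
qed

text \<open>For \<open>\<beta> (Suc n)\<close> in range at most one indicator is active, so the
  random choice becomes a sum in which each summand is a \<open>past n\<close> variable times a
  \<open>fut n\<close> variable. Independence can then be applied term by term.\<close>

lemma step_decomposition:
  fixes h :: "real \<Rightarrow> real"
  assumes n: "n \<ge> 1"
  shows "AE \<omega> in M. h (Y (Suc n) \<omega>) = (\<Sum>k=1..n. h (Y k \<omega>) * pick n k \<omega>)
     + (1 - of_bool (\<alpha> (Suc n) \<omega>)) * h (\<xi> (Suc n) \<omega>)"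
  using \<beta>_range[OF n]
proof eventually_elim
  case (elim \<omega>)
  have pick: "(\<Sum>k=1..n. f k * pick n k \<omega>) = of_bool (\<alpha> (Suc n) \<omega>) * f (\<beta> (Suc n) \<omega>)" for f :: "nat \<Rightarrow> real"
  proof -
    have "(\<Sum>k=1..n. f k * pick n k \<omega>) = (\<Sum>k=1..n. if k = \<beta> (Suc n) \<omega> then of_bool (\<alpha> (Suc n) \<omega>) * f k else 0)"
      by (intro sum.cong) (auto simp: pick_def)
    also have "\<dots> = of_bool (\<alpha> (Suc n) \<omega>) * f (\<beta> (Suc n) \<omega>)" using elim by (subst sum.delta) auto
    finally show ?thesis .
  qed
  have "(\<Sum>k=1..<Suc n. of_bool (\<beta> (Suc n) \<omega> = k) * Y k \<omega>) = (\<Sum>k=1..n. if k = \<beta> (Suc n) \<omega> then Y k \<omega> else 0)"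
    by (intro sum.cong) auto
  also have "\<dots> = Y (\<beta> (Suc n) \<omega>) \<omega>" using elim by (subst sum.delta) auto
  finally have "Y (Suc n) \<omega> = (if \<alpha> (Suc n) \<omega> then Y (\<beta> (Suc n) \<omega>) \<omega> else \<xi> (Suc n) \<omega>)"
    by (subst Y.simps) (use n in auto)
  then show ?case unfolding pick by simp
qed

lemma step_expectation:
  fixes G :: "'a \<Rightarrow> 'b::{real_normed_field, banach, second_countable_topology}"
  assumes n: "n \<ge> 1" and G: "G \<in> borel_measurable (past n)" and h[measurable]: "h \<in> borel_measurable borel"
    and intG: "integrable M G" and inth: "integrable M (\<lambda>\<omega>. h (\<xi> 1 \<omega>) :: real)"
    and int: "\<And>k. k \<in> {1..n} \<Longrightarrow> integrable M (\<lambda>\<omega>. G \<omega> * of_real (h (Y k \<omega>)))"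
  shows "integrable M (\<lambda>\<omega>. G \<omega> * of_real (h (Y (Suc n) \<omega>)))"
    "expectation (\<lambda>\<omega>. G \<omega> * of_real (h (Y (Suc n) \<omega>))) =
      (\<Sum>k=1..n. expectation (\<lambda>\<omega>. G \<omega> * of_real (h (Y k \<omega>))) * of_real (p * \<mu> k / \<nu> n))
      + expectation G * of_real ((1 - p) * expectation (\<lambda>\<omega>. h (\<xi> 1 \<omega>)))"
proof -
  define A where "A k \<omega> = (G \<omega> * of_real (h (Y k \<omega>))) * (of_real (pick n k \<omega>) :: 'b)" for k \<omega>
  define B where "B \<omega> = G \<omega> * (of_real ((1 - of_bool (\<alpha> (Suc n) \<omega>)) * h (\<xi> (Suc n) \<omega>)) :: 'b)" for \<omega>
  note G[measurable]
  have A: "integrable M (A k)" "expectation (A k) = expectation (\<lambda>\<omega>. G \<omega> * of_real (h (Y k \<omega>))) * of_real (p * \<mu> k / \<nu> n)"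
    if k: "k \<in> {1..n}" for k
  proof -
    have [measurable]: "Y k \<in> borel_measurable (past n)" using k by (intro Y_past) auto
    have 1: "(\<lambda>\<omega>. G \<omega> * of_real (h (Y k \<omega>))) \<in> borel_measurable (past n)" by measurable
    have 2: "(\<lambda>\<omega>. of_real (pick n k \<omega>) :: 'b) \<in> borel_measurable (fut n)" using pick_fut[of n k] by measurable
    have i: "integrable M (\<lambda>\<omega>. of_real (pick n k \<omega>) :: 'b)" using pick_expectation(2)[OF n k] by simp
    note ind = past_fut_indep[OF n 1 2]
    show "integrable M (A k)" unfolding A_def by (rule indep_var_integrable[OF ind int[OF k] i])
    show "expectation (A k) = expectation (\<lambda>\<omega>. G \<omega> * of_real (h (Y k \<omega>))) * of_real (p * \<mu> k / \<nu> n)"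
      unfolding A_def indep_var_lebesgue_integral[OF ind int[OF k] i]
      using pick_expectation[OF n k] by simp
  qed
  note inn = innovate_expectation[OF n h inth]
  have i: "integrable M (\<lambda>\<omega>. of_real ((1 - of_bool (\<alpha> (Suc n) \<omega>)) * h (\<xi> (Suc n) \<omega>)) :: 'b)"
    using inn(2) by (rule integrable_of_real)
  have m: "(\<lambda>\<omega>. of_real ((1 - of_bool (\<alpha> (Suc n) \<omega>)) * h (\<xi> (Suc n) \<omega>)) :: 'b) \<in> borel_measurable (fut n)"
    using inn(3) by measurable
  note ind = past_fut_indep[OF n G m]
  have B: "integrable M B" unfolding B_def by (rule indep_var_integrable[OF ind intG i])
  have eB: "expectation B = expectation G * of_real ((1 - p) * expectation (\<lambda>\<omega>. h (\<xi> 1 \<omega>)))"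
    unfolding B_def indep_var_lebesgue_integral[OF ind intG i] integral_of_real[OF inn(2)] inn(1) ..
  have ae: "AE \<omega> in M. (\<Sum>k=1..n. A k \<omega>) + B \<omega> = G \<omega> * of_real (h (Y (Suc n) \<omega>))"
    using step_decomposition[OF n, of h]
  proof eventually_elim
    case (elim \<omega>)
    show ?case unfolding elim A_def B_def
      by (simp add: distrib_left sum_distrib_left mult.assoc)
  qed
  have [measurable]: "G \<in> borel_measurable M" by (rule past_imp_measurable[OF G])
  have mG: "(\<lambda>\<omega>. G \<omega> * of_real (h (Y (Suc n) \<omega>))) \<in> borel_measurable M" by measurable
  have AB: "integrable M (\<lambda>\<omega>. (\<Sum>k=1..n. A k \<omega>) + B \<omega>)"
    using A(1) B by (intro Bochner_Integration.integrable_add Bochner_Integration.integrable_sum) auto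
  then show "integrable M (\<lambda>\<omega>. G \<omega> * of_real (h (Y (Suc n) \<omega>)))"
    using integrable_cong_AE[OF _ mG ae] by auto
  have "expectation (\<lambda>\<omega>. G \<omega> * of_real (h (Y (Suc n) \<omega>))) = expectation (\<lambda>\<omega>. (\<Sum>k=1..n. A k \<omega>) + B \<omega>)"
    using integral_cong_AE[OF _ mG ae] AB by auto
  also have "\<dots> = (\<Sum>k=1..n. expectation (A k)) + expectation B"
  proof -
    have S: "integrable M (\<lambda>\<omega>. \<Sum>k=1..n. A k \<omega>)" by (rule Bochner_Integration.integrable_sum[OF A(1)])
    have "expectation (\<lambda>\<omega>. \<Sum>k=1..n. A k \<omega>) = (\<Sum>k=1..n. expectation (A k))"
      by (rule Bochner_Integration.integral_sum[OF A(1)])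
    then show ?thesis using Bochner_Integration.integral_add[OF S B] by simp
  qed
  finally show "expectation (\<lambda>\<omega>. G \<omega> * of_real (h (Y (Suc n) \<omega>))) =
      (\<Sum>k=1..n. expectation (\<lambda>\<omega>. G \<omega> * of_real (h (Y k \<omega>))) * of_real (p * \<mu> k / \<nu> n))
      + expectation G * of_real ((1 - p) * expectation (\<lambda>\<omega>. h (\<xi> 1 \<omega>)))"
    by (simp add: A(2) eB)
qed

text \<open>By induction each step is a mixture, with total weight \<open>p\<close>, of earlier
  steps having the common law and, with weight \<open>1 - p\<close>, of an innovation. This is
  \<open>step_expectation\<close> with \<open>G = 1\<close>; it concerns single steps, which are far
  from independent.\<close>

lemma Y_law:
  fixes h :: "real \<Rightarrow> real"
  assumes h[measurable]: "h \<in> borel_measurable borel" and inth: "integrable M (\<lambda>\<omega>. h (\<xi> 1 \<omega>))"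
    and n: "n \<ge> 1"
  shows "integrable M (\<lambda>\<omega>. h (Y n \<omega>)) \<and> expectation (\<lambda>\<omega>. h (Y n \<omega>)) = expectation (\<lambda>\<omega>. h (\<xi> 1 \<omega>))"
  using n
proof (induction n rule: less_induct)
  case (less n)
  show ?case
  proof (cases "n = 1")
    case True
    have "Y 1 = \<xi> 1" by (rule ext, subst Y.simps) simp
    then show ?thesis using inth True by simp
  next
    case False
    define m where "m = n - 1"
    have m: "n = Suc m" "m \<ge> 1" using False less.prems by (auto simp: m_def)
    have IH: "integrable M (\<lambda>\<omega>. h (Y k \<omega>))" "expectation (\<lambda>\<omega>. h (Y k \<omega>)) = expectation (\<lambda>\<omega>. h (\<xi> 1 \<omega>))" if "k \<in> {1..m}" for k
      using less.IH[of k] that m by auto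
    have 1: "(\<lambda>_. 1 :: real) \<in> borel_measurable (past m)" by simp
    note step = step_expectation[OF m(2) 1 h _ inth]
    have "(\<Sum>k=1..m. expectation (\<lambda>\<omega>. h (Y k \<omega>)) * (p * \<mu> k / \<nu> m)) = (\<Sum>k=1..m. expectation (\<lambda>\<omega>. h (\<xi> 1 \<omega>)) * p / \<nu> m * \<mu> k)"
      by (intro sum.cong) (auto simp: IH)
    also have "\<dots> = expectation (\<lambda>\<omega>. h (\<xi> 1 \<omega>)) * p"
      using \<nu>_pos[OF m(2)] unfolding sum_distrib_left[symmetric] by (simp add: \<nu>_def memory_sum_def)
    finally have s: "(\<Sum>k=1..m. expectation (\<lambda>\<omega>. h (Y k \<omega>)) * (p * \<mu> k / \<nu> m)) = expectation (\<lambda>\<omega>. h (\<xi> 1 \<omega>)) * p" .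
    have "integrable M (\<lambda>\<omega>. h (Y (Suc m) \<omega>))" using step(1) IH(1) by simp
    moreover have "expectation (\<lambda>\<omega>. h (Y (Suc m) \<omega>)) = expectation (\<lambda>\<omega>. h (\<xi> 1 \<omega>))"
      using step(2) IH(1) s by (simp add: prob_space algebra_simps)
    ultimately show ?thesis using m by simp
  qed
qed

end


section \<open>Martingale estimates\<close>

context prob_space
begin

text \<open>Measurability is stated separately since it does not follow from that of the
  square.\<close>

definition l2 :: "('a \<Rightarrow> real) \<Rightarrow> bool" where
  "l2 f \<longleftrightarrow> f \<in> borel_measurable M \<and> integrable M (\<lambda>\<omega>. (f \<omega>)\<^sup>2)"

lemma l2_measurable: "l2 f \<Longrightarrow> f \<in> borel_measurable M"
  and l2_square: "l2 f \<Longrightarrow> integrable M (\<lambda>\<omega>. (f \<omega>)\<^sup>2)"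
  by (simp_all add: l2_def)

lemma l2_mult:
  assumes "l2 f" "l2 g"
  shows "integrable M (\<lambda>\<omega>. f \<omega> * g \<omega>)"
proof (rule Bochner_Integration.integrable_bound)
  note [measurable] = l2_measurable[OF assms(1)] l2_measurable[OF assms(2)]
  show "integrable M (\<lambda>\<omega>. (f \<omega>)\<^sup>2 + (g \<omega>)\<^sup>2)" using assms by (auto dest: l2_square)
  show "(\<lambda>\<omega>. f \<omega> * g \<omega>) \<in> borel_measurable M" by measurable
  show "AE \<omega> in M. norm (f \<omega> * g \<omega>) \<le> norm ((f \<omega>)\<^sup>2 + (g \<omega>)\<^sup>2)"
  proof (rule AE_I2)
    fix \<omega>
    have "2 * (\<bar>f \<omega>\<bar> * \<bar>g \<omega>\<bar>) \<le> (f \<omega>)\<^sup>2 + (g \<omega>)\<^sup>2"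
      using sum_squares_bound[of "\<bar>f \<omega>\<bar>" "\<bar>g \<omega>\<bar>"] by simp
    moreover have "0 \<le> \<bar>f \<omega>\<bar> * \<bar>g \<omega>\<bar>" by simp
    ultimately have "\<bar>f \<omega>\<bar> * \<bar>g \<omega>\<bar> \<le> (f \<omega>)\<^sup>2 + (g \<omega>)\<^sup>2" by linarith
    then show "norm (f \<omega> * g \<omega>) \<le> norm ((f \<omega>)\<^sup>2 + (g \<omega>)\<^sup>2)" by (simp add: abs_mult)
  qed
qed

lemma l2_const: "l2 (\<lambda>_. c)"
  by (simp add: l2_def)

lemma l2_integrable: "l2 f \<Longrightarrow> integrable M f"
  using l2_mult[of f "\<lambda>_. 1"] l2_const by simp

lemma l2_cmult: "l2 f \<Longrightarrow> l2 (\<lambda>\<omega>. c * f \<omega>)"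
  by (auto simp: l2_def power_mult_distrib)

lemma l2_add:
  assumes "l2 f" "l2 g"
  shows "l2 (\<lambda>\<omega>. f \<omega> + g \<omega>)"
  unfolding l2_def power2_sum mult.assoc
  using l2_mult[OF assms] assms[unfolded l2_def] by auto

lemma l2_diff:
  assumes "l2 f" "l2 g"
  shows "l2 (\<lambda>\<omega>. f \<omega> - g \<omega>)"
  using l2_add[OF assms(1) l2_cmult[OF assms(2), of "-1"]] by simp

lemma l2_sum:
  assumes "\<And>i. i \<in> I \<Longrightarrow> l2 (f i)"
  shows "l2 (\<lambda>\<omega>. \<Sum>i\<in>I. f i \<omega>)"
  using assms by (induction I rule: infinite_finite_induct) (auto intro: l2_add l2_const)

lemma l2_indicator:
  assumes f: "l2 f" and A: "A \<in> events"
  shows "l2 (\<lambda>\<omega>. indicator A \<omega> * f \<omega>)"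
proof -
  note [measurable] = l2_measurable[OF f] A
  have "(\<lambda>\<omega>. (indicator A \<omega> * f \<omega>)\<^sup>2) = (\<lambda>\<omega>. (f \<omega>)\<^sup>2 * indicator A \<omega>)"
    by (auto simp: fun_eq_iff indicator_def)
  then show ?thesis using integrable_real_mult_indicator[OF A l2_square[OF f]] by (simp add: l2_def)
qed

text \<open>The variance of the absolute value is nonnegative.\<close>

lemma l2_abs_le:
  assumes f: "l2 f"
  shows "expectation (\<lambda>\<omega>. \<bar>f \<omega>\<bar>) \<le> sqrt (expectation (\<lambda>\<omega>. (f \<omega>)\<^sup>2))"
proof (rule real_le_rsqrt)
  have "0 \<le> variance (\<lambda>\<omega>. \<bar>f \<omega>\<bar>)" by (rule variance_positive)
  also have "\<dots> = expectation (\<lambda>\<omega>. \<bar>f \<omega>\<bar>\<^sup>2) - (expectation (\<lambda>\<omega>. \<bar>f \<omega>\<bar>))\<^sup>2"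
    using l2_integrable[OF f] l2_square[OF f] by (intro variance_eq) auto
  finally show "(expectation (\<lambda>\<omega>. \<bar>f \<omega>\<bar>))\<^sup>2 \<le> expectation (\<lambda>\<omega>. (f \<omega>)\<^sup>2)" by simp
qed

lemma l2_expectation_add_square:
  assumes f: "l2 f" and g: "l2 g"
  shows "expectation (\<lambda>\<omega>. (f \<omega> + g \<omega>)\<^sup>2) = expectation (\<lambda>\<omega>. (f \<omega>)\<^sup>2) + 2 * expectation (\<lambda>\<omega>. f \<omega> * g \<omega>) + expectation (\<lambda>\<omega>. (g \<omega>)\<^sup>2)"
  unfolding power2_sum mult.assoc
  using l2_mult[OF f g] l2_square[OF f] l2_square[OF g] by simp

end

section \<open>The two martingales and their second moments\<close>

context critical_srrw
begin

definition centered :: "(real \<Rightarrow> real) \<Rightarrow> bool" where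
  "centered h \<longleftrightarrow> h \<in> borel_measurable borel \<and> integrable M (\<lambda>\<omega>. (h (\<xi> 1 \<omega>))\<^sup>2) \<and> expectation (\<lambda>\<omega>. h (\<xi> 1 \<omega>)) = 0"

text \<open>\<open>a n * U h n\<close> is a martingale with increments \<open>b (n + 1) * D h n\<close>. The martingale of the proof is
  the case \<open>h x = x\<close>; truncated squares \<open>h\<close> give the law of large numbers for the conditional
  variances.\<close>

definition U :: "(real \<Rightarrow> real) \<Rightarrow> nat \<Rightarrow> 'a \<Rightarrow> real" where
  "U h n \<omega> = (\<Sum>k=1..n. \<mu> k * h (Y k \<omega>))"

definition D :: "(real \<Rightarrow> real) \<Rightarrow> nat \<Rightarrow> 'a \<Rightarrow> real" where
  "D h n \<omega> = h (Y (Suc n) \<omega>) - p / \<nu> n * U h n \<omega>"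

lemma centered_id: "centered (\<lambda>x. x)"
  using \<xi>_sq_integrable \<xi>_mean by (simp add: centered_def)

lemma centered_measurable: "centered h \<Longrightarrow> h \<in> borel_measurable borel"
  by (simp add: centered_def)

lemma \<xi>_l2: "centered h \<Longrightarrow> l2 (\<lambda>\<omega>. h (\<xi> 1 \<omega>))"
  using measurable_compose[OF \<xi>_measurable[OF order_refl], of h borel]
  by (simp add: l2_def centered_def)

lemma hY_l2:
  assumes h: "centered h" and k: "k \<ge> 1"
  shows "l2 (\<lambda>\<omega>. h (Y k \<omega>))" "expectation (\<lambda>\<omega>. (h (Y k \<omega>))\<^sup>2) = expectation (\<lambda>\<omega>. (h (\<xi> 1 \<omega>))\<^sup>2)"
proof -
  note [measurable] = centered_measurable[OF h] Y_measurable[OF k]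
  have "integrable M (\<lambda>\<omega>. (h (Y k \<omega>))\<^sup>2) \<and> expectation (\<lambda>\<omega>. (h (Y k \<omega>))\<^sup>2) = expectation (\<lambda>\<omega>. (h (\<xi> 1 \<omega>))\<^sup>2)"
    by (rule Y_law[OF _ _ k]) (use h in \<open>auto simp: centered_def\<close>)
  then show "l2 (\<lambda>\<omega>. h (Y k \<omega>))" "expectation (\<lambda>\<omega>. (h (Y k \<omega>))\<^sup>2) = expectation (\<lambda>\<omega>. (h (\<xi> 1 \<omega>))\<^sup>2)"
    by (auto simp: l2_def)
qed

lemma hY_past: "centered h \<Longrightarrow> 1 \<le> k \<Longrightarrow> k \<le> n \<Longrightarrow> (\<lambda>\<omega>. h (Y k \<omega>)) \<in> borel_measurable (past n)"
  using measurable_compose[OF Y_past centered_measurable] .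

lemma U_l2: "centered h \<Longrightarrow> l2 (U h n)"
  unfolding U_def by (intro l2_sum l2_cmult hY_l2) auto

lemma U_past: "centered h \<Longrightarrow> k \<le> n \<Longrightarrow> U h k \<in> borel_measurable (past n)"
  unfolding U_def by (intro borel_measurable_sum borel_measurable_times borel_measurable_const hY_past) auto

lemma U_Suc: "U h (Suc n) \<omega> = U h n \<omega> + \<mu> (Suc n) * h (Y (Suc n) \<omega>)"
  by (simp add: U_def)

lemma D_l2: "centered h \<Longrightarrow> l2 (D h n)"
  unfolding D_def by (intro l2_diff l2_cmult hY_l2 U_l2) auto

lemma D_past: "centered h \<Longrightarrow> k < n \<Longrightarrow> D h k \<in> borel_measurable (past n)"
  unfolding D_def
  by (intro borel_measurable_diff borel_measurable_times borel_measurable_const hY_past U_past) auto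

text \<open>The conditional mean of \<open>h (Y (Suc n))\<close> in integrated form; the innovation
  contributes nothing because \<open>h\<close> is centered.\<close>

lemma expectation_mult_hY:
  assumes h: "centered h" and n: "n \<ge> 1" and G: "G \<in> borel_measurable (past n)" "l2 G"
  shows "expectation (\<lambda>\<omega>. G \<omega> * h (Y (Suc n) \<omega>)) = p / \<nu> n * expectation (\<lambda>\<omega>. G \<omega> * U h n \<omega>)"
proof -
  have int: "integrable M (\<lambda>\<omega>. G \<omega> * h (Y k \<omega>))" if "k \<in> {1..n}" for k
    using that by (intro l2_mult G hY_l2[OF h]) auto
  have "expectation (\<lambda>\<omega>. G \<omega> * h (Y (Suc n) \<omega>)) =
      (\<Sum>k=1..n. expectation (\<lambda>\<omega>. G \<omega> * h (Y k \<omega>)) * (p * \<mu> k / \<nu> n))"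
    using step_expectation(2)[OF n G(1) centered_measurable[OF h] l2_integrable[OF G(2)] l2_integrable[OF \<xi>_l2[OF h]]] int h
    by (simp add: centered_def)
  also have "\<dots> = p / \<nu> n * (\<Sum>k=1..n. \<mu> k * expectation (\<lambda>\<omega>. G \<omega> * h (Y k \<omega>)))"
    by (simp add: sum_distrib_left mult_ac)
  also have "(\<Sum>k=1..n. \<mu> k * expectation (\<lambda>\<omega>. G \<omega> * h (Y k \<omega>))) = expectation (\<lambda>\<omega>. \<Sum>k=1..n. \<mu> k * (G \<omega> * h (Y k \<omega>)))"
    using int by (subst Bochner_Integration.integral_sum) auto
  also have "\<dots> = expectation (\<lambda>\<omega>. G \<omega> * U h n \<omega>)"
    by (simp add: U_def sum_distrib_left mult_ac)
  finally show ?thesis .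
qed

lemma D_orthogonal:
  assumes h: "centered h" and n: "n \<ge> 1" and G: "G \<in> borel_measurable (past n)" "l2 G"
  shows "expectation (\<lambda>\<omega>. G \<omega> * D h n \<omega>) = 0"
proof -
  have "expectation (\<lambda>\<omega>. G \<omega> * D h n \<omega>) = expectation (\<lambda>\<omega>. G \<omega> * h (Y (Suc n) \<omega>) - p / \<nu> n * (G \<omega> * U h n \<omega>))"
    by (simp add: D_def right_diff_distrib mult_ac)
  also have "\<dots> = expectation (\<lambda>\<omega>. G \<omega> * h (Y (Suc n) \<omega>)) - p / \<nu> n * expectation (\<lambda>\<omega>. G \<omega> * U h n \<omega>)"
    using l2_mult[OF G(2) U_l2[OF h, of n]] l2_mult[OF G(2) hY_l2(1)[OF h, of "Suc n"]]
    by (subst Bochner_Integration.integral_diff) auto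
  also have "\<dots> = 0" using expectation_mult_hY[OF assms] by simp
  finally show ?thesis .
qed

text \<open>Pythagoras: \<open>h (Y (Suc n))\<close> is the orthogonal sum of \<open>D h n\<close>
  and its conditional mean, and its second moment is that of \<open>h (\<xi> 1)\<close> by equality
  of laws.\<close>

lemma D_square:
  assumes h: "centered h" and n: "n \<ge> 1"
  shows "expectation (\<lambda>\<omega>. (D h n \<omega>)\<^sup>2) \<le> expectation (\<lambda>\<omega>. (h (\<xi> 1 \<omega>))\<^sup>2)"
proof -
  have "expectation (\<lambda>\<omega>. (D h n \<omega> + p / \<nu> n * U h n \<omega>)\<^sup>2)
     = expectation (\<lambda>\<omega>. (D h n \<omega>)\<^sup>2) + 2 * expectation (\<lambda>\<omega>. D h n \<omega> * (p / \<nu> n * U h n \<omega>)) + expectation (\<lambda>\<omega>. (p / \<nu> n * U h n \<omega>)\<^sup>2)"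
    by (intro l2_expectation_add_square D_l2 l2_cmult U_l2 h)
  moreover have "expectation (\<lambda>\<omega>. D h n \<omega> * (p / \<nu> n * U h n \<omega>)) = 0"
    using D_orthogonal[OF h n U_past[OF h order_refl] U_l2[OF h]] by (simp add: mult_ac)
  moreover have "expectation (\<lambda>\<omega>. (p / \<nu> n * U h n \<omega>)\<^sup>2) \<ge> 0" by (intro integral_nonneg_AE) auto
  moreover have "expectation (\<lambda>\<omega>. (D h n \<omega> + p / \<nu> n * U h n \<omega>)\<^sup>2) = expectation (\<lambda>\<omega>. (h (\<xi> 1 \<omega>))\<^sup>2)"
    using hY_l2(2)[OF h, of "Suc n"] by (simp add: D_def)
  ultimately show ?thesis by linarith
qed

text \<open>The conditional mean multiplies \<open>U h n\<close> by
  \<open>1 + p * (\<mu> (Suc n) / \<nu> n)\<close>, and passing from \<open>a n\<close> to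
  \<open>a (Suc n)\<close> divides by exactly this factor.\<close>

lemma aU_Suc:
  assumes n: "n \<ge> 1"
  shows "a (Suc n) * U h (Suc n) \<omega> = a n * U h n \<omega> + b (Suc n) * D h n \<omega>"
proof -
  have "a n = a (Suc n) * (1 + p * (\<mu> (Suc n) / \<nu> n))" using growth_pos[of n] by (simp add: a_Suc[OF n])
  then show ?thesis using \<nu>_pos[OF n] by (simp add: U_Suc D_def b_def algebra_simps)
qed

text \<open>The offset \<open>C\<close> is anything known from time \<open>k\<close> on:
  \<open>C = 0\<close> gives the second moment, and \<open>C\<close> equal to the martingale at
  \<open>k\<close> gives the increment after \<open>k\<close>.\<close>

lemma aU_increment:
  assumes h: "centered h" and k: "k \<ge> 1" and C: "\<And>m. m \<ge> k \<Longrightarrow> C \<in> borel_measurable (past m)" "l2 C" and n: "k \<le> n"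
  shows "expectation (\<lambda>\<omega>. (a n * U h n \<omega> - C \<omega>)\<^sup>2) \<le> expectation (\<lambda>\<omega>. (a k * U h k \<omega> - C \<omega>)\<^sup>2) + expectation (\<lambda>\<omega>. (h (\<xi> 1 \<omega>))\<^sup>2) * (v2 n - v2 k)"
  using n
proof (induction n rule: dec_induct)
  case (step n)
  have n1: "n \<ge> 1" using step k by simp
  let ?G = "\<lambda>\<omega>. a n * U h n \<omega> - C \<omega>"
  let ?s = "expectation (\<lambda>\<omega>. (h (\<xi> 1 \<omega>))\<^sup>2)"
  have G: "l2 ?G" by (intro l2_diff l2_cmult U_l2 h C)
  have Gp: "?G \<in> borel_measurable (past n)"
    using step by (intro borel_measurable_diff borel_measurable_times borel_measurable_const U_past h C) auto
  have bD: "l2 (\<lambda>\<omega>. b (Suc n) * D h n \<omega>)" by (intro l2_cmult D_l2 h)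
  have "expectation (\<lambda>\<omega>. (a (Suc n) * U h (Suc n) \<omega> - C \<omega>)\<^sup>2) = expectation (\<lambda>\<omega>. (?G \<omega> + b (Suc n) * D h n \<omega>)\<^sup>2)"
    unfolding aU_Suc[OF n1] by (simp add: algebra_simps)
  also have "\<dots> = expectation (\<lambda>\<omega>. (?G \<omega>)\<^sup>2) + 2 * expectation (\<lambda>\<omega>. ?G \<omega> * (b (Suc n) * D h n \<omega>)) + expectation (\<lambda>\<omega>. (b (Suc n) * D h n \<omega>)\<^sup>2)"
    by (rule l2_expectation_add_square[OF G bD])
  also have "expectation (\<lambda>\<omega>. ?G \<omega> * (b (Suc n) * D h n \<omega>)) = b (Suc n) * expectation (\<lambda>\<omega>. ?G \<omega> * D h n \<omega>)"
    by (subst integral_mult_right_zero[symmetric]) (simp only: mult.left_commute)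
  also have "\<dots> = 0" using D_orthogonal[OF h n1 Gp G] by simp
  also have "expectation (\<lambda>\<omega>. (b (Suc n) * D h n \<omega>)\<^sup>2) = (b (Suc n))\<^sup>2 * expectation (\<lambda>\<omega>. (D h n \<omega>)\<^sup>2)"
    by (simp add: power_mult_distrib)
  also have "\<dots> \<le> (b (Suc n))\<^sup>2 * ?s" by (intro mult_left_mono D_square h n1) auto
  finally show ?case using step.IH by (simp add: v2_Suc algebra_simps)
qed simp

lemma aU_square:
  assumes h: "centered h" and n: "n \<ge> 1"
  shows "expectation (\<lambda>\<omega>. (a n * U h n \<omega>)\<^sup>2) \<le> expectation (\<lambda>\<omega>. (h (\<xi> 1 \<omega>))\<^sup>2) * v2 n"
proof -
  have "expectation (\<lambda>\<omega>. (a 1 * U h 1 \<omega>)\<^sup>2) = (b 1)\<^sup>2 * expectation (\<lambda>\<omega>. (h (\<xi> 1 \<omega>))\<^sup>2)"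
    using hY_l2(2)[OF h order_refl] by (simp add: U_def b_def power_mult_distrib)
  moreover have "v2 1 = (b 1)\<^sup>2" by (simp add: v2_def)
  ultimately show ?thesis
    using aU_increment[OF h order_refl _ _ n, of "\<lambda>_. 0"] l2_const[of 0] by (simp add: algebra_simps)
qed

text \<open>Symmetric in \<open>k\<close> and \<open>n\<close>, because the martingale is frozen at
  \<open>n\<close> while \<open>k\<close> runs up to a multiple of \<open>n\<close>.\<close>

lemma aU_diff:
  assumes h: "centered h" and k: "k \<ge> 1" and n: "n \<ge> 1"
  shows "expectation (\<lambda>\<omega>. \<bar>a k * U h k \<omega> - a n * U h n \<omega>\<bar>) \<le> sqrt (expectation (\<lambda>\<omega>. (h (\<xi> 1 \<omega>))\<^sup>2) * \<bar>v2 n - v2 k\<bar>)"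
proof -
  have *: "expectation (\<lambda>\<omega>. (a n * U h n \<omega> - a k * U h k \<omega>)\<^sup>2) \<le> expectation (\<lambda>\<omega>. (h (\<xi> 1 \<omega>))\<^sup>2) * (v2 n - v2 k)"
    if "k \<ge> 1" "k \<le> n" for k n
    using aU_increment[OF h that(1) _ _ that(2), of "\<lambda>\<omega>. a k * U h k \<omega>"] U_past[OF h] l2_cmult[OF U_l2[OF h]] by simp
  have "expectation (\<lambda>\<omega>. (a k * U h k \<omega> - a n * U h n \<omega>)\<^sup>2) \<le> expectation (\<lambda>\<omega>. (h (\<xi> 1 \<omega>))\<^sup>2) * \<bar>v2 n - v2 k\<bar>"
    using *[of k n] *[of n k] k n v2_mono[of k n] v2_mono[of n k]
    by (cases "k \<le> n") (auto simp: power2_commute)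
  then show ?thesis
    using l2_abs_le[OF l2_diff[OF l2_cmult[OF U_l2[OF h]] l2_cmult[OF U_l2[OF h]]], of "a k" k "a n" n]
    by (meson order_trans real_sqrt_le_mono)
qed

text \<open>The martingale part of the walk. At index 0 the empty sum leaves \<open>Y 1\<close> and
  not the starting point 0, so that index is treated separately in the decomposition of the
  walk.\<close>

definition Nm :: "nat \<Rightarrow> 'a \<Rightarrow> real" where
  "Nm n \<omega> = Y 1 \<omega> + (\<Sum>k=1..<n. D (\<lambda>x. x) k \<omega>)"

lemma Nm_l2: "l2 (Nm n)"
  unfolding Nm_def using hY_l2(1)[OF centered_id order_refl]
  by (intro l2_add l2_sum D_l2 centered_id) auto

lemma Nm_past: "n \<ge> 1 \<Longrightarrow> k \<le> n \<Longrightarrow> Nm k \<in> borel_measurable (past n)"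
  unfolding Nm_def using hY_past[OF centered_id order_refl, of n]
  by (intro borel_measurable_add borel_measurable_sum D_past centered_id) auto

lemma Nm_Suc: "n \<ge> 1 \<Longrightarrow> Nm (Suc n) \<omega> = Nm n \<omega> + D (\<lambda>x. x) n \<omega>"
  by (simp add: Nm_def)

lemma Nm_square: "n \<ge> 1 \<Longrightarrow> expectation (\<lambda>\<omega>. (Nm n \<omega>)\<^sup>2) \<le> real n"
proof (induction n rule: dec_induct)
  case base
  show ?case using hY_l2(2)[OF centered_id order_refl] \<xi>_sq by (simp add: Nm_def)
next
  case (step n)
  have "expectation (\<lambda>\<omega>. (Nm (Suc n) \<omega>)\<^sup>2) = expectation (\<lambda>\<omega>. (Nm n \<omega>)\<^sup>2) + 2 * expectation (\<lambda>\<omega>. Nm n \<omega> * D (\<lambda>x. x) n \<omega>) + expectation (\<lambda>\<omega>. (D (\<lambda>x. x) n \<omega>)\<^sup>2)"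
    unfolding Nm_Suc[OF step(1)] by (intro l2_expectation_add_square Nm_l2 D_l2 centered_id)
  also have "expectation (\<lambda>\<omega>. Nm n \<omega> * D (\<lambda>x. x) n \<omega>) = 0"
    using step(1) by (intro D_orthogonal centered_id Nm_l2 Nm_past) auto
  also have "expectation (\<lambda>\<omega>. (D (\<lambda>x. x) n \<omega>)\<^sup>2) \<le> 1"
    using D_square[OF centered_id step(1)] \<xi>_sq by simp
  finally show ?case using step.IH by simp
qed

lemma Nm_orthogonal:
  assumes k: "k \<ge> 1" "k \<le> n" and G: "\<And>m. m \<ge> k \<Longrightarrow> G \<in> borel_measurable (past m)" "l2 G"
  shows "expectation (\<lambda>\<omega>. G \<omega> * (Nm n \<omega> - Nm k \<omega>)) = 0"
proof -
  have eq: "Nm n \<omega> - Nm k \<omega> = (\<Sum>j=k..<n. D (\<lambda>x. x) j \<omega>)" for \<omega>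
    using sum.atLeastLessThan_concat[OF k, of "\<lambda>j. D (\<lambda>x. x) j \<omega>"] by (simp add: Nm_def)
  have "expectation (\<lambda>\<omega>. G \<omega> * (Nm n \<omega> - Nm k \<omega>)) = (\<Sum>j=k..<n. expectation (\<lambda>\<omega>. G \<omega> * D (\<lambda>x. x) j \<omega>))"
    unfolding eq sum_distrib_left
    by (intro Bochner_Integration.integral_sum l2_mult G D_l2 centered_id)
  also have "\<dots> = 0" using k by (intro sum.neutral ballI D_orthogonal centered_id G) auto
  finally show ?thesis .
qed

text \<open>Kolmogorov's argument: \<open>A k\<close> is the event that \<open>k\<close> is the first passage time.\<close>

lemma Nm_maximal:
  assumes n: "n \<ge> 1" and l: "l > 0"
  shows "prob {\<omega> \<in> space M. \<exists>k\<in>{1..n}. l \<le> \<bar>Nm k \<omega>\<bar>} \<le> real n / l\<^sup>2"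
proof -
  define A where "A k = {\<omega> \<in> space M. l \<le> \<bar>Nm k \<omega>\<bar> \<and> (\<forall>j\<in>{1..<k}. \<bar>Nm j \<omega>\<bar> < l)}" for k
  have A_past: "A k \<in> sets (past m)" if "1 \<le> k" "k \<le> m" for k m
  proof -
    have [measurable]: "Nm j \<in> borel_measurable (past m)" if "j \<in> {1..k}" for j
      using that \<open>1 \<le> k\<close> \<open>k \<le> m\<close> by (intro Nm_past) auto
    have "{\<omega> \<in> space (past m). l \<le> \<bar>Nm k \<omega>\<bar>} \<in> sets (past m)"
      using \<open>1 \<le> k\<close> by (intro borel_measurable_le) auto
    moreover have "{\<omega> \<in> space (past m). \<forall>j\<in>{1..<k}. \<bar>Nm j \<omega>\<bar> < l} \<in> sets (past m)"
      by (intro sets.sets_Collect_finite_All borel_measurable_less) auto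
    ultimately have "{\<omega> \<in> space (past m). l \<le> \<bar>Nm k \<omega>\<bar>} \<inter> {\<omega> \<in> space (past m). \<forall>j\<in>{1..<k}. \<bar>Nm j \<omega>\<bar> < l} \<in> sets (past m)"
      by (rule sets.Int)
    also have "{\<omega> \<in> space (past m). l \<le> \<bar>Nm k \<omega>\<bar>} \<inter> {\<omega> \<in> space (past m). \<forall>j\<in>{1..<k}. \<bar>Nm j \<omega>\<bar> < l} = A k"
      by (auto simp: A_def past_def space_alg)
    finally show ?thesis .
  qed
  have A_events: "A k \<in> events" if "1 \<le> k" for k using A_past[OF that order_refl] past_events by blast
  have "{\<omega> \<in> space M. \<exists>k\<in>{1..n}. l \<le> \<bar>Nm k \<omega>\<bar>} = (\<Union>k\<in>{1..n}. A k)"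
  proof (intro set_eqI iffI)
    fix \<omega> assume "\<omega> \<in> {\<omega> \<in> space M. \<exists>k\<in>{1..n}. l \<le> \<bar>Nm k \<omega>\<bar>}"
    then have w: "\<omega> \<in> space M" "\<exists>k. k \<in> {1..n} \<and> l \<le> \<bar>Nm k \<omega>\<bar>" by auto
    define k where "k = (LEAST k. k \<in> {1..n} \<and> l \<le> \<bar>Nm k \<omega>\<bar>)"
    have k: "k \<in> {1..n} \<and> l \<le> \<bar>Nm k \<omega>\<bar>" unfolding k_def by (rule LeastI_ex[OF w(2)])
    have "\<bar>Nm j \<omega>\<bar> < l" if "j \<in> {1..<k}" for j
      using not_less_Least[of j "\<lambda>k. k \<in> {1..n} \<and> l \<le> \<bar>Nm k \<omega>\<bar>"] that k unfolding k_def[symmetric] by auto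
    then show "\<omega> \<in> (\<Union>k\<in>{1..n}. A k)" using k w by (auto simp: A_def)
  qed (auto simp: A_def)
  also have "prob \<dots> = (\<Sum>k=1..n. prob (A k))"
  proof (rule finite_measure_finite_Union)
    show "disjoint_family_on A {1..n}"
      unfolding disjoint_family_on_def
    proof (intro ballI impI)
      fix i j :: nat assume "i \<in> {1..n}" "j \<in> {1..n}" "i \<noteq> j"
      then show "A i \<inter> A j = {}" unfolding A_def by (cases "i < j") (force simp: not_less)+
    qed
  qed (use A_events in auto)
  also have "\<dots> \<le> (\<Sum>k=1..n. expectation (\<lambda>\<omega>. indicator (A k) \<omega> * (Nm n \<omega>)\<^sup>2) / l\<^sup>2)"
  proof (rule sum_mono)
    fix k assume k: "k \<in> {1..n}"
    have Ak: "A k \<in> events" using A_events k by auto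
    define G where "G \<omega> = indicator (A k) \<omega> * Nm k \<omega>" for \<omega>
    have G: "l2 G" unfolding G_def by (intro l2_indicator Nm_l2 Ak)
    have Gp: "G \<in> borel_measurable (past m)" if "m \<ge> k" for m
      unfolding G_def using A_past[of k m] Nm_past[of m k] k that
      by (intro borel_measurable_times borel_measurable_indicator) auto
    have i1: "integrable M (\<lambda>\<omega>. indicator (A k) \<omega> * (Nm k \<omega>)\<^sup>2)"
      using integrable_real_mult_indicator[OF Ak l2_square[OF Nm_l2[of k]]] by (simp add: mult.commute)
    have i2: "integrable M (\<lambda>\<omega>. indicator (A k) \<omega> * (Nm n \<omega>)\<^sup>2)"
      using integrable_real_mult_indicator[OF Ak l2_square[OF Nm_l2[of n]]] by (simp add: mult.commute)
    have i3: "integrable M (\<lambda>\<omega>. G \<omega> * (Nm n \<omega> - Nm k \<omega>))" by (intro l2_mult G l2_diff Nm_l2)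
    have "l\<^sup>2 * prob (A k) = expectation (\<lambda>\<omega>. l\<^sup>2 * indicator (A k) \<omega>)" using Ak by simp
    also have "\<dots> \<le> expectation (\<lambda>\<omega>. indicator (A k) \<omega> * (Nm k \<omega>)\<^sup>2)"
    proof (rule integral_mono[OF _ i1])
      show "integrable M (\<lambda>\<omega>. l\<^sup>2 * indicator (A k) \<omega>)" using Ak by (auto simp: emeasure_eq_measure intro!: integrable_mult_right integrable_real_indicator)
      fix \<omega> show "l\<^sup>2 * indicator (A k) \<omega> \<le> indicator (A k) \<omega> * (Nm k \<omega>)\<^sup>2"
        using l power_mono[of l "\<bar>Nm k \<omega>\<bar>" 2] by (auto simp: indicator_def A_def)
    qed
    \<comment> \<open>The added cross term is zero by orthogonality; it completes the square, so
      that the integrand is bounded by that of the final time.\<close>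
    also have "\<dots> = expectation (\<lambda>\<omega>. indicator (A k) \<omega> * (Nm k \<omega>)\<^sup>2) + 2 * expectation (\<lambda>\<omega>. G \<omega> * (Nm n \<omega> - Nm k \<omega>))"
      using Nm_orthogonal[of k n G] Gp G k by simp
    also have "\<dots> = expectation (\<lambda>\<omega>. indicator (A k) \<omega> * (Nm k \<omega>)\<^sup>2 + 2 * (G \<omega> * (Nm n \<omega> - Nm k \<omega>)))"
      using i1 i3 by simp
    also have "\<dots> \<le> expectation (\<lambda>\<omega>. indicator (A k) \<omega> * (Nm n \<omega>)\<^sup>2)"
    proof (rule integral_mono[OF _ i2])
      show "integrable M (\<lambda>\<omega>. indicator (A k) \<omega> * (Nm k \<omega>)\<^sup>2 + 2 * (G \<omega> * (Nm n \<omega> - Nm k \<omega>)))" using i1 i3 by simp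
      fix \<omega>
      have "0 \<le> (Nm n \<omega> - Nm k \<omega>)\<^sup>2" by simp
      then show "indicator (A k) \<omega> * (Nm k \<omega>)\<^sup>2 + 2 * (G \<omega> * (Nm n \<omega> - Nm k \<omega>)) \<le> indicator (A k) \<omega> * (Nm n \<omega>)\<^sup>2"
        by (auto simp: G_def indicator_def power2_eq_square algebra_simps)
    qed
    finally show "prob (A k) \<le> expectation (\<lambda>\<omega>. indicator (A k) \<omega> * (Nm n \<omega>)\<^sup>2) / l\<^sup>2"
      using l by (simp add: field_simps)
  qed
  also have "\<dots> = expectation (\<lambda>\<omega>. \<Sum>k=1..n. indicator (A k) \<omega> * (Nm n \<omega>)\<^sup>2) / l\<^sup>2"
    unfolding sum_divide_distrib[symmetric]
    using A_events integrable_real_mult_indicator[OF _ l2_square[OF Nm_l2[of n]]]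
    by (subst Bochner_Integration.integral_sum) (auto simp: mult.commute)
  also have "\<dots> \<le> expectation (\<lambda>\<omega>. (Nm n \<omega>)\<^sup>2) / l\<^sup>2"
  proof (intro divide_right_mono integral_mono)
    show "integrable M (\<lambda>\<omega>. \<Sum>k=1..n. indicator (A k) \<omega> * (Nm n \<omega>)\<^sup>2)"
      using A_events integrable_real_mult_indicator[OF _ l2_square[OF Nm_l2[of n]]]
      by (intro Bochner_Integration.integrable_sum) (auto simp: mult.commute)
    show "integrable M (\<lambda>\<omega>. (Nm n \<omega>)\<^sup>2)" by (rule l2_square[OF Nm_l2])
    fix \<omega>
    \<comment> \<open>First passage happens at one time at most.\<close>
    have "(\<Sum>k=1..n. indicator (A k) \<omega>) \<le> (1::real)"
    proof (cases "\<exists>k\<in>{1..n}. \<omega> \<in> A k")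
      case True
      then obtain k where k: "k \<in> {1..n}" "\<omega> \<in> A k" by blast
      have "\<omega> \<notin> A j" if "j \<in> {1..n}" "j \<noteq> k" for j
        using k that unfolding A_def by (cases "j < k") (force simp: not_less)+
      then have "(\<Sum>j=1..n. indicator (A j) \<omega>) = (\<Sum>j=1..n. if j = k then 1 else (0::real))"
        using k by (intro sum.cong) (auto simp: indicator_def)
      then show ?thesis using k by simp
    next
      case False
      then have "(\<Sum>k=1..n. indicator (A k) \<omega>) = (0::real)" by (intro sum.neutral) auto
      then show ?thesis by simp
    qed
    from mult_right_mono[OF this, of "(Nm n \<omega>)\<^sup>2"]
    show "(\<Sum>k=1..n. indicator (A k) \<omega> * (Nm n \<omega>)\<^sup>2) \<le> (Nm n \<omega>)\<^sup>2" by (simp add: sum_distrib_right)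
  qed simp
  also have "\<dots> \<le> real n / l\<^sup>2" using Nm_square[OF n] by (intro divide_right_mono) auto
  finally show ?thesis .
qed

end


section \<open>Central limit theorem for the martingale\<close>

context critical_srrw
begin

text \<open>A weak law of large numbers for averages weighted by the memory. The martingale bound
  replaces independence, and \<open>v2_a\<nu>\<close> supplies the rate.\<close>

lemma mean_square_U:
  assumes h: "centered h"
  shows "(\<lambda>n. expectation (\<lambda>\<omega>. (U h n \<omega>)\<^sup>2) / (\<nu> n)\<^sup>2) \<longlonglongrightarrow> 0"
proof (rule tendsto_sandwich[of "\<lambda>_. 0"])
  let ?s = "expectation (\<lambda>\<omega>. (h (\<xi> 1 \<omega>))\<^sup>2)"
  show "(\<lambda>n. ?s * (v2 n / (a n * \<nu> n)\<^sup>2)) \<longlonglongrightarrow> 0"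
    using tendsto_mult[OF tendsto_const v2_a\<nu>, of ?s] by simp
  show "eventually (\<lambda>n. expectation (\<lambda>\<omega>. (U h n \<omega>)\<^sup>2) / (\<nu> n)\<^sup>2 \<le> ?s * (v2 n / (a n * \<nu> n)\<^sup>2)) sequentially"
    using eventually_ge_at_top[of 1]
  proof eventually_elim
    case (elim n)
    have "(a n)\<^sup>2 * expectation (\<lambda>\<omega>. (U h n \<omega>)\<^sup>2) \<le> ?s * v2 n"
      using aU_square[OF h elim] by (simp add: power_mult_distrib)
    then show ?case using a_pos[OF elim] \<nu>_pos[OF elim] by (simp add: field_simps power_mult_distrib)
  qed
qed auto

lemma mean_abs_U:
  assumes h: "centered h"
  shows "(\<lambda>n. expectation (\<lambda>\<omega>. \<bar>U h n \<omega>\<bar>) / \<nu> n) \<longlonglongrightarrow> 0"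
proof (rule tendsto_sandwich[of "\<lambda>_. 0"])
  show "(\<lambda>n. sqrt (expectation (\<lambda>\<omega>. (U h n \<omega>)\<^sup>2) / (\<nu> n)\<^sup>2)) \<longlonglongrightarrow> 0"
    using tendsto_real_sqrt[OF mean_square_U[OF h]] by simp
  show "eventually (\<lambda>n. expectation (\<lambda>\<omega>. \<bar>U h n \<omega>\<bar>) / \<nu> n \<le> sqrt (expectation (\<lambda>\<omega>. (U h n \<omega>)\<^sup>2) / (\<nu> n)\<^sup>2)) sequentially"
    using eventually_ge_at_top[of 1]
  proof eventually_elim
    case (elim n)
    show ?case using divide_right_mono[OF l2_abs_le[OF U_l2[OF h, of n]], of "\<nu> n"] \<nu>_pos[OF elim]
      by (simp add: real_sqrt_divide)
  qed
  show "eventually (\<lambda>n. 0 \<le> expectation (\<lambda>\<omega>. \<bar>U h n \<omega>\<bar>) / \<nu> n) sequentially"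
    using eventually_ge_at_top[of 1]
    by eventually_elim (use \<nu>_pos in \<open>simp add: less_imp_le\<close>)
qed auto

text \<open>\<open>p * V n / \<nu> n + (1 - p)\<close> is the conditional second moment of the next
  step, so the central limit theorem needs \<open>V n / \<nu> n\<close> close to 1.\<close>

definition V :: "nat \<Rightarrow> 'a \<Rightarrow> real" where
  "V n \<omega> = (\<Sum>k=1..n. \<mu> k * (Y k \<omega>)\<^sup>2)"

lemma Y_square_integrable: "k \<ge> 1 \<Longrightarrow> integrable M (\<lambda>\<omega>. (Y k \<omega>)\<^sup>2)"
  using l2_square[OF hY_l2(1)[OF centered_id]] .

lemma Y_square: "k \<ge> 1 \<Longrightarrow> expectation (\<lambda>\<omega>. (Y k \<omega>)\<^sup>2) = 1"
  using hY_l2(2)[OF centered_id] \<xi>_sq by simp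

lemma V_integrable: "integrable M (V n)"
  unfolding V_def by (intro Bochner_Integration.integrable_sum integrable_mult_right Y_square_integrable) auto

text \<open>Only \<open>\<xi>\<^sup>2\<close> is integrable, so the second moment bound for weighted sums is applied to the
  truncation \<open>min (\<xi>\<^sup>2) K\<close>.\<close>

lemma V_law_of_large_numbers: "(\<lambda>n. expectation (\<lambda>\<omega>. \<bar>V n \<omega> / \<nu> n - 1\<bar>)) \<longlonglongrightarrow> 0"
proof (rule tendstoI)
  fix e :: real assume e: "e > 0"
  note [measurable] = \<xi>_measurable[OF order_refl] \<xi>_measurable[OF order_refl, simplified]
  have "(\<lambda>K. expectation (\<lambda>\<omega>. min ((\<xi> 1 \<omega>)\<^sup>2) (real K))) \<longlonglongrightarrow> expectation (\<lambda>\<omega>. (\<xi> 1 \<omega>)\<^sup>2)"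
  proof (rule integral_dominated_convergence[where w="\<lambda>\<omega>. (\<xi> 1 \<omega>)\<^sup>2"])
    show "AE \<omega> in M. (\<lambda>K. min ((\<xi> 1 \<omega>)\<^sup>2) (real K)) \<longlonglongrightarrow> (\<xi> 1 \<omega>)\<^sup>2"
    proof (rule AE_I2, rule tendsto_eventually)
      fix \<omega>
      obtain K where "(\<xi> 1 \<omega>)\<^sup>2 \<le> real K" using real_arch_simple by blast
      then show "eventually (\<lambda>K. min ((\<xi> 1 \<omega>)\<^sup>2) (real K) = (\<xi> 1 \<omega>)\<^sup>2) sequentially"
        by (intro eventually_sequentiallyI[of K]) (auto simp: min_def)
    qed
  qed (use \<xi>_sq_integrable in auto)
  then have "eventually (\<lambda>K. 1 - e / 4 < expectation (\<lambda>\<omega>. min ((\<xi> 1 \<omega>)\<^sup>2) (real K))) sequentially"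
    using e \<xi>_sq by (intro order_tendstoD(1)) auto
  then obtain K where K: "1 - e / 4 < expectation (\<lambda>\<omega>. min ((\<xi> 1 \<omega>)\<^sup>2) (real K))"
    by (auto simp: eventually_sequentially)
  define g where "g x = min (x\<^sup>2) (real K)" for x :: real
  define mK where "mK = expectation (\<lambda>\<omega>. g (\<xi> 1 \<omega>))"
  define h where "h x = g x - mK" for x :: real
  have [measurable]: "g \<in> borel_measurable borel" unfolding g_def[abs_def] by measurable
  have g_bd: "0 \<le> g x" "g x \<le> real K" "g x \<le> x\<^sup>2" for x by (auto simp: g_def)
  have g_int: "integrable M (\<lambda>\<omega>. g (\<xi> 1 \<omega>))"
    using g_bd by (intro integrable_const_bound[of _ "real K"]) auto
  have mK: "1 - e / 4 < mK" using K by (simp add: mK_def g_def)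
  have h: "centered h"
  proof -
    have [measurable]: "h \<in> borel_measurable borel" unfolding h_def[abs_def] by measurable
    have "\<bar>h x\<bar> \<le> real K + \<bar>mK\<bar>" for x using g_bd[of x] unfolding h_def by linarith
    then have "(h x)\<^sup>2 \<le> (real K + \<bar>mK\<bar>)\<^sup>2" for x
      using power_mono[of "\<bar>h x\<bar>" "real K + \<bar>mK\<bar>" 2] by simp
    then have "integrable M (\<lambda>\<omega>. (h (\<xi> 1 \<omega>))\<^sup>2)" by (intro integrable_const_bound[of _ "(real K + \<bar>mK\<bar>)\<^sup>2"]) auto
    moreover have "expectation (\<lambda>\<omega>. h (\<xi> 1 \<omega>)) = 0"
      using g_int by (simp add: h_def mK_def prob_space)
    ultimately show ?thesis by (simp add: centered_def)
  qed
  have gY: "integrable M (\<lambda>\<omega>. g (Y k \<omega>))" "expectation (\<lambda>\<omega>. g (Y k \<omega>)) = mK" if "k \<ge> 1" for k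
    using Y_law[OF _ g_int that] by (auto simp: mK_def)
  \<comment> \<open>The part \<open>R\<close> of the squares above the truncation level is
    nonnegative with mean \<open>\<nu> n * (1 - mK)\<close>, and centering by \<open>mK\<close>
    instead of 1 costs \<open>1 - mK\<close> once more, whence the factor 2 and the threshold
    \<open>e / 4\<close> for \<open>K\<close>.\<close>
  have bound: "expectation (\<lambda>\<omega>. \<bar>V n \<omega> / \<nu> n - 1\<bar>) \<le> expectation (\<lambda>\<omega>. \<bar>U h n \<omega>\<bar>) / \<nu> n + 2 * (1 - mK)" if n: "n \<ge> 1" for n
  proof -
    define R where "R \<omega> = (\<Sum>k=1..n. \<mu> k * ((Y k \<omega>)\<^sup>2 - g (Y k \<omega>)))" for \<omega>
    have R_int: "integrable M R" unfolding R_def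
      by (intro Bochner_Integration.integrable_sum integrable_mult_right Bochner_Integration.integrable_diff Y_square_integrable gY) auto
    have "expectation R = (\<Sum>k=1..n. \<mu> k * (1 - mK))"
      unfolding R_def using Y_square_integrable gY Y_square
      by (subst Bochner_Integration.integral_sum) (auto intro!: sum.cong)
    also have "\<dots> = \<nu> n * (1 - mK)" by (simp add: sum_distrib_right \<nu>_def memory_sum_def)
    finally have R_exp: "expectation R = \<nu> n * (1 - mK)" .
    have R_nonneg: "R \<omega> \<ge> 0" for \<omega>
      unfolding R_def using g_bd by (intro sum_nonneg mult_nonneg_nonneg) (auto intro!: less_imp_le[OF \<mu>_gt_0])
    have mK1: "mK \<le> 1" using R_exp R_nonneg \<nu>_pos[OF n] Bochner_Integration.integral_nonneg[of M R] by (simp add: zero_le_mult_iff)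
    have VU: "V n \<omega> = U h n \<omega> + R \<omega> + \<nu> n * mK" for \<omega>
      unfolding V_def U_def R_def \<nu>_def memory_sum_def h_def sum_distrib_right sum.distrib[symmetric]
      by (intro sum.cong) (auto simp: algebra_simps)
    have "\<bar>V n \<omega> / \<nu> n - 1\<bar> \<le> \<bar>U h n \<omega>\<bar> / \<nu> n + R \<omega> / \<nu> n + (1 - mK)" for \<omega>
    proof -
      have "V n \<omega> / \<nu> n - 1 = U h n \<omega> / \<nu> n + R \<omega> / \<nu> n - (1 - mK)"
        using \<nu>_pos[OF n] unfolding VU by (simp add: field_simps)
      moreover have "\<bar>U h n \<omega> / \<nu> n\<bar> = \<bar>U h n \<omega>\<bar> / \<nu> n" "0 \<le> R \<omega> / \<nu> n"
        using \<nu>_pos[OF n] R_nonneg by auto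
      ultimately show ?thesis using mK1 by linarith
    qed
    then have "expectation (\<lambda>\<omega>. \<bar>V n \<omega> / \<nu> n - 1\<bar>) \<le> expectation (\<lambda>\<omega>. \<bar>U h n \<omega>\<bar> / \<nu> n + R \<omega> / \<nu> n + (1 - mK))"
      using V_integrable[of n] R_int l2_integrable[OF U_l2[OF h, of n]]
      by (intro integral_mono) auto
    also have "\<dots> = expectation (\<lambda>\<omega>. \<bar>U h n \<omega>\<bar>) / \<nu> n + expectation R / \<nu> n + (1 - mK)"
      using R_int l2_integrable[OF U_l2[OF h, of n]] by (simp add: prob_space)
    also have "\<dots> = expectation (\<lambda>\<omega>. \<bar>U h n \<omega>\<bar>) / \<nu> n + 2 * (1 - mK)"
      using \<nu>_pos[OF n] by (simp add: R_exp)
    finally show ?thesis .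
  qed
  have "eventually (\<lambda>n. expectation (\<lambda>\<omega>. \<bar>U h n \<omega>\<bar>) / \<nu> n < e / 2) sequentially"
    using e by (intro order_tendstoD(2)[OF mean_abs_U[OF h]]) auto
  then show "eventually (\<lambda>n. dist (expectation (\<lambda>\<omega>. \<bar>V n \<omega> / \<nu> n - 1\<bar>)) 0 < e) sequentially"
    using eventually_ge_at_top[of 1]
  proof eventually_elim
    case (elim n)
    have "0 \<le> expectation (\<lambda>\<omega>. \<bar>V n \<omega> / \<nu> n - 1\<bar>)" by (intro Bochner_Integration.integral_nonneg) auto
    moreover have "x < e" if "x \<le> y + 2 * (1 - mK)" "y < e / 2" for x y
    proof -
      have "2 * (1 - mK) < e / 2" using mK by simp
      with that(2) have "y + 2 * (1 - mK) < e / 2 + e / 2" by (rule add_strict_mono)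
      with that(1) show ?thesis by simp
    qed
    from this[OF bound[OF elim(2)] elim(1)] have "expectation (\<lambda>\<omega>. \<bar>V n \<omega> / \<nu> n - 1\<bar>) < e" .
    ultimately show ?case by (simp add: dist_real_def)
  qed
qed

text \<open>\<open>u\<^sup>2 * \<kappa> u\<close> dominates the mean second order Taylor remainder
  of a characteristic function: the smaller of the quadratic bound and the cubic one with constant
  1/3!. It vanishes with \<open>u\<close> under a second moment alone.\<close>

definition \<kappa> :: "real \<Rightarrow> real" where
  "\<kappa> u = expectation (\<lambda>\<omega>. min ((\<xi> 1 \<omega>)\<^sup>2) (u * \<bar>\<xi> 1 \<omega>\<bar> ^ 3 / 6))"

lemma \<kappa>_integrand:
  assumes u: "u \<ge> 0"
  shows "integrable M (\<lambda>\<omega>. min ((\<xi> 1 \<omega>)\<^sup>2) (u * \<bar>\<xi> 1 \<omega>\<bar> ^ 3 / 6))"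
proof (rule Bochner_Integration.integrable_bound[OF \<xi>_sq_integrable])
  note [measurable] = \<xi>_measurable[OF order_refl] \<xi>_measurable[OF order_refl, simplified]
  show "(\<lambda>\<omega>. min ((\<xi> 1 \<omega>)\<^sup>2) (u * \<bar>\<xi> 1 \<omega>\<bar> ^ 3 / 6)) \<in> borel_measurable M" by measurable
  show "AE \<omega> in M. norm (min ((\<xi> 1 \<omega>)\<^sup>2) (u * \<bar>\<xi> 1 \<omega>\<bar> ^ 3 / 6)) \<le> norm ((\<xi> 1 \<omega>)\<^sup>2)"
    using u by (intro AE_I2) (auto simp: min_def)
qed

lemma \<kappa>_mono: "0 \<le> u \<Longrightarrow> u \<le> u' \<Longrightarrow> \<kappa> u \<le> \<kappa> u'"
  unfolding \<kappa>_def
  by (intro integral_mono \<kappa>_integrand min.mono divide_right_mono mult_right_mono) auto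

lemma \<kappa>_nonneg: "0 \<le> u \<Longrightarrow> 0 \<le> \<kappa> u"
  unfolding \<kappa>_def by (intro Bochner_Integration.integral_nonneg) auto

text \<open>Dominated convergence with majorant the square of \<open>\<xi> 1\<close>. Monotonicity
  of \<open>\<kappa>\<close> extends the conclusion from these arguments to all small ones.\<close>

lemma \<kappa>_tendsto: "(\<lambda>n. \<kappa> (inverse (real (Suc n)))) \<longlonglongrightarrow> 0"
proof -
  note [measurable] = \<xi>_measurable[OF order_refl] \<xi>_measurable[OF order_refl, simplified]
  have "(\<lambda>n. expectation (\<lambda>\<omega>. min ((\<xi> 1 \<omega>)\<^sup>2) (inverse (real (Suc n)) * \<bar>\<xi> 1 \<omega>\<bar> ^ 3 / 6))) \<longlonglongrightarrow> expectation (\<lambda>\<omega>. min ((\<xi> 1 \<omega>)\<^sup>2) (0 * \<bar>\<xi> 1 \<omega>\<bar> ^ 3 / 6))"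
  proof (rule integral_dominated_convergence[where w="\<lambda>\<omega>. (\<xi> 1 \<omega>)\<^sup>2"])
    show "AE \<omega> in M. (\<lambda>n. min ((\<xi> 1 \<omega>)\<^sup>2) (inverse (real (Suc n)) * \<bar>\<xi> 1 \<omega>\<bar> ^ 3 / 6)) \<longlonglongrightarrow> min ((\<xi> 1 \<omega>)\<^sup>2) (0 * \<bar>\<xi> 1 \<omega>\<bar> ^ 3 / 6)"
      by (intro AE_I2 tendsto_intros LIMSEQ_inverse_real_of_nat) auto
  qed (use \<xi>_sq_integrable in \<open>auto simp: min_def\<close>)
  moreover have "min ((\<xi> 1 \<omega>)\<^sup>2) (0 * \<bar>\<xi> 1 \<omega>\<bar> ^ 3 / 6) = 0" for \<omega> by simp
  ultimately show ?thesis by (simp only: \<kappa>_def Bochner_Integration.integral_zero)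
qed

lemma exp_minus_quadratic:
  fixes x :: real assumes x: "x \<ge> 0"
  shows "\<bar>exp (-x) - (1 - x)\<bar> \<le> x\<^sup>2"
proof -
  have 1: "1 - x \<le> exp (-x)" using exp_ge_add_one_self[of "-x"] by simp
  have "exp (-x) \<le> inverse (1 + x)"
    using exp_ge_add_one_self[of x] x by (simp add: exp_minus)
  also have "inverse (1 + x) \<le> 1 - x + x\<^sup>2"
  proof -
    have "(1 - x + x\<^sup>2) * (1 + x) = 1 + x ^ 3" by (simp add: algebra_simps power2_eq_square power3_eq_cube)
    then have "1 \<le> (1 - x + x\<^sup>2) * (1 + x)" using x by simp
    then show ?thesis using x by (simp add: field_simps)
  qed
  finally show ?thesis using 1 by linarith
qed

text \<open>Both characteristic functions contain the factor \<open>G\<close>, with \<open>a (Suc n)\<close> in front of \<open>U n\<close>. Then the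
  first order terms in \<open>u\<close> agree because the conditional mean of \<open>Y (Suc n)\<close> is \<open>q * U n\<close>.\<close>

lemma cf_step:
  fixes \<theta> w :: real
  assumes n: "n \<ge> 1" and w: "w > 0"
  defines "u \<equiv> \<theta> * b (Suc n) / w" and "q \<equiv> p / \<nu> n"
  shows "cmod (expectation (\<lambda>\<omega>. iexp (\<theta> * (a (Suc n) * U (\<lambda>x. x) (Suc n) \<omega>) / w))
      - of_real (exp (-(u\<^sup>2/2))) * expectation (\<lambda>\<omega>. iexp (\<theta> * (a n * U (\<lambda>x. x) n \<omega>) / w)))
    \<le> u\<^sup>2 * (\<kappa> \<bar>u\<bar> + \<bar>u\<bar> * (q * expectation (\<lambda>\<omega>. \<bar>U (\<lambda>x. x) n \<omega>\<bar>)) / 2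
       + expectation (\<lambda>\<omega>. \<bar>V n \<omega> / \<nu> n - 1\<bar>) / 2 + q\<^sup>2 * expectation (\<lambda>\<omega>. (U (\<lambda>x. x) n \<omega>)\<^sup>2) / 2 + u\<^sup>2 / 4)"
proof -
  define T where "T = U (\<lambda>x. x) n"
  define Z where "Z = Y (Suc n)"
  define G where "G \<omega> = iexp (\<theta> * (a (Suc n) * T \<omega>) / w)" for \<omega>
  have q: "q \<ge> 0" using p_nonneg \<nu>_pos[OF n] by (simp add: q_def)
  have T_past[measurable]: "T \<in> borel_measurable (past n)" unfolding T_def by (rule U_past[OF centered_id order_refl])
  have T_l2: "l2 T" unfolding T_def by (rule U_l2[OF centered_id])
  note [measurable] = l2_measurable[OF T_l2]
  have Z_meas[measurable]: "Z \<in> borel_measurable M" unfolding Z_def by measurable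
  have Z_l2: "l2 Z" unfolding Z_def using hY_l2(1)[OF centered_id, of "Suc n"] by simp
  have G_past: "G \<in> borel_measurable (past n)" unfolding G_def[abs_def] by measurable
  have [measurable]: "G \<in> borel_measurable M" by (rule past_imp_measurable[OF G_past])
  have nG: "norm (G \<omega>) = 1" for \<omega> by (simp add: G_def)
  have int_G: "integrable M (\<lambda>\<omega>. G \<omega> * r \<omega>)" if r: "integrable M r" for r :: "'a \<Rightarrow> complex"
  proof (rule Bochner_Integration.integrable_bound[OF r])
    note [measurable] = borel_measurable_integrable[OF r]
    show "(\<lambda>\<omega>. G \<omega> * r \<omega>) \<in> borel_measurable M" by measurable
  qed (simp add: norm_mult nG)
  have norm_G: "cmod (expectation (\<lambda>\<omega>. G \<omega> * r \<omega>)) \<le> expectation (\<lambda>\<omega>. s \<omega>)"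
    if "integrable M r" "integrable M s" "\<And>\<omega>. cmod (r \<omega>) \<le> s \<omega>" for r :: "'a \<Rightarrow> complex" and s
  proof -
    have "cmod (expectation (\<lambda>\<omega>. G \<omega> * r \<omega>)) \<le> expectation (\<lambda>\<omega>. cmod (G \<omega> * r \<omega>))"
      by (rule integral_norm_bound)
    also have "\<dots> \<le> expectation (\<lambda>\<omega>. s \<omega>)"
      using that int_G[OF that(1)] by (intro integral_mono) (auto simp: norm_mult nG)
    finally show ?thesis .
  qed
  have iexp_int: "integrable M (\<lambda>\<omega>. iexp (f \<omega>))" if [measurable]: "f \<in> borel_measurable M" for f
    by (intro integrable_const_bound[of _ 1]) auto
  have int_one: "integrable M G" using int_G[of "\<lambda>_. 1"] by simp

  have f1: "iexp (\<theta> * (a (Suc n) * U (\<lambda>x. x) (Suc n) \<omega>) / w) = G \<omega> * iexp (u * Z \<omega>)" for \<omega>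
    unfolding G_def exp_add[symmetric] using w
    by (simp add: U_Suc T_def Z_def u_def b_def field_simps)
  have f0: "iexp (\<theta> * (a n * U (\<lambda>x. x) n \<omega>) / w) = G \<omega> * iexp (u * q * T \<omega>)" for \<omega>
  proof -
    have "a n = a (Suc n) * (1 + p * (\<mu> (Suc n) / \<nu> n))" using growth_pos[of n] by (simp add: a_Suc[OF n])
    then have "\<theta> * (a n * T \<omega>) / w = \<theta> * (a (Suc n) * T \<omega>) / w + u * q * T \<omega>"
      using w \<nu>_pos[OF n] by (simp add: u_def q_def b_def field_simps)
    then show ?thesis unfolding G_def T_def[symmetric] exp_add[symmetric] by (simp add: distrib_left)
  qed
  \<comment> \<open>\<open>Z\<close> is of order one and is expanded to second order;
    \<open>q * T\<close> becomes small in mean square, so first order is enough for it.\<close>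
  define R1 where "R1 \<omega> = iexp (u * Z \<omega>) - (1 + \<i> * of_real (u * Z \<omega>) - of_real ((u * Z \<omega>)\<^sup>2 / 2))" for \<omega>
  define R2 where "R2 \<omega> = iexp (u * q * T \<omega>) - (1 + \<i> * of_real (u * q * T \<omega>))" for \<omega>
  have R1_bound: "cmod (R1 \<omega>) \<le> u\<^sup>2 * min ((Z \<omega>)\<^sup>2) (\<bar>u\<bar> * \<bar>Z \<omega>\<bar> ^ 3 / 6)" for \<omega>
  proof -
    have s: "(\<Sum>k\<le>2. (\<i> * of_real x) ^ k / fact k) = 1 + \<i> * of_real x - of_real (x\<^sup>2 / 2)" for x
      by (simp add: numeral_2_eq_2 power_mult_distrib)
    have "cmod (R1 \<omega>) \<le> \<bar>u * Z \<omega>\<bar> ^ Suc 2 / fact (Suc 2)"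
      using iexp_approx1[of "u * Z \<omega>" 2] unfolding s R1_def .
    also have "\<dots> = u\<^sup>2 * (\<bar>u\<bar> * \<bar>Z \<omega>\<bar> ^ 3 / 6)"
    proof -
      have "(x * y) ^ Suc 2 / fact (Suc 2) = x\<^sup>2 * (x * y ^ 3 / 6)" for x y :: real
        by (simp add: fact_numeral power_mult_distrib power2_eq_square power3_eq_cube)
      from this[of "\<bar>u\<bar>" "\<bar>Z \<omega>\<bar>"] show ?thesis unfolding abs_mult power2_abs .
    qed
    finally have 1: "cmod (R1 \<omega>) \<le> u\<^sup>2 * (\<bar>u\<bar> * \<bar>Z \<omega>\<bar> ^ 3 / 6)" .
    have "cmod (R1 \<omega>) \<le> 2 * \<bar>u * Z \<omega>\<bar> ^ 2 / fact 2"
      using iexp_approx2[of "u * Z \<omega>" 2] unfolding s R1_def .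
    also have "\<dots> = u\<^sup>2 * (Z \<omega>)\<^sup>2" by (simp add: power_mult_distrib)
    finally show ?thesis using 1 by (simp add: min_def)
  qed
  have R2_bound: "cmod (R2 \<omega>) \<le> u\<^sup>2 * q\<^sup>2 / 2 * (T \<omega>)\<^sup>2" for \<omega>
  proof -
    have s: "(\<Sum>k\<le>1. (\<i> * of_real x) ^ k / fact k) = 1 + \<i> * of_real x" for x
      by simp
    have "cmod (R2 \<omega>) \<le> \<bar>u * q * T \<omega>\<bar> ^ Suc 1 / fact (Suc 1)"
      using iexp_approx1[of "u * q * T \<omega>" 1] unfolding s R2_def .
    also have "\<dots> = u\<^sup>2 * q\<^sup>2 / 2 * (T \<omega>)\<^sup>2" by (simp add: power_mult_distrib power2_eq_square[symmetric])
    finally show ?thesis .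
  qed
  have \<kappa>Z: "integrable M (\<lambda>\<omega>. min ((Z \<omega>)\<^sup>2) (\<bar>u\<bar> * \<bar>Z \<omega>\<bar> ^ 3 / 6))"
     "expectation (\<lambda>\<omega>. min ((Z \<omega>)\<^sup>2) (\<bar>u\<bar> * \<bar>Z \<omega>\<bar> ^ 3 / 6)) = \<kappa> \<bar>u\<bar>"
  proof -
    have "(\<lambda>x::real. min (x\<^sup>2) (\<bar>u\<bar> * \<bar>x\<bar> ^ 3 / 6)) \<in> borel_measurable borel" by measurable
    from Y_law[OF this \<kappa>_integrand, of "Suc n"]
    show "integrable M (\<lambda>\<omega>. min ((Z \<omega>)\<^sup>2) (\<bar>u\<bar> * \<bar>Z \<omega>\<bar> ^ 3 / 6))"
     "expectation (\<lambda>\<omega>. min ((Z \<omega>)\<^sup>2) (\<bar>u\<bar> * \<bar>Z \<omega>\<bar> ^ 3 / 6)) = \<kappa> \<bar>u\<bar>"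
      by (auto simp: Z_def \<kappa>_def)
  qed
  have iZ: "integrable M Z" "integrable M (\<lambda>\<omega>. (Z \<omega>)\<^sup>2)" and iT: "integrable M T" "integrable M (\<lambda>\<omega>. (T \<omega>)\<^sup>2)"
    using l2_integrable l2_square Z_l2 T_l2 by auto
  have "integrable M (\<lambda>\<omega>. u * Z \<omega>)" "integrable M (\<lambda>\<omega>. (u * Z \<omega>)\<^sup>2 / 2)" "integrable M (\<lambda>\<omega>. u * q * T \<omega>)"
    using iZ iT by (auto simp: power_mult_distrib)
  note i = this[THEN integrable_of_real]
  have iR1: "integrable M R1" unfolding R1_def
    by (intro Bochner_Integration.integrable_diff Bochner_Integration.integrable_add iexp_int integrable_mult_right i) auto
  have iR2: "integrable M R2" unfolding R2_def
    by (intro Bochner_Integration.integrable_diff Bochner_Integration.integrable_add iexp_int integrable_mult_right i) auto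

  define F1 where "F1 = expectation G"
  define FT where "FT = expectation (\<lambda>\<omega>. G \<omega> * of_real (T \<omega>))"
  define F2 where "F2 = expectation (\<lambda>\<omega>. G \<omega> * of_real (Z \<omega>))"
  define F3 where "F3 = expectation (\<lambda>\<omega>. G \<omega> * of_real ((Z \<omega>)\<^sup>2))"
  define f where "f = expectation (\<lambda>\<omega>. G \<omega> * iexp (u * q * T \<omega>))"
  define f' where "f' = expectation (\<lambda>\<omega>. G \<omega> * iexp (u * Z \<omega>))"
  have iYk: "integrable M (\<lambda>\<omega>. G \<omega> * of_real (Y k \<omega>))" "integrable M (\<lambda>\<omega>. G \<omega> * of_real ((Y k \<omega>)\<^sup>2))" if "k \<in> {1..n}" for k
    using that l2_integrable[OF hY_l2(1)[OF centered_id, of k]] Y_square_integrable[of k]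
    by (intro int_G integrable_of_real; simp)+
  have F2: "F2 = of_real q * FT"
  proof -
    have "F2 = (\<Sum>k=1..n. expectation (\<lambda>\<omega>. G \<omega> * of_real (Y k \<omega>)) * of_real (p * \<mu> k / \<nu> n)) + F1 * of_real ((1 - p) * expectation (\<lambda>\<omega>. \<xi> 1 \<omega>))"
      unfolding F2_def Z_def F1_def
      by (rule step_expectation(2)[where h="\<lambda>x. x", OF n G_past _ int_one _ iYk(1)]) (use \<xi>_integrable in auto)
    also have "\<dots> = (\<Sum>k=1..n. of_real (q * \<mu> k) * expectation (\<lambda>\<omega>. G \<omega> * of_real (Y k \<omega>)))"
      by (simp add: \<xi>_mean[simplified] q_def mult_ac)
    also have "\<dots> = (\<Sum>k=1..n. expectation (\<lambda>\<omega>. of_real (q * \<mu> k) * (G \<omega> * of_real (Y k \<omega>))))"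
      by (simp only: integral_mult_right_zero)
    also have "\<dots> = expectation (\<lambda>\<omega>. \<Sum>k=1..n. of_real (q * \<mu> k) * (G \<omega> * of_real (Y k \<omega>)))"
      using iYk(1) by (intro Bochner_Integration.integral_sum[symmetric] integrable_mult_right) auto
    also have "\<dots> = expectation (\<lambda>\<omega>. of_real q * (G \<omega> * of_real (T \<omega>)))"
      by (intro Bochner_Integration.integral_cong) (auto simp: T_def U_def sum_distrib_left mult_ac)
    finally show ?thesis by (simp add: FT_def)
  qed
  \<comment> \<open>The past contributes the weighted average of its squares with weight
    \<open>p\<close>, the innovation contributes 1 with weight \<open>1 - p\<close>.\<close>
  have F3: "F3 = of_real q * expectation (\<lambda>\<omega>. G \<omega> * of_real (V n \<omega>)) + F1 * of_real (1 - p)"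
  proof -
    have "F3 = (\<Sum>k=1..n. expectation (\<lambda>\<omega>. G \<omega> * of_real ((Y k \<omega>)\<^sup>2)) * of_real (p * \<mu> k / \<nu> n)) + F1 * of_real ((1 - p) * expectation (\<lambda>\<omega>. (\<xi> 1 \<omega>)\<^sup>2))"
      unfolding F3_def Z_def F1_def
      by (rule step_expectation(2)[where h="\<lambda>x. x\<^sup>2", OF n G_past _ int_one _ iYk(2)]) (use \<xi>_sq_integrable in auto)
    also have "(\<Sum>k=1..n. expectation (\<lambda>\<omega>. G \<omega> * of_real ((Y k \<omega>)\<^sup>2)) * of_real (p * \<mu> k / \<nu> n)) = (\<Sum>k=1..n. of_real (q * \<mu> k) * expectation (\<lambda>\<omega>. G \<omega> * of_real ((Y k \<omega>)\<^sup>2)))"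
      by (simp add: q_def mult_ac)
    also have "\<dots> = (\<Sum>k=1..n. expectation (\<lambda>\<omega>. of_real (q * \<mu> k) * (G \<omega> * of_real ((Y k \<omega>)\<^sup>2))))"
      by (simp only: integral_mult_right_zero)
    also have "\<dots> = expectation (\<lambda>\<omega>. \<Sum>k=1..n. of_real (q * \<mu> k) * (G \<omega> * of_real ((Y k \<omega>)\<^sup>2)))"
      using iYk(2) by (intro Bochner_Integration.integral_sum[symmetric] integrable_mult_right) auto
    also have "\<dots> = expectation (\<lambda>\<omega>. of_real q * (G \<omega> * of_real (V n \<omega>)))"
      by (intro Bochner_Integration.integral_cong) (auto simp: V_def sum_distrib_left mult_ac)
    finally show ?thesis by (simp add: \<xi>_sq[simplified])
  qed
  have iV: "integrable M (\<lambda>\<omega>. of_real (V n \<omega>) :: complex)" using V_integrable[of n] by simp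
  have L1: "f' = F1 + \<i> * of_real u * F2 - of_real (u\<^sup>2 / 2) * F3 + expectation (\<lambda>\<omega>. G \<omega> * R1 \<omega>)"
  proof -
    have "f' = expectation (\<lambda>\<omega>. G \<omega> + (\<i> * of_real u) * (G \<omega> * of_real (Z \<omega>)) - of_real (u\<^sup>2 / 2) * (G \<omega> * of_real ((Z \<omega>)\<^sup>2)) + G \<omega> * R1 \<omega>)"
      unfolding f'_def
      by (intro Bochner_Integration.integral_cong) (auto simp: R1_def algebra_simps power_mult_distrib)
    also have "\<dots> = F1 + \<i> * of_real u * F2 - of_real (u\<^sup>2 / 2) * F3 + expectation (\<lambda>\<omega>. G \<omega> * R1 \<omega>)"
    proof -
      have 1: "integrable M (\<lambda>\<omega>. (\<i> * of_real u) * (G \<omega> * of_real (Z \<omega>)))"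
        "integrable M (\<lambda>\<omega>. of_real (u\<^sup>2 / 2) * (G \<omega> * of_real ((Z \<omega>)\<^sup>2)))" "integrable M (\<lambda>\<omega>. G \<omega> * R1 \<omega>)"
        by (rule integrable_mult_right[OF int_G[OF integrable_of_real[OF iZ(1)]]],
            rule integrable_mult_right[OF int_G[OF integrable_of_real[OF iZ(2)]]], rule int_G[OF iR1])
      show ?thesis
        unfolding Bochner_Integration.integral_add[OF Bochner_Integration.integrable_diff[OF Bochner_Integration.integrable_add[OF int_one 1(1)] 1(2)] 1(3)]
          Bochner_Integration.integral_diff[OF Bochner_Integration.integrable_add[OF int_one 1(1)] 1(2)]
          Bochner_Integration.integral_add[OF int_one 1(1)] integral_mult_right_zero F1_def F2_def F3_def ..
    qed
    finally show ?thesis .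
  qed
  have L2: "f = F1 + \<i> * of_real u * F2 + expectation (\<lambda>\<omega>. G \<omega> * R2 \<omega>)"
  proof -
    have "f = expectation (\<lambda>\<omega>. G \<omega> + (\<i> * of_real u * of_real q) * (G \<omega> * of_real (T \<omega>)) + G \<omega> * R2 \<omega>)"
      unfolding f_def
      by (intro Bochner_Integration.integral_cong) (auto simp: R2_def algebra_simps)
    also have "\<dots> = F1 + (\<i> * of_real u * of_real q) * FT + expectation (\<lambda>\<omega>. G \<omega> * R2 \<omega>)"
    proof -
      have 1: "integrable M (\<lambda>\<omega>. (\<i> * of_real u * of_real q) * (G \<omega> * of_real (T \<omega>)))" "integrable M (\<lambda>\<omega>. G \<omega> * R2 \<omega>)"
        by (rule integrable_mult_right[OF int_G[OF integrable_of_real[OF iT(1)]]], rule int_G[OF iR2])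
      show ?thesis
        unfolding Bochner_Integration.integral_add[OF Bochner_Integration.integrable_add[OF int_one 1(1)] 1(2)]
          Bochner_Integration.integral_add[OF int_one 1(1)] integral_mult_right_zero F1_def FT_def ..
    qed
    finally show ?thesis by (simp add: F2 mult_ac)
  qed
  define E1 where "E1 = expectation (\<lambda>\<omega>. G \<omega> * R1 \<omega>)"
  define E2 where "E2 = expectation (\<lambda>\<omega>. G \<omega> * R2 \<omega>)"
  have B1: "cmod E1 \<le> u\<^sup>2 * \<kappa> \<bar>u\<bar>"
    using norm_G[OF iR1 _ R1_bound] \<kappa>Z unfolding E1_def by simp
  have B2: "cmod E2 \<le> u\<^sup>2 * q\<^sup>2 / 2 * expectation (\<lambda>\<omega>. (T \<omega>)\<^sup>2)"
    using norm_G[OF iR2 _ R2_bound] iT unfolding E2_def by simp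
  \<comment> \<open>The second order term is a multiple of \<open>F1\<close>, while the recursion
    asks for the same multiple of \<open>f\<close>; their integrands differ only by a phase that is
    small with \<open>u * q * T \<omega>\<close>.\<close>
  have B3: "cmod (F1 - f) \<le> \<bar>u\<bar> * (q * expectation (\<lambda>\<omega>. \<bar>T \<omega>\<bar>))"
  proof -
    have i: "integrable M (\<lambda>\<omega>. 1 - iexp (u * q * T \<omega>))" by (intro Bochner_Integration.integrable_diff iexp_int) auto
    have "F1 - f = expectation (\<lambda>\<omega>. G \<omega> * (1 - iexp (u * q * T \<omega>)))"
      unfolding F1_def f_def right_diff_distrib mult_1_right
      by (rule Bochner_Integration.integral_diff[symmetric, OF int_one int_G[OF iexp_int]]) measurable
    also have "cmod \<dots> \<le> expectation (\<lambda>\<omega>. \<bar>u\<bar> * q * \<bar>T \<omega>\<bar>)"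
    proof (rule norm_G[OF i])
      show "cmod (1 - iexp (u * q * T \<omega>)) \<le> \<bar>u\<bar> * q * \<bar>T \<omega>\<bar>" for \<omega>
        using iexp_approx1[of "u * q * T \<omega>" 0] q by (simp add: norm_minus_commute abs_mult)
    qed (use iT in auto)
    finally show ?thesis by (simp add: mult.assoc)
  qed
  have B4: "cmod (F3 - F1) \<le> expectation (\<lambda>\<omega>. \<bar>V n \<omega> / \<nu> n - 1\<bar>)"
  proof -
    have "F3 - F1 = of_real p * (of_real (1 / \<nu> n) * expectation (\<lambda>\<omega>. G \<omega> * of_real (V n \<omega>)) - F1)"
      unfolding F3 by (simp add: q_def algebra_simps)
    also have "of_real (1 / \<nu> n) * expectation (\<lambda>\<omega>. G \<omega> * of_real (V n \<omega>)) - F1 = expectation (\<lambda>\<omega>. of_real (1 / \<nu> n) * (G \<omega> * of_real (V n \<omega>)) - G \<omega>)"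
      unfolding F1_def integral_mult_right_zero[symmetric]
      by (rule Bochner_Integration.integral_diff[symmetric, OF integrable_mult_right[OF int_G[OF iV]] int_one])
    also have "\<dots> = expectation (\<lambda>\<omega>. G \<omega> * of_real (V n \<omega> / \<nu> n - 1))"
      by (intro Bochner_Integration.integral_cong) (auto simp: algebra_simps)
    also have "cmod (of_real p * expectation (\<lambda>\<omega>. G \<omega> * of_real (V n \<omega> / \<nu> n - 1))) \<le> 1 * expectation (\<lambda>\<omega>. \<bar>V n \<omega> / \<nu> n - 1\<bar>)"
      unfolding norm_mult
    proof (intro mult_mono norm_G)
      have iv: "integrable M (\<lambda>\<omega>. V n \<omega> / \<nu> n - 1)" using V_integrable[of n] by auto
      show "integrable M (\<lambda>\<omega>. of_real (V n \<omega> / \<nu> n - 1) :: complex)" by (rule integrable_of_real[OF iv])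
      show "integrable M (\<lambda>\<omega>. \<bar>V n \<omega> / \<nu> n - 1\<bar>)" using iv by (rule integrable_abs)
      show "cmod (of_real (V n \<omega> / \<nu> n - 1)) \<le> \<bar>V n \<omega> / \<nu> n - 1\<bar>" for \<omega> by (simp only: norm_of_real)
    qed (use p_range in auto)
    finally show ?thesis by simp
  qed
  have nf: "cmod f \<le> 1"
    using norm_G[of "\<lambda>\<omega>. iexp (u * q * T \<omega>)" "\<lambda>_. 1"] iexp_int[of "\<lambda>\<omega>. u * q * T \<omega>"] unfolding f_def by (simp add: prob_space)
  have alg: "(F1 + A - k * F3 + E1) - x * (F1 + A + E2)
      = - k * (F3 - F1) - k * (F1 - (F1 + A + E2)) + E1 - E2 - (x - (1 - k)) * (F1 + A + E2)" for A k x
    by (simp add: algebra_simps)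
  \<comment> \<open>With the first order terms cancelled, what remains is the error in the
    conditional second moment, the exchange of \<open>F1\<close> for \<open>f\<close>, the two
    Taylor remainders, and \<open>exp (-(u\<^sup>2/2))\<close> against its linearisation.\<close>
  have "f' - of_real (exp (-(u\<^sup>2/2))) * f =
     - of_real (u\<^sup>2 / 2) * (F3 - F1) - of_real (u\<^sup>2 / 2) * (F1 - f) + E1 - E2 - of_real (exp (-(u\<^sup>2/2)) - (1 - u\<^sup>2/2)) * f"
    unfolding L1 L2 E1_def[symmetric] E2_def[symmetric] of_real_diff of_real_1 by (rule alg)
  also have "cmod \<dots> \<le> cmod (of_real (u\<^sup>2 / 2) * (F3 - F1)) + cmod (of_real (u\<^sup>2 / 2) * (F1 - f)) + cmod E1 + cmod E2
      + cmod (of_real (exp (-(u\<^sup>2/2)) - (1 - u\<^sup>2/2)) * f)"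
    by (smt (verit) norm_triangle_ineq norm_triangle_ineq4 norm_minus_cancel mult_minus_left)
  also have "\<dots> \<le> u\<^sup>2 / 2 * expectation (\<lambda>\<omega>. \<bar>V n \<omega> / \<nu> n - 1\<bar>) + u\<^sup>2 / 2 * (\<bar>u\<bar> * (q * expectation (\<lambda>\<omega>. \<bar>T \<omega>\<bar>)))
      + u\<^sup>2 * \<kappa> \<bar>u\<bar> + u\<^sup>2 * q\<^sup>2 / 2 * expectation (\<lambda>\<omega>. (T \<omega>)\<^sup>2) + (u\<^sup>2 / 2)\<^sup>2"
  proof (intro add_mono B1 B2)
    show "cmod (of_real (u\<^sup>2 / 2) * (F3 - F1)) \<le> u\<^sup>2 / 2 * expectation (\<lambda>\<omega>. \<bar>V n \<omega> / \<nu> n - 1\<bar>)"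
      unfolding norm_mult norm_of_real using B4 by (intro mult_mono) auto
    show "cmod (of_real (u\<^sup>2 / 2) * (F1 - f)) \<le> u\<^sup>2 / 2 * (\<bar>u\<bar> * (q * expectation (\<lambda>\<omega>. \<bar>T \<omega>\<bar>)))"
      unfolding norm_mult norm_of_real using B3 by (intro mult_mono) auto
    have "cmod (of_real (exp (-(u\<^sup>2/2)) - (1 - u\<^sup>2/2)) * f) \<le> (u\<^sup>2 / 2)\<^sup>2 * 1"
      unfolding norm_mult norm_of_real using exp_minus_quadratic[of "u\<^sup>2/2"] nf by (intro mult_mono) auto
    then show "cmod (of_real (exp (-(u\<^sup>2/2)) - (1 - u\<^sup>2/2)) * f) \<le> (u\<^sup>2 / 2)\<^sup>2" by simp
  qed
  also have "\<dots> = u\<^sup>2 * (\<kappa> \<bar>u\<bar> + \<bar>u\<bar> * (q * expectation (\<lambda>\<omega>. \<bar>T \<omega>\<bar>)) / 2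
       + expectation (\<lambda>\<omega>. \<bar>V n \<omega> / \<nu> n - 1\<bar>) / 2 + q\<^sup>2 * expectation (\<lambda>\<omega>. (T \<omega>)\<^sup>2) / 2 + u\<^sup>2 / 4)"
    by (simp add: field_simps power2_eq_square)
  finally show ?thesis unfolding f1 f0 f'_def f_def T_def .
qed

end

section \<open>Negligible jumps and the limit of the characteristic functions\<close>

context critical_srrw
begin

text \<open>Uniform negligibility of the jumps. For late \<open>k\<close> the bound holds already
  with \<open>v2 k\<close> and \<open>v2\<close> is monotone; the finitely many early ones are
  dwarfed because \<open>v2\<close> diverges.\<close>

lemma max_b_tendsto_0:
  assumes e: "e > 0"
  shows "eventually (\<lambda>n. \<forall>k\<in>{1..n}. (b k)\<^sup>2 \<le> e * v2 n) sequentially"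
proof -
  obtain K where K: "\<And>k. k \<ge> K \<Longrightarrow> (b k)\<^sup>2 / v2 k < e"
    using order_tendstoD(2)[OF b_v2 e] by (auto simp: eventually_sequentially)
  have "eventually (\<lambda>n. \<forall>k\<in>{..<K}. (b k)\<^sup>2 / e \<le> v2 n) sequentially"
    using v2_at_top by (intro eventually_ball_finite) (auto simp: filterlim_at_top)
  then show ?thesis
  proof eventually_elim
    case (elim n)
    show ?case
    proof
      fix k assume k: "k \<in> {1..n}"
      show "(b k)\<^sup>2 \<le> e * v2 n"
      proof (cases "k < K")
        case True
        then have "(b k)\<^sup>2 / e \<le> v2 n" using elim by auto
        then show ?thesis using e by (simp add: field_simps)
      next
        case False
        then have "(b k)\<^sup>2 \<le> e * v2 k" using K[of k] v2_pos[of k] k by (simp add: field_simps)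
        also have "\<dots> \<le> e * v2 n" using k e v2_mono[of k n] by (intro mult_left_mono) auto
        finally show ?thesis .
      qed
    qed
  qed
qed

definition W :: "nat \<Rightarrow> 'a \<Rightarrow> real" where
  "W n \<omega> = a n * U (\<lambda>x. x) n \<omega> / sqrt (v2 n)"

lemma W_l2: "l2 (W n)"
  using l2_cmult[OF U_l2[OF centered_id, of n], of "a n / sqrt (v2 n)"] by (simp add: W_def[abs_def])

lemma W_measurable[measurable]: "W n \<in> borel_measurable M"
  by (rule l2_measurable[OF W_l2])

lemma W_abs: assumes n: "n \<ge> 1" shows "expectation (\<lambda>\<omega>. \<bar>W n \<omega>\<bar>) \<le> 1"
proof -
  have "expectation (\<lambda>\<omega>. (W n \<omega>)\<^sup>2) = expectation (\<lambda>\<omega>. (a n * U (\<lambda>x. x) n \<omega>)\<^sup>2) / v2 n"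
    by (simp add: W_def power_divide v2_nonneg)
  also have "\<dots> \<le> 1" using aU_square[OF centered_id n] \<xi>_sq v2_pos[OF n] by simp
  finally show ?thesis using l2_abs_le[OF W_l2[of n]] by (meson order_trans real_sqrt_le_1_iff)
qed

lemma W_tail:
  assumes n: "n \<ge> 1" and l: "l > 0"
  shows "prob {\<omega> \<in> space M. \<bar>W n \<omega>\<bar> \<ge> l} \<le> 1 / l"
proof -
  have "prob {\<omega> \<in> space M. \<bar>W n \<omega>\<bar> \<ge> l} \<le> expectation (\<lambda>\<omega>. \<bar>W n \<omega>\<bar>) / l"
    by (rule integral_Markov_inequality_measure[where A="{}"]) (use l2_integrable[OF W_l2[of n]] l in auto)
  also have "\<dots> \<le> 1 / l" using W_abs[OF n] l by (intro divide_right_mono) auto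
  finally show ?thesis .
qed

text \<open>The part of the error in \<open>cf_step\<close> that does not depend on \<open>u\<close>, once \<open>\<bar>u\<bar>\<close> is bounded by \<open>\<bar>\<theta>\<bar>\<close>.\<close>

definition \<delta> :: "real \<Rightarrow> nat \<Rightarrow> real" where
  "\<delta> \<theta> n = \<bar>\<theta>\<bar> * (p * (expectation (\<lambda>\<omega>. \<bar>U (\<lambda>x. x) n \<omega>\<bar>) / \<nu> n)) / 2
     + expectation (\<lambda>\<omega>. \<bar>V n \<omega> / \<nu> n - 1\<bar>) / 2 + p\<^sup>2 * (expectation (\<lambda>\<omega>. (U (\<lambda>x. x) n \<omega>)\<^sup>2) / (\<nu> n)\<^sup>2) / 2"

lemma \<delta>_tendsto: "\<delta> \<theta> \<longlonglongrightarrow> 0"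
proof -
  have "(\<lambda>n. \<delta> \<theta> n) \<longlonglongrightarrow> \<bar>\<theta>\<bar> * (p * 0) / 2 + 0 / 2 + p\<^sup>2 * 0 / 2"
    unfolding \<delta>_def
    by (intro tendsto_intros mean_abs_U[OF centered_id] mean_square_U[OF centered_id] V_law_of_large_numbers) auto
  then show ?thesis by simp
qed

lemma \<delta>_nonneg: "n \<ge> 1 \<Longrightarrow> \<delta> \<theta> n \<ge> 0"
  unfolding \<delta>_def using p_nonneg \<nu>_pos[of n]
  by (intro add_nonneg_nonneg divide_nonneg_nonneg mult_nonneg_nonneg Bochner_Integration.integral_nonneg) auto

text \<open>The normalisation \<open>v2 n\<close> is held fixed while the recursion runs over the
  times up to \<open>n\<close>. Multiplication by a Gaussian factor does not enlarge earlier errors,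
  so the errors \<open>E n j\<close> simply add up.\<close>

lemma cf_limit: "(\<lambda>n. expectation (\<lambda>\<omega>. iexp (\<theta> * W n \<omega>))) \<longlonglongrightarrow> of_real (exp (-(\<theta>\<^sup>2/2)))"
proof -
  define f where "f n k = expectation (\<lambda>\<omega>. iexp (\<theta> * (a k * U (\<lambda>x. x) k \<omega>) / sqrt (v2 n)))" for n k
  \<comment> \<open>The product of the factors \<open>exp (-((y n j)\<^sup>2/2))\<close> over the
    steps \<open>1 \<le> j < k\<close>; the exponents telescope because the squares of
    \<open>b\<close> sum to \<open>v2\<close>.\<close>
  define g where "g n k = exp (-(\<theta>\<^sup>2 * (v2 k - v2 1) / (2 * v2 n)))" for n k
  define y where "y n k = \<theta> * b (Suc k) / sqrt (v2 n)" for n k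
  define E where "E n k = (y n k)\<^sup>2 * (\<delta> \<theta> k + \<kappa> \<bar>y n k\<bar> + (y n k)\<^sup>2 / 4)" for n k
  have y2: "(y n k)\<^sup>2 = \<theta>\<^sup>2 * (b (Suc k))\<^sup>2 / v2 n" for n k
    by (simp add: y_def power_divide power_mult_distrib v2_nonneg)
  have one_step: "cmod (f n (Suc k) - of_real (exp (-((y n k)\<^sup>2/2))) * f n k) \<le> E n k" if k: "k \<in> {1..<n}" for n k
  proof -
    have k1: "k \<ge> 1" and vn: "v2 n > 0" using k v2_pos[of n] by auto
    have "(b (Suc k))\<^sup>2 \<le> v2 (Suc k)" using v2_nonneg[of k] by (simp add: v2_Suc)
    also have "\<dots> \<le> v2 n" using k by (intro v2_mono) auto
    finally have "\<theta>\<^sup>2 * (b (Suc k))\<^sup>2 \<le> \<theta>\<^sup>2 * v2 n" by (rule mult_left_mono) simp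
    then have "(y n k)\<^sup>2 \<le> \<theta>\<^sup>2" unfolding y2 using vn by (simp add: pos_divide_le_eq)
    then have y_le: "\<bar>y n k\<bar> \<le> \<bar>\<theta>\<bar>" by (simp add: abs_le_square_iff)
    let ?e = "expectation (\<lambda>\<omega>. \<bar>U (\<lambda>x. x) k \<omega>\<bar>)"
    have e0: "0 \<le> p / \<nu> k * ?e" using p_nonneg \<nu>_pos[OF k1]
      by (intro mult_nonneg_nonneg divide_nonneg_nonneg Bochner_Integration.integral_nonneg) auto
    have "cmod (f n (Suc k) - of_real (exp (-((y n k)\<^sup>2/2))) * f n k)
      \<le> (y n k)\<^sup>2 * (\<kappa> \<bar>y n k\<bar> + \<bar>y n k\<bar> * (p / \<nu> k * ?e) / 2 + expectation (\<lambda>\<omega>. \<bar>V k \<omega> / \<nu> k - 1\<bar>) / 2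
         + (p / \<nu> k)\<^sup>2 * expectation (\<lambda>\<omega>. (U (\<lambda>x. x) k \<omega>)\<^sup>2) / 2 + (y n k)\<^sup>2 / 4)"
      unfolding f_def y_def by (rule cf_step[OF k1]) (use vn in simp)
    also have "\<dots> \<le> (y n k)\<^sup>2 * (\<kappa> \<bar>y n k\<bar> + \<bar>\<theta>\<bar> * (p / \<nu> k * ?e) / 2 + expectation (\<lambda>\<omega>. \<bar>V k \<omega> / \<nu> k - 1\<bar>) / 2
         + (p / \<nu> k)\<^sup>2 * expectation (\<lambda>\<omega>. (U (\<lambda>x. x) k \<omega>)\<^sup>2) / 2 + (y n k)\<^sup>2 / 4)"
      using y_le e0 by (intro mult_left_mono add_mono order_refl divide_right_mono mult_right_mono) auto
    also have "\<dots> = E n k" by (simp add: E_def \<delta>_def power_divide)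
    finally show ?thesis .
  qed
  have tele: "cmod (f n k - of_real (g n k) * f n 1) \<le> (\<Sum>j=1..<k. E n j)" if "1 \<le> k" "k \<le> n" for n k
    using that
  proof (induction k rule: dec_induct)
    case base
    then show ?case by (simp add: g_def)
  next
    case (step k)
    have vn: "v2 n > 0" using step by (intro v2_pos) auto
    have "g n (Suc k) = exp (-((y n k)\<^sup>2/2)) * g n k"
      unfolding g_def exp_add[symmetric] y2 using vn by (simp add: v2_Suc field_simps)
    then have "f n (Suc k) - of_real (g n (Suc k)) * f n 1
       = (f n (Suc k) - of_real (exp (-((y n k)\<^sup>2/2))) * f n k) + of_real (exp (-((y n k)\<^sup>2/2))) * (f n k - of_real (g n k) * f n 1)"
      by (simp add: algebra_simps)
    also have "cmod \<dots> \<le> E n k + 1 * (\<Sum>j=1..<k. E n j)"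
    proof (rule norm_triangle_mono)
      show "cmod (f n (Suc k) - of_real (exp (-((y n k)\<^sup>2/2))) * f n k) \<le> E n k" by (rule one_step) (use step in auto)
      show "cmod (of_real (exp (-((y n k)\<^sup>2/2))) * (f n k - of_real (g n k) * f n 1)) \<le> 1 * (\<Sum>j=1..<k. E n j)"
        unfolding norm_mult using step by (intro mult_mono) auto
    qed
    finally show ?case using step by simp
  qed
  have y_sum: "(\<Sum>k=1..<n. (y n k)\<^sup>2) \<le> \<theta>\<^sup>2" if n: "n \<ge> 1" for n
  proof -
    have "(\<Sum>k=1..<n. (y n k)\<^sup>2) = \<theta>\<^sup>2 / v2 n * (\<Sum>k=1..<n. (b (Suc k))\<^sup>2)"
      unfolding y2 by (simp add: sum_distrib_left)
    also have "(\<Sum>k=1..<n. (b (Suc k))\<^sup>2) = (\<Sum>k=Suc 1..<Suc n. (b k)\<^sup>2)" by (rule sum.shift_bounds_Suc_ivl[symmetric])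
    also have "\<theta>\<^sup>2 / v2 n * \<dots> \<le> \<theta>\<^sup>2 / v2 n * v2 n"
      unfolding v2_def[of n] using v2_nonneg[of n]
      by (intro mult_left_mono sum_mono2) (auto simp: v2_def)
    also have "\<dots> = \<theta>\<^sup>2" using v2_pos[OF n] by simp
    finally show ?thesis .
  qed
  have sum_E: "(\<lambda>n. \<Sum>k=1..<n. E n k) \<longlonglongrightarrow> 0"
  proof (rule tendstoI)
    fix e :: real assume e: "e > 0"
    \<comment> \<open>A bound for the sum of all \<open>(y n k)\<^sup>2\<close> that stays positive
      for \<open>\<theta> = 0\<close> and may be divided by.\<close>
    define t where "t = \<theta>\<^sup>2 + 1"
    have t: "t > 0" "\<theta>\<^sup>2 \<le> t" by (auto simp: t_def add_nonneg_pos)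
    obtain j where j: "\<kappa> (inverse (real (Suc j))) < e / (4 * t)"
      using order_tendstoD(2)[OF \<kappa>_tendsto, of "e / (4 * t)"] e t by (auto simp: eventually_sequentially)
    \<comment> \<open>As a bound for \<open>(y n k)\<^sup>2\<close>, the first entry keeps
      \<open>\<bar>y n k\<bar>\<close> where \<open>\<kappa>\<close> is small, and the second
      controls the quartic error.\<close>
    define r where "r = min ((inverse (real (Suc j)))\<^sup>2) (e / (4 * t))"
    have r: "r > 0" using e t by (simp add: r_def)
    have ev1: "eventually (\<lambda>n. \<forall>k\<in>{1..n}. (b k)\<^sup>2 \<le> r / t * v2 n) sequentially"
      using r t by (intro max_b_tendsto_0) auto
    \<comment> \<open>The error \<open>\<delta> \<theta> k\<close> carries the weight of
      \<open>b (Suc k)\<close>, hence the shift by one in the weighted average.\<close>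
    have "(\<lambda>k. \<delta> \<theta> (k - 1)) \<longlonglongrightarrow> 0"
      by (rule LIMSEQ_imp_Suc) (simp add: \<delta>_tendsto)
    from tendsto_mult[OF tendsto_const weighted_b_average_tendsto_0[OF this], of "\<theta>\<^sup>2"]
    have "eventually (\<lambda>n. \<theta>\<^sup>2 * ((\<Sum>k=1..n. (b k)\<^sup>2 * \<delta> \<theta> (k - 1)) / v2 n) < e / 4) sequentially"
      using e by (intro order_tendstoD(2)) auto
    \<comment> \<open>The average also contains the term with \<open>b 1\<close> and
      \<open>\<delta> \<theta> 0\<close>, which belongs to no step. Removing it costs an amount that
      vanishes as \<open>v2\<close> diverges.\<close>
    moreover have "(\<lambda>n. \<theta>\<^sup>2 * (b 1)\<^sup>2 * \<bar>\<delta> \<theta> 0\<bar> / v2 n) \<longlonglongrightarrow> 0"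
      by (rule real_tendsto_divide_at_top[OF tendsto_const v2_at_top])
    then have "eventually (\<lambda>n. \<theta>\<^sup>2 * (b 1)\<^sup>2 * \<bar>\<delta> \<theta> 0\<bar> / v2 n < e / 4) sequentially"
      using e by (intro order_tendstoD(2)) auto
    ultimately show "eventually (\<lambda>n. dist (\<Sum>k=1..<n. E n k) 0 < e) sequentially"
      using ev1 eventually_ge_at_top[of 1]
    proof eventually_elim
      case (elim n)
      have vn: "v2 n > 0" by (rule v2_pos[OF elim(4)])
      have yk: "(y n k)\<^sup>2 \<le> r" if k: "k \<in> {1..<n}" for k
      proof -
        have "(b (Suc k))\<^sup>2 \<le> r / t * v2 n" using elim(3) k by auto
        then have "(b (Suc k))\<^sup>2 / v2 n \<le> r / t" using vn by (simp add: field_simps)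
        then have "t * ((b (Suc k))\<^sup>2 / v2 n) \<le> r" using t by (simp add: field_simps)
        moreover have "\<theta>\<^sup>2 * ((b (Suc k))\<^sup>2 / v2 n) \<le> t * ((b (Suc k))\<^sup>2 / v2 n)"
          using t vn by (intro mult_right_mono) auto
        ultimately show ?thesis unfolding y2 by simp
      qed
      have E_le: "E n k \<le> (y n k)\<^sup>2 * \<delta> \<theta> k + (y n k)\<^sup>2 * (e / (2 * t))" if k: "k \<in> {1..<n}" for k
      proof -
        have "(y n k)\<^sup>2 \<le> (inverse (real (Suc j)))\<^sup>2" using yk[OF k] by (simp add: r_def)
        then have "\<bar>y n k\<bar> \<le> inverse (real (Suc j))" by (simp add: abs_le_square_iff[symmetric] del: of_nat_Suc)
        then have 1: "\<kappa> \<bar>y n k\<bar> \<le> e / (4 * t)" using \<kappa>_mono[of "\<bar>y n k\<bar>" "inverse (real (Suc j))"] j by simp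
        have "(y n k)\<^sup>2 / 4 \<le> (y n k)\<^sup>2" by simp
        also have "\<dots> \<le> e / (4 * t)" using yk[OF k] unfolding r_def by (rule order_trans) simp
        finally have 2: "(y n k)\<^sup>2 / 4 \<le> e / (4 * t)" .
        have "E n k \<le> (y n k)\<^sup>2 * (\<delta> \<theta> k + e / (4 * t) + e / (4 * t))"
          unfolding E_def using 1 2 by (intro mult_left_mono add_mono order_refl) auto
        then show ?thesis by (simp add: distrib_left)
      qed
      have "(\<Sum>k=1..<n. E n k) \<le> (\<Sum>k=1..<n. (y n k)\<^sup>2 * \<delta> \<theta> k) + (\<Sum>k=1..<n. (y n k)\<^sup>2) * (e / (2 * t))"
        unfolding sum_distrib_right sum.distrib[symmetric] by (intro sum_mono E_le)
      also have "(\<Sum>k=1..<n. (y n k)\<^sup>2 * \<delta> \<theta> k) = \<theta>\<^sup>2 / v2 n * (\<Sum>k=1..<n. (b (Suc k))\<^sup>2 * \<delta> \<theta> (Suc k - 1))"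
        unfolding y2 sum_distrib_left by (intro sum.cong) auto
      also have "(\<Sum>k=1..<n. (b (Suc k))\<^sup>2 * \<delta> \<theta> (Suc k - 1)) = (\<Sum>k=Suc 1..<Suc n. (b k)\<^sup>2 * \<delta> \<theta> (k - 1))"
        by (rule sum.shift_bounds_Suc_ivl[symmetric])
      also have "\<dots> = (\<Sum>k=1..n. (b k)\<^sup>2 * \<delta> \<theta> (k - 1)) - (b 1)\<^sup>2 * \<delta> \<theta> 0"
        using sum.atLeast_Suc_atMost[OF elim(4), of "\<lambda>k. (b k)\<^sup>2 * \<delta> \<theta> (k - 1)"] by (simp add: atLeastLessThanSuc_atLeastAtMost)
      also have "\<theta>\<^sup>2 / v2 n * \<dots> \<le> \<theta>\<^sup>2 * ((\<Sum>k=1..n. (b k)\<^sup>2 * \<delta> \<theta> (k - 1)) / v2 n) + \<theta>\<^sup>2 * (b 1)\<^sup>2 * \<bar>\<delta> \<theta> 0\<bar> / v2 n"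
      proof -
        have "- (\<theta>\<^sup>2 * (b 1)\<^sup>2 / v2 n * \<delta> \<theta> 0) \<le> \<theta>\<^sup>2 * (b 1)\<^sup>2 / v2 n * \<bar>\<delta> \<theta> 0\<bar>"
          unfolding minus_mult_right using vn by (intro mult_left_mono) auto
        then show ?thesis by (simp add: right_diff_distrib)
      qed
      also have "(\<Sum>k=1..<n. (y n k)\<^sup>2) * (e / (2 * t)) \<le> t * (e / (2 * t))"
        using y_sum[OF elim(4)] t e by (intro mult_right_mono) auto
      also have "t * (e / (2 * t)) = e / 2" using t by simp
      finally have lt: "(\<Sum>k=1..<n. E n k) < e" using elim(1,2) by linarith
      have "0 \<le> (\<Sum>k=1..<n. E n k)"
        unfolding E_def by (intro sum_nonneg mult_nonneg_nonneg add_nonneg_nonneg \<delta>_nonneg \<kappa>_nonneg) auto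
      with lt show ?case by (simp add: dist_real_def)
    qed
  qed
  have v_inv: "(\<lambda>n. 1 / v2 n) \<longlonglongrightarrow> 0" by (rule real_tendsto_divide_at_top[OF tendsto_const v2_at_top])
  have g_lim: "(\<lambda>n. g n n) \<longlonglongrightarrow> exp (-(\<theta>\<^sup>2/2))"
  proof -
    have "(\<lambda>n. exp (-(\<theta>\<^sup>2 * (1 - v2 1 * (1 / v2 n)) / 2))) \<longlonglongrightarrow> exp (-(\<theta>\<^sup>2 * (1 - v2 1 * 0) / 2))"
      by (intro tendsto_intros v_inv) auto
    moreover have "eventually (\<lambda>n. exp (-(\<theta>\<^sup>2 * (1 - v2 1 * (1 / v2 n)) / 2)) = g n n) sequentially"
      using eventually_ge_at_top[of 1]
    proof eventually_elim
      case (elim n)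
      have "v2 n \<noteq> 0" using v2_pos[OF elim] by simp
      then have "1 - v2 1 * (1 / v2 n) = (v2 n - v2 1) / v2 n" by (simp add: diff_divide_distrib)
      then show ?case unfolding g_def by (simp only: times_divide_eq_right divide_divide_eq_left mult.commute[of "v2 n"])
    qed
    ultimately show ?thesis by (auto dest: Lim_transform_eventually)
  qed
  \<comment> \<open>The telescoping starts at time 1, where the martingale value is independent of
    \<open>n\<close> while the normalisation diverges.\<close>
  have f1_lim: "(\<lambda>n. f n 1) \<longlonglongrightarrow> 1"
  proof (rule LIM_zero_cancel, rule Lim_null_comparison)
    have U1: "integrable M (\<lambda>\<omega>. \<bar>a 1 * U (\<lambda>x. x) 1 \<omega>\<bar>)"
      using l2_integrable[OF l2_cmult[OF U_l2[OF centered_id]]] by auto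
    show "eventually (\<lambda>n. cmod (f n 1 - 1) \<le> \<bar>\<theta>\<bar> * expectation (\<lambda>\<omega>. \<bar>a 1 * U (\<lambda>x. x) 1 \<omega>\<bar>) * sqrt (1 / v2 n)) sequentially"
    proof (rule always_eventually, rule allI)
      fix n
      define F where "F \<omega> = \<theta> * (a 1 * U (\<lambda>x. x) 1 \<omega>) / sqrt (v2 n)" for \<omega>
      have [measurable]: "F \<in> borel_measurable M"
        using l2_measurable[OF l2_cmult[OF U_l2[OF centered_id, of 1], of "\<theta> * a 1 / sqrt (v2 n)"]]
        by (simp add: F_def[abs_def] mult.assoc)
      have i: "integrable M (\<lambda>\<omega>. iexp (F \<omega>))" by (intro integrable_const_bound[of _ 1]) auto
      have "f n 1 - 1 = expectation (\<lambda>\<omega>. iexp (F \<omega>) - 1)"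
        using i by (simp add: f_def F_def prob_space)
      also have "cmod \<dots> \<le> expectation (\<lambda>\<omega>. cmod (iexp (F \<omega>) - 1))" by (rule integral_norm_bound)
      also have "\<dots> \<le> expectation (\<lambda>\<omega>. \<bar>\<theta>\<bar> * sqrt (1 / v2 n) * \<bar>a 1 * U (\<lambda>x. x) 1 \<omega>\<bar>)"
      proof (rule integral_mono)
        fix \<omega>
        have "cmod (iexp (F \<omega>) - 1) \<le> \<bar>F \<omega>\<bar>" using iexp_approx1[of "F \<omega>" 0] by simp
        also have "\<dots> = \<bar>\<theta>\<bar> * sqrt (1 / v2 n) * \<bar>a 1 * U (\<lambda>x. x) 1 \<omega>\<bar>"
          by (simp add: F_def abs_mult real_sqrt_divide v2_nonneg)
        finally show "cmod (iexp (F \<omega>) - 1) \<le> \<bar>\<theta>\<bar> * sqrt (1 / v2 n) * \<bar>a 1 * U (\<lambda>x. x) 1 \<omega>\<bar>" .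
      qed (use i U1 in auto)
      also have "\<dots> = \<bar>\<theta>\<bar> * expectation (\<lambda>\<omega>. \<bar>a 1 * U (\<lambda>x. x) 1 \<omega>\<bar>) * sqrt (1 / v2 n)" by simp
      finally show "cmod (f n 1 - 1) \<le> \<bar>\<theta>\<bar> * expectation (\<lambda>\<omega>. \<bar>a 1 * U (\<lambda>x. x) 1 \<omega>\<bar>) * sqrt (1 / v2 n)" .
    qed
    show "(\<lambda>n. \<bar>\<theta>\<bar> * expectation (\<lambda>\<omega>. \<bar>a 1 * U (\<lambda>x. x) 1 \<omega>\<bar>) * sqrt (1 / v2 n)) \<longlonglongrightarrow> 0"
      using tendsto_mult[OF tendsto_const tendsto_real_sqrt[OF v_inv]] by simp
  qed
  have "(\<lambda>n. f n n - of_real (g n n) * f n 1) \<longlonglongrightarrow> 0"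
  proof (rule Lim_null_comparison[OF _ sum_E])
    show "eventually (\<lambda>n. cmod (f n n - of_real (g n n) * f n 1) \<le> (\<Sum>k=1..<n. E n k)) sequentially"
      using eventually_ge_at_top[of 1] by eventually_elim (rule tele, auto)
  qed
  from tendsto_add[OF this tendsto_mult[OF tendsto_of_real[OF g_lim] f1_lim]]
  have "(\<lambda>n. f n n) \<longlonglongrightarrow> of_real (exp (-(\<theta>\<^sup>2/2)))" by simp
  moreover have "f n n = expectation (\<lambda>\<omega>. iexp (\<theta> * W n \<omega>))" for n
    by (simp add: f_def W_def)
  ultimately show ?thesis by simp
qed

text \<open>Levy's continuity theorem, restated with the bounded continuous test functions that the
  argument for paths uses.\<close>

lemma W_weak_limit:
  fixes g :: "real \<Rightarrow> real"
  assumes g: "continuous_on UNIV g" "bounded (range g)"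
  shows "(\<lambda>n. expectation (\<lambda>\<omega>. g (W n \<omega>))) \<longlonglongrightarrow> integral\<^sup>L std_normal_distribution g"
proof -
  have rd: "real_distribution (distr M borel (W n))" for n by (rule real_distribution_distr) measurable
  have rdN: "real_distribution std_normal_distribution" by (rule real_dist_normal_dist)
  have "weak_conv_m (\<lambda>n. distr M borel (W n)) std_normal_distribution"
  proof (rule levy_continuity[OF rd rdN])
    fix t
    have "char (distr M borel (W n)) t = expectation (\<lambda>\<omega>. iexp (t * W n \<omega>))" for n
      unfolding char_def by (subst integral_distr) auto
    then show "(\<lambda>n. char (distr M borel (W n)) t) \<longlonglongrightarrow> char std_normal_distribution t"
      using cf_limit[of t] by (simp add: char_std_normal_distribution)
  qed
  moreover obtain B where "\<And>x. norm (g x) \<le> B" using g(2) by (auto simp: bounded_iff)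
  moreover have "isCont g x" for x using g(1) by (simp add: continuous_on_eq_continuous_at)
  ultimately have "(\<lambda>n. integral\<^sup>L (distr M borel (W n)) g) \<longlonglongrightarrow> integral\<^sup>L std_normal_distribution g"
    by (intro weak_conv_imp_integral_bdd_continuous_conv[OF rd rdN]) auto
  moreover have "g \<in> borel_measurable borel" using g(1) by (rule borel_measurable_continuous_onI)
  then have "integral\<^sup>L (distr M borel (W n)) g = expectation (\<lambda>\<omega>. g (W n \<omega>))" for n
    by (intro integral_distr) auto
  ultimately show ?thesis by simp
qed


section \<open>The functional limit theorem\<close>

lemma walk_decomposition:
  assumes j: "j \<ge> 1"
  shows "(\<Sum>k=1..j. Y k \<omega>) = Nm j \<omega> + p * (\<Sum>k=1..<j. (a k * U (\<lambda>x. x) k \<omega>) * c k)"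
proof -
  have "p * (\<Sum>k=1..<j. (a k * U (\<lambda>x. x) k \<omega>) * c k) = (\<Sum>k=1..<j. p / \<nu> k * U (\<lambda>x. x) k \<omega>)"
    unfolding sum_distrib_left
  proof (intro sum.cong refl)
    fix k assume "k \<in> {1..<j}"
    then have "U (\<lambda>x. x) k \<omega> / \<nu> k = (a k * U (\<lambda>x. x) k \<omega>) * c k"
      using a_pos[of k] by (simp add: c_def)
    then have "p * ((a k * U (\<lambda>x. x) k \<omega>) * c k) = p * (U (\<lambda>x. x) k \<omega> / \<nu> k)" by (simp only:)
    then show "p * ((a k * U (\<lambda>x. x) k \<omega>) * c k) = p / \<nu> k * U (\<lambda>x. x) k \<omega>" by simp
  qed
  then have "Nm j \<omega> + p * (\<Sum>k=1..<j. (a k * U (\<lambda>x. x) k \<omega>) * c k) = Y 1 \<omega> + (\<Sum>k=1..<j. Y (Suc k) \<omega>)"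
    by (simp add: Nm_def D_def sum.distrib[symmetric])
  also have "(\<Sum>k=1..<j. Y (Suc k) \<omega>) = (\<Sum>k=Suc 1..<Suc j. Y k \<omega>)" by (rule sum.shift_bounds_Suc_ivl[symmetric])
  also have "Y 1 \<omega> + \<dots> = (\<Sum>k=1..j. Y k \<omega>)"
    using sum.atLeast_Suc_atMost[OF j, of "\<lambda>k. Y k \<omega>"] by (simp add: atLeastLessThanSuc_atLeastAtMost)
  finally show ?thesis by simp
qed

text \<open>Three errors of at most \<open>d / 3\<close> each: the martingale part (off
  \<open>A1\<close>), freezing the other martingale at time \<open>n\<close> (off
  \<open>A2\<close>), and the uniform Karamata error multiplied by \<open>W n\<close> (off
  \<open>A3\<close>). Each exceptional event has probability at most \<open>e / 3\<close>
  eventually.\<close>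

lemma walk_near_root_path:
  assumes d: "d > 0" and e: "e > 0"
  shows "\<exists>A. (\<forall>n. A n \<in> events) \<and> eventually (\<lambda>n. prob (A n) \<le> e) sequentially \<and>
    eventually (\<lambda>n. \<forall>\<omega>\<in>space M - A n. \<forall>t. 0 \<le> t \<longrightarrow> t \<le> real m \<longrightarrow>
      \<bar>(\<Sum>k=1..nat \<lfloor>real n * t\<rfloor>. Y k \<omega>) / \<sigma>_seq p \<mu> n - sqrt t * (2 * \<gamma> + 1) * W n \<omega>\<bar> \<le> d) sequentially"
proof -
  define s where "s n = \<sigma>_seq p \<mu> n" for n
  \<comment> \<open>Enlarged by one so that the horizon is positive and contains at least one step
    also for \<open>m = 0\<close>.\<close>
  define T where "T = real m + 1"
  have T: "T > 0" by (simp add: T_def)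
  \<comment> \<open>Markov's inequality bounds the probability that \<open>\<bar>W n\<bar>\<close>
    reaches \<open>d / (3 * r)\<close> by \<open>3 * r / d = e / 3\<close>, and off that event the
    Karamata error is at most \<open>d / 3\<close>.\<close>
  define r where "r = d * e / 9"
  have r: "r > 0" using d e by (simp add: r_def)
  \<comment> \<open>With absolute values and nonnegative weights the sum up to \<open>T\<close>
    dominates the freezing error for all \<open>t \<le> T\<close> at once, so Markov's inequality
    replaces a maximal inequality.\<close>
  define Q where "Q n \<omega> = p * (b n / sqrt (v2 n) * (\<Sum>k=1..<nat \<lfloor>real n * T\<rfloor>. \<bar>a k * U (\<lambda>x. x) k \<omega> - a n * U (\<lambda>x. x) n \<omega>\<bar> * c k))" for n \<omega>
  define A1 where "A1 n = {\<omega> \<in> space M. \<exists>k\<in>{1..nat \<lfloor>real n * T\<rfloor>}. d / 3 * s n \<le> \<bar>Nm k \<omega>\<bar>}" for n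
  define A2 where "A2 n = {\<omega> \<in> space M. d / 3 \<le> Q n \<omega>}" for n
  define A3 where "A3 n = {\<omega> \<in> space M. d / 3 / r \<le> \<bar>W n \<omega>\<bar>}" for n
  have s_eq: "s n = sqrt (v2 n) / b n" for n by (simp add: s_def \<sigma>_seq_def v_seq_eq b_def a_def)
  have diff_l2: "l2 (\<lambda>\<omega>. a k * U (\<lambda>x. x) k \<omega> - a n * U (\<lambda>x. x) n \<omega>)" for k n
    by (intro l2_diff l2_cmult U_l2 centered_id)
  have diff_int: "integrable M (\<lambda>\<omega>. \<bar>a k * U (\<lambda>x. x) k \<omega> - a n * U (\<lambda>x. x) n \<omega>\<bar> * c k)" for k n
    using l2_integrable[OF diff_l2[of k n]] by auto
  have Q_int: "integrable M (Q n)" for n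
    unfolding Q_def by (intro integrable_mult_right Bochner_Integration.integrable_sum diff_int)
  note [measurable] = borel_measurable_integrable[OF Q_int]
  have A_events: "A1 n \<in> events" "A2 n \<in> events" "A3 n \<in> events" for n
  proof -
    have [measurable]: "Nm k \<in> borel_measurable M" for k by (rule l2_measurable[OF Nm_l2])
    show "A1 n \<in> events" "A2 n \<in> events" "A3 n \<in> events" unfolding A1_def A2_def A3_def by measurable
  qed
  have ev1: "eventually (\<lambda>n. prob (A1 n) \<le> e / 3) sequentially"
  proof -
    have "(\<lambda>n. T * 9 / d\<^sup>2 * (real n * (b n)\<^sup>2 / v2 n)) \<longlonglongrightarrow> T * 9 / d\<^sup>2 * 0"
      by (intro tendsto_intros lb_v2)
    then have "eventually (\<lambda>n. T * 9 / d\<^sup>2 * (real n * (b n)\<^sup>2 / v2 n) < e / 3) sequentially"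
      using e by (intro order_tendstoD(2)) auto
    then show ?thesis using eventually_ge_at_top[of 1]
    proof eventually_elim
      case (elim n)
      have sn: "s n > 0" using b_pos[OF elim(2)] v2_pos[OF elim(2)] by (simp add: s_eq)
      have "real n * 1 \<le> real n * T" by (intro mult_left_mono) (auto simp: T_def)
      then have "nat \<lfloor>real n * T\<rfloor> \<ge> 1" using elim(2) by linarith
      then have "prob (A1 n) \<le> real (nat \<lfloor>real n * T\<rfloor>) / (d / 3 * s n)\<^sup>2"
        unfolding A1_def using d sn by (intro Nm_maximal) auto
      also have "\<dots> \<le> real n * T / (d / 3 * s n)\<^sup>2"
        using T by (intro divide_right_mono) (auto simp: of_nat_nat)
      also have "\<dots> = T * 9 / d\<^sup>2 * (real n * (b n)\<^sup>2 / v2 n)"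
        using v2_nonneg[of n] by (simp add: s_eq power_mult_distrib power_divide)
      finally show ?case using elim(1) by linarith
    qed
  qed
  have ev2: "eventually (\<lambda>n. prob (A2 n) \<le> e / 3) sequentially"
  proof -
    have "(\<lambda>n. p * (b n / sqrt (v2 n) * (\<Sum>k=1..<nat \<lfloor>real n * T\<rfloor>. sqrt \<bar>v2 n - v2 k\<bar> * c k)) / (d / 3)) \<longlonglongrightarrow> p * 0 / (d / 3)"
      using d by (intro tendsto_intros v2_c_sum T) auto
    then have "eventually (\<lambda>n. p * (b n / sqrt (v2 n) * (\<Sum>k=1..<nat \<lfloor>real n * T\<rfloor>. sqrt \<bar>v2 n - v2 k\<bar> * c k)) / (d / 3) < e / 3) sequentially"
      using e by (intro order_tendstoD(2)) auto
    then show ?thesis using eventually_ge_at_top[of 1]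
    proof eventually_elim
      case (elim n)
      have bn: "0 \<le> b n / sqrt (v2 n)" using b_pos[OF elim(2)] v2_nonneg[of n] by simp
      have "Q n \<omega> \<ge> 0" for \<omega>
        unfolding Q_def using bn p_nonneg c_nonneg by (intro mult_nonneg_nonneg sum_nonneg) auto
      then have "prob (A2 n) \<le> expectation (Q n) / (d / 3)"
        unfolding A2_def by (intro integral_Markov_inequality_measure[where A="{}"] Q_int) (use d in auto)
      also have "expectation (Q n) = p * (b n / sqrt (v2 n) * (\<Sum>k=1..<nat \<lfloor>real n * T\<rfloor>. expectation (\<lambda>\<omega>. \<bar>a k * U (\<lambda>x. x) k \<omega> - a n * U (\<lambda>x. x) n \<omega>\<bar>) * c k))"
        unfolding Q_def integral_mult_right_zero using diff_int
        by (subst Bochner_Integration.integral_sum) auto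
      also have "\<dots> / (d / 3) \<le> p * (b n / sqrt (v2 n) * (\<Sum>k=1..<nat \<lfloor>real n * T\<rfloor>. sqrt \<bar>v2 n - v2 k\<bar> * c k)) / (d / 3)"
      proof (intro divide_right_mono mult_left_mono sum_mono mult_right_mono)
        fix k assume "k \<in> {1..<nat \<lfloor>real n * T\<rfloor>}"
        then show "expectation (\<lambda>\<omega>. \<bar>a k * U (\<lambda>x. x) k \<omega> - a n * U (\<lambda>x. x) n \<omega>\<bar>) \<le> sqrt \<bar>v2 n - v2 k\<bar>"
          using aU_diff[OF centered_id, of k n] elim(2) \<xi>_sq by simp
      qed (use c_nonneg bn p_nonneg d in auto)
      finally show ?case using elim(1) by linarith
    qed
  qed
  have ev3: "eventually (\<lambda>n. prob (A3 n) \<le> e / 3) sequentially"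
    using eventually_ge_at_top[of 1]
  proof eventually_elim
    case (elim n)
    have "prob (A3 n) \<le> 1 / (d / 3 / r)" unfolding A3_def using d r by (intro W_tail elim) auto
    also have "\<dots> = e / 3" using d by (simp add: r_def)
    finally show ?case .
  qed
  have ev4: "eventually (\<lambda>n. prob (A1 n \<union> A2 n \<union> A3 n) \<le> e) sequentially"
    using ev1 ev2 ev3
  proof eventually_elim
    case (elim n)
    have "prob (A1 n \<union> A2 n \<union> A3 n) \<le> prob (A1 n) + prob (A2 n) + prob (A3 n)"
      using measure_Un_le[of "A1 n \<union> A2 n" M "A3 n"] measure_Un_le[of "A1 n" M "A2 n"] A_events[of n] by auto
    then show ?case using elim by linarith
  qed
  have "eventually (\<lambda>n. \<forall>t\<in>{0..T}. \<bar>b n * (\<Sum>k=1..<nat \<lfloor>real n * t\<rfloor>. c k) - 2 * (\<gamma> + 1) * sqrt t\<bar> \<le> r) sequentially"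
    by (rule b_c_sum_floor_uniform[OF T r])
  then have ev5: "eventually (\<lambda>n. \<forall>\<omega>\<in>space M - (A1 n \<union> A2 n \<union> A3 n). \<forall>t. 0 \<le> t \<longrightarrow> t \<le> real m \<longrightarrow>
      \<bar>(\<Sum>k=1..nat \<lfloor>real n * t\<rfloor>. Y k \<omega>) / s n - sqrt t * (2 * \<gamma> + 1) * W n \<omega>\<bar> \<le> d) sequentially"
    using eventually_ge_at_top[of 1]
  proof eventually_elim
    case (elim n)
    have bn: "b n > 0" "v2 n > 0" using elim(2) by (auto intro: b_pos v2_pos)
    have sn: "s n > 0" using bn by (simp add: s_eq)
    show ?case
    proof (intro ballI allI impI)
      fix \<omega> t assume w: "\<omega> \<in> space M - (A1 n \<union> A2 n \<union> A3 n)" and t: "0 \<le> t" "t \<le> real m"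
      define j where "j = nat \<lfloor>real n * t\<rfloor>"
      define J where "J = nat \<lfloor>real n * T\<rfloor>"
      have jJ: "j \<le> J" unfolding j_def J_def using t by (intro nat_mono floor_mono mult_left_mono) (auto simp: T_def)
      define H where "H k = a k * U (\<lambda>x. x) k \<omega>" for k
      \<comment> \<open>The walk is 0 at index 0, where \<open>Nm\<close> is not.\<close>
      define N0 where "N0 = (if j = 0 then 0 else Nm j \<omega>)"
      have dec: "(\<Sum>k=1..j. Y k \<omega>) = N0 + p * (\<Sum>k=1..<j. H k * c k)"
        using walk_decomposition[of j \<omega>] by (cases "j = 0") (auto simp: N0_def H_def)
      have sum_split: "(\<Sum>k=1..<j. H k * c k) = (\<Sum>k=1..<j. (H k - H n) * c k) + H n * (\<Sum>k=1..<j. c k)"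
        by (simp add: sum_distrib_left sum.distrib[symmetric] left_diff_distrib)
      have Hn: "H n / s n = W n \<omega> * b n" using bn by (simp add: H_def W_def s_eq)
      have inv: "1 / s n = b n / sqrt (v2 n)" by (simp add: s_eq)
      have p2: "p * (2 * (\<gamma> + 1)) = 2 * \<gamma> + 1"
        unfolding mult.left_commute[of p] p_critical by simp
      have "(\<Sum>k=1..j. Y k \<omega>) / s n - sqrt t * (2 * \<gamma> + 1) * W n \<omega>
        = N0 / s n + p * (1 / s n * (\<Sum>k=1..<j. (H k - H n) * c k)) + p * (H n / s n * (\<Sum>k=1..<j. c k)) - sqrt t * (p * (2 * (\<gamma> + 1))) * W n \<omega>"
        unfolding dec sum_split p2 by (simp add: add_divide_distrib distrib_left)
      also have "\<dots> = N0 / s n + p * (b n / sqrt (v2 n) * (\<Sum>k=1..<j. (H k - H n) * c k)) + p * W n \<omega> * (b n * (\<Sum>k=1..<j. c k) - 2 * (\<gamma> + 1) * sqrt t)"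
        unfolding Hn inv by (simp add: algebra_simps)
      finally have eq: "(\<Sum>k=1..j. Y k \<omega>) / s n - sqrt t * (2 * \<gamma> + 1) * W n \<omega> = \<dots>" .
      have b1: "\<bar>N0 / s n\<bar> \<le> d / 3"
      proof (cases "j = 0")
        case False
        then have "\<bar>Nm j \<omega>\<bar> < d / 3 * s n" using w jJ by (auto simp: A1_def J_def not_le)
        then show ?thesis using False sn by (simp add: N0_def field_simps)
      qed (use d in \<open>simp add: N0_def\<close>)
      have "\<bar>p * (b n / sqrt (v2 n) * (\<Sum>k=1..<j. (H k - H n) * c k))\<bar> = p * (b n / sqrt (v2 n) * \<bar>\<Sum>k=1..<j. (H k - H n) * c k\<bar>)"
        using p_nonneg bn by (simp add: abs_mult)
      also have "\<dots> \<le> Q n \<omega>" unfolding Q_def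
      proof (intro mult_left_mono)
        have "\<bar>\<Sum>k=1..<j. (H k - H n) * c k\<bar> \<le> (\<Sum>k=1..<j. \<bar>H k - H n\<bar> * c k)"
          by (rule order_trans[OF sum_abs]) (simp add: abs_mult c_nonneg)
        also have "\<dots> \<le> (\<Sum>k=1..<J. \<bar>H k - H n\<bar> * c k)"
          using jJ c_nonneg by (intro sum_mono2) auto
        finally show "\<bar>\<Sum>k=1..<j. (H k - H n) * c k\<bar> \<le> (\<Sum>k=1..<nat \<lfloor>real n * T\<rfloor>. \<bar>a k * U (\<lambda>x. x) k \<omega> - a n * U (\<lambda>x. x) n \<omega>\<bar> * c k)"
          by (simp add: H_def J_def)
      qed (use p_nonneg bn in auto)
      also have "\<dots> \<le> d / 3" using w by (auto simp: A2_def)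
      finally have b2: "\<bar>p * (b n / sqrt (v2 n) * (\<Sum>k=1..<j. (H k - H n) * c k))\<bar> \<le> d / 3" .
      have "\<bar>p * W n \<omega> * (b n * (\<Sum>k=1..<j. c k) - 2 * (\<gamma> + 1) * sqrt t)\<bar> \<le> 1 * (d / 3 / r) * r"
        unfolding abs_mult
      proof (intro mult_mono)
        show "\<bar>b n * (\<Sum>k=1..<j. c k) - 2 * (\<gamma> + 1) * sqrt t\<bar> \<le> r"
          using elim(1) t unfolding j_def by (auto simp: T_def)
        show "\<bar>W n \<omega>\<bar> \<le> d / 3 / r" using w by (auto simp: A3_def)
      qed (use p_range d r in auto)
      also have "\<dots> = d / 3" using r by simp
      finally have b3: "\<bar>p * W n \<omega> * (b n * (\<Sum>k=1..<j. c k) - 2 * (\<gamma> + 1) * sqrt t)\<bar> \<le> d / 3" .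
      show "\<bar>(\<Sum>k=1..nat \<lfloor>real n * t\<rfloor>. Y k \<omega>) / s n - sqrt t * (2 * \<gamma> + 1) * W n \<omega>\<bar> \<le> d"
      proof -
        have "\<bar>x + y + z\<bar> \<le> d" if "\<bar>x\<bar> \<le> d / 3" "\<bar>y\<bar> \<le> d / 3" "\<bar>z\<bar> \<le> d / 3" for x y z
        proof -
          have "\<bar>x + y + z\<bar> \<le> \<bar>x\<bar> + \<bar>y\<bar> + \<bar>z\<bar>"
            by (rule order_trans[OF abs_triangle_ineq]) (intro add_right_mono abs_triangle_ineq)
          also have "\<dots> \<le> d / 3 + d / 3 + d / 3" by (intro add_mono that)
          finally show ?thesis by simp
        qed
        from this[OF b1 b2 b3] show ?thesis unfolding j_def[symmetric] eq .
      qed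
    qed
  qed
  show ?thesis
    using A_events ev4 ev5 unfolding s_def by (intro exI[of _ "\<lambda>n. A1 n \<union> A2 n \<union> A3 n"]) auto
qed

end

theorem theorem2p17:
  fixes M :: "'a measure" and N :: "'b measure"
    and p \<gamma> :: real and \<mu> :: "nat \<Rightarrow> real"
    and \<xi> :: "nat \<Rightarrow> 'a \<Rightarrow> real" and \<alpha> :: "nat \<Rightarrow> 'a \<Rightarrow> bool" and \<beta> :: "nat \<Rightarrow> 'a \<Rightarrow> nat"
    and X :: "nat \<Rightarrow> 'a \<Rightarrow> real" and Z :: "'b \<Rightarrow> real"
  assumes model: "srrw_rvm M p \<gamma> \<mu> \<xi> \<alpha> \<beta> X"
    and second_moment: "integrable M (\<lambda>\<omega>. (\<xi> 1 \<omega>)\<^sup>2)" "(\<integral>\<omega>. (\<xi> 1 \<omega>)\<^sup>2 \<partial>M) = 1"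
    and critical: "p = critical_p \<gamma>"
    and unbounded: "\<not> bounded (v_seq p \<mu> ` {1..})"
    and Z: "prob_space N" "distributed N lborel Z std_normal_density"
  shows "converges_weakly skorohod_topology
     M (\<lambda>n \<omega>. \<lambda>t\<in>{0..}. walk X (nat \<lfloor>real n * t\<rfloor>) \<omega> / \<sigma>_seq p \<mu> n)
     N (\<lambda>\<omega>. \<lambda>t\<in>{0..}. sqrt t * (2 * \<gamma> + 1) * Z \<omega>)"
proof -
  interpret srrw_rvm M p \<gamma> \<mu> \<xi> \<alpha> \<beta> X by (rule model)
  have pc: "p * (\<gamma> + 1) = \<gamma> + 1/2" using critical \<gamma>_range by (simp add: critical_p_def)
  interpret critical_srrw M p \<gamma> \<mu> \<xi> \<alpha> \<beta> X
    by unfold_locales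
      (use p_range \<gamma>_range \<mu>_pos \<mu>_regularly_varying pc unbounded second_moment in auto)
  \<comment> \<open>The walk built from \<open>Y\<close>, for which the limit is proved first.
    Almost surely its whole path equals that of the given walk, so all expectations of test
    functions coincide.\<close>
  define S where "S k \<omega> = (\<Sum>j=1..k. Y j \<omega>)" for k \<omega>
  have Z_meas: "Z \<in> borel_measurable N" using Z(2) by (simp add: distributed_def)
  have Y_weak: "converges_weakly skorohod_topology M (\<lambda>n \<omega>. step_path n (\<sigma>_seq p \<mu> n) (\<lambda>k. S k \<omega>))
      N (\<lambda>\<omega>. root_path (2 * \<gamma> + 1) (Z \<omega>))"
  proof (rule converges_weakly_root_path[OF _ W_measurable Z_meas])
    show "S k \<in> borel_measurable M" for k unfolding S_def[abs_def] by measurable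
    fix g :: "real \<Rightarrow> real" assume g: "continuous_on UNIV g" "bounded (range g)"
    have [measurable]: "g \<in> borel_measurable borel" using g(1) by (rule borel_measurable_continuous_onI)
    have "(\<integral>\<omega>. g (Z \<omega>) \<partial>N) = integral\<^sup>L (distr N lborel Z) g"
      using Z_meas by (intro integral_distr[symmetric]) auto
    also have "distr N lborel Z = std_normal_distribution" using Z(2) by (simp add: distributed_def)
    finally show "(\<lambda>n. expectation (\<lambda>\<omega>. g (W n \<omega>))) \<longlonglongrightarrow> (\<integral>\<omega>. g (Z \<omega>) \<partial>N)"
      using W_weak_limit[OF g] by simp
  next
    fix e :: real assume e: "e > 0"
    have "prob {\<omega> \<in> space M. \<bar>W n \<omega>\<bar> > 1 / e} \<le> e" if "n \<ge> 1" for n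
    proof -
      have "prob {\<omega> \<in> space M. \<bar>W n \<omega>\<bar> > 1 / e} \<le> prob {\<omega> \<in> space M. \<bar>W n \<omega>\<bar> \<ge> 1 / e}"
        by (intro finite_measure_mono) auto
      also have "\<dots> \<le> e" using W_tail[OF that, of "1 / e"] e by simp
      finally show ?thesis .
    qed
    then show "\<exists>k. eventually (\<lambda>n. prob {\<omega> \<in> space M. \<bar>W n \<omega>\<bar> > k} \<le> e) sequentially"
      by (intro exI[of _ "1 / e"] eventually_sequentiallyI[of 1])
  next
    fix m :: nat and d e :: real assume "d > 0" "e > 0"
    then show "\<exists>A. (\<forall>n. A n \<in> events) \<and> eventually (\<lambda>n. prob (A n) \<le> e) sequentially \<and>
      eventually (\<lambda>n. \<forall>\<omega>\<in>space M - A n. \<forall>t. 0 \<le> t \<longrightarrow> t \<le> real m \<longrightarrow>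
        \<bar>S (nat \<lfloor>real n * t\<rfloor>) \<omega> / \<sigma>_seq p \<mu> n - sqrt t * (2 * \<gamma> + 1) * W n \<omega>\<bar> \<le> d) sequentially"
      unfolding S_def by (rule walk_near_root_path)
  qed
  have walk_meas: "walk X k \<in> borel_measurable M" for k
    unfolding walk_def[abs_def] by (intro borel_measurable_sum X_measurable) auto
  have meas: "(\<lambda>\<omega>. step_path n (\<sigma>_seq p \<mu> n) (\<lambda>k. walk X k \<omega>)) \<in> measurable M (borel_sigma skorohod_topology)" for n
    by (rule step_path_measurable[OF walk_meas])
  have ae: "AE \<omega> in M. step_path n (\<sigma>_seq p \<mu> n) (\<lambda>k. walk X k \<omega>) = step_path n (\<sigma>_seq p \<mu> n) (\<lambda>k. S k \<omega>)" for n
    using X_eq_Y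
  proof eventually_elim
    case (elim \<omega>)
    then have "(\<lambda>k. walk X k \<omega>) = (\<lambda>k. S k \<omega>)" unfolding walk_def S_def by (intro ext sum.cong) auto
    then show ?case by simp
  qed
  have "converges_weakly skorohod_topology M (\<lambda>n \<omega>. step_path n (\<sigma>_seq p \<mu> n) (\<lambda>k. walk X k \<omega>))
      N (\<lambda>\<omega>. root_path (2 * \<gamma> + 1) (Z \<omega>))"
    unfolding converges_weakly_def
  proof (intro conjI allI impI meas)
    show "(\<lambda>\<omega>. root_path (2 * \<gamma> + 1) (Z \<omega>)) \<in> measurable N (borel_sigma skorohod_topology)"
      using Y_weak by (simp add: converges_weakly_def)
    fix f assume f: "continuous_map skorohod_topology euclideanreal f" "bounded (f ` topspace skorohod_topology)"
    have "(\<lambda>n. expectation (\<lambda>\<omega>. f (step_path n (\<sigma>_seq p \<mu> n) (\<lambda>k. S k \<omega>)))) \<longlonglongrightarrow> (\<integral>\<omega>. f (root_path (2 * \<gamma> + 1) (Z \<omega>)) \<partial>N)"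
      using Y_weak f by (simp add: converges_weakly_def)
    moreover have "expectation (\<lambda>\<omega>. f (step_path n (\<sigma>_seq p \<mu> n) (\<lambda>k. S k \<omega>))) = expectation (\<lambda>\<omega>. f (step_path n (\<sigma>_seq p \<mu> n) (\<lambda>k. walk X k \<omega>)))" for n
    proof (rule integral_cong_AE)
      have S_meas: "(\<lambda>\<omega>. step_path n (\<sigma>_seq p \<mu> n) (\<lambda>k. S k \<omega>)) \<in> measurable M (borel_sigma skorohod_topology)"
        using Y_weak by (simp add: converges_weakly_def)
      show "(\<lambda>\<omega>. f (step_path n (\<sigma>_seq p \<mu> n) (\<lambda>k. S k \<omega>))) \<in> borel_measurable M"
        by (rule measurable_compose[OF S_meas continuous_map_borel_sigma[OF f(1)]])
      show "(\<lambda>\<omega>. f (step_path n (\<sigma>_seq p \<mu> n) (\<lambda>k. walk X k \<omega>))) \<in> borel_measurable M"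
        by (rule measurable_compose[OF meas continuous_map_borel_sigma[OF f(1)]])
      show "AE \<omega> in M. f (step_path n (\<sigma>_seq p \<mu> n) (\<lambda>k. S k \<omega>)) = f (step_path n (\<sigma>_seq p \<mu> n) (\<lambda>k. walk X k \<omega>))"
        using ae[of n] by eventually_elim simp
    qed
    ultimately show "(\<lambda>n. expectation (\<lambda>\<omega>. f (step_path n (\<sigma>_seq p \<mu> n) (\<lambda>k. walk X k \<omega>)))) \<longlonglongrightarrow> (\<integral>\<omega>. f (root_path (2 * \<gamma> + 1) (Z \<omega>)) \<partial>N)"
      by simp
  qed
  then show ?thesis by (simp only: step_path_def root_path_def)
qed

end
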